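(* Let $G$ be a countable discrete group acting by homeomorphisms on a compact Hausdorff topological space $X$. Then the following are equivalent: (1) The action of $G$ on $X$ is topologically amenable. (2) The Johnson class $[J]\in H_b^1(G,N_0(G,X)^{**})$ is trivial. (3) $H_b^p(G,\mathcal{E}^* )=0$ for every $p\geq 1$ and every $\ell^1$-geometric $G$-$C(X)$-module $\mathcal{E}$.
   Context: $X$ is nonempty. $C(X)$ is the Banach algebra of real-valued continuous functions on $X$ with the supremum norm; $1_X$ is the constant function $1$. $G$ acts on $C(X)$ by $(g\cdot t)(x)=t(g^{-1}x)$. All Banach spaces are real. For a function $f:G\to C(X)$ write $f_g\in C(X)$ for its value at $g\in G$, and set $\|f\|_{\infty,1}=\sup_{x\in X}\sum_{g\in G}|f_g(x)|$. $V$ denotes the Banach space of all $f:G\to C(X)$ with $\|f\|_{\infty,1}<\infty$ (so $\|\cdot\|_V=\|\cdot\|_{\infty,1}$). $G$ acts isometrically on $V$ by $(gf)_h(x)=f_{g^{-1}h}(g^{-1}x)$. $W_{00}(G,X)\subseteq V$ is the subspace of finitely supported $f:G\to C(X)$ such that $\sum_{g\in G}f_g=c\,1_X$ for some $c\in\mathbb{R}$ depending on $f$. $W_0(G,X)$ is its closure in $V$. The map $\pi:W_{00}(G,X)\to\mathbb{R}$ is defined by $\sum_{g\in G}f_g=\pi(f)1_X$ and is extended by continuity to $W_0(G,X)$. $N_0(G,X)=\ker(\pi:W_0(G,X)\to\mathbb{R})$, a $G$-invariant closed subspace. Topological amenability: the action of $G$ on $X$ is (topologically) amenable if there exists a sequence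 $f^n\in W_{00}(G,X)$ such that (1) $f^n_g\ge 0$ for all $n$ and $g\in G$; (2) $\pi(f^n)=1$ for all $n$; (3) for each $g\in G$, $\|f^n-gf^n\|_V\to 0$. Modules: a $C(X)$-module is a Banach space $\mathcal{E}$ with a contractive unital representation of the Banach algebra $C(X)$ (so $\|tv\|\le\|t\|_\infty\|v\|$ and $1_Xv=v$). It is a $G$-$C(X)$-module if moreover $G$ acts on $\mathcal{E}$ by linear isometries and the representation of $C(X)$ is $G$-equivariant: $g(tv)=(g\cdot t)(gv)$. Vectors $v_1,v_2\in\mathcal{E}$ are disjointly supported if there exist $f_1,f_2\in C(X)$ with disjoint (closed) supports such that $f_1v_1=v_1$ and $f_2v_2=v_2$. $\mathcal{E}$ is $\ell^1$-geometric if $\|v_1+v_2\|=\|v_1\|+\|v_2\|$ for all disjointly supported $v_1,v_2\in\mathcal{E}$. Bounded cohomology: if $G$ acts isometrically on a Banach space $\mathcal{E}$, it acts on the dual $\mathcal{E}^*$ by $\langle g\alpha,v\rangle=\langle\alpha,g^{-1}v\rangle$ (and likewise on the double dual). $C^m_b(G,\mathcal{E}^* )$ is the space of bounded $G$-equivariant functions $\phi:G^{m+1}\to\mathcal{E}^*$, i.e. $\phi(kg_0,\dots,kg_m)=k\,\phi(g_0,\dots,g_m)$, with the differential of the homogeneous bar resolution $(d\phi)(g_0,\dots,g_{m+1})=\sum_{i=0}^{m+1}(-1)^i\phi(g_0,\dots,\widehat{g_i},\dots,g_{m+1})$. $H^*_b(G,\mathcal{E}^* )$ is the cohomology of this complex.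 Johnson class: for $g\in G$, $\delta_g\in W_{00}(G,X)$ is given by $(\delta_g)_h=1_X$ if $h=g$ and $0$ otherwise. The function $J(g_0,g_1)=\delta_{g_1}-\delta_{g_0}$ takes values in $N_0(G,X)$, regarded as a subspace of $N_0(G,X)^{**}$ via the canonical embedding; it is a bounded 1-cocycle, and its class $[J]\in H^1_b(G,N_0(G,X)^{**})$ (with coefficient module the dual of $N_0(G,X)^*$) is the Johnson class of the action. *)

theory Defs
  imports "HOL-Analysis.Analysis"
begin

section \<open>The Banach algebra of bounded continuous functions\<close>

text \<open>On a compact space every continuous function is bounded, so there
  \<^typ>\<open>'x::topological_space \<Rightarrow>\<^sub>C real\<close> is the Banach algebra \<open>C(X)\<close>.\<close>

instantiation bcontfun :: (topological_space, real_normed_algebra) real_normed_algebra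
begin

definition times_bcontfun :: "('a \<Rightarrow>\<^sub>C 'b) \<Rightarrow> ('a \<Rightarrow>\<^sub>C 'b) \<Rightarrow> ('a \<Rightarrow>\<^sub>C 'b)"
  where "times_bcontfun s t = Bcontfun (\<lambda>x. apply_bcontfun s x * apply_bcontfun t x)"

lemma apply_bcontfun_times [simp]:
  "apply_bcontfun (s * t) x = apply_bcontfun s x * apply_bcontfun t x"
proof -
  have "(\<lambda>x. apply_bcontfun s x * apply_bcontfun t x) \<in> bcontfun"
  proof (rule bcontfun_normI)
    show "continuous_on UNIV (\<lambda>x. apply_bcontfun s x * apply_bcontfun t x)"
      by (intro continuous_intros continuous_on_apply_bcontfun)
    show "norm (apply_bcontfun s x * apply_bcontfun t x) \<le> norm s * norm t" for x
      by (meson mult_mono' norm_bounded norm_ge_zero norm_mult_ineq order_trans)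
  qed
  then show ?thesis by (simp add: times_bcontfun_def Bcontfun_inverse)
qed

instance
proof
  fix s t u :: "'a \<Rightarrow>\<^sub>C 'b" and r :: real
  show "norm (s * t) \<le> norm s * norm t"
  proof (rule norm_bound)
    fix x
    have "norm (apply_bcontfun s x * apply_bcontfun t x) \<le>
        norm (apply_bcontfun s x) * norm (apply_bcontfun t x)"
      by (rule norm_mult_ineq)
    also have "\<dots> \<le> norm s * norm t"
      by (intro mult_mono norm_bounded) auto
    finally show "norm (apply_bcontfun (s * t) x) \<le> norm s * norm t" by simp
  qed
  show "s * t * u = s * (t * u)" by (rule bcontfun_eqI) (simp add: mult.assoc)
  show "(s + t) * u = s * u + t * u" by (rule bcontfun_eqI) (simp add: distrib_right)
  show "s * (t + u) = s * t + s * u" by (rule bcontfun_eqI) (simp add: distrib_left)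
  show "r *\<^sub>R s * t = r *\<^sub>R (s * t)" by (rule bcontfun_eqI) simp
  show "s * r *\<^sub>R t = r *\<^sub>R (s * t)" by (rule bcontfun_eqI) simp
qed

end

instantiation bcontfun :: (topological_space, real_normed_algebra_1) real_normed_algebra_1
begin

definition one_bcontfun :: "'a \<Rightarrow>\<^sub>C 'b"
  where "one_bcontfun = const_bcontfun 1"

lemma apply_bcontfun_one [simp]: "apply_bcontfun 1 x = 1"
  by (simp add: one_bcontfun_def)

instance
proof
  show "norm (1 :: 'a \<Rightarrow>\<^sub>C 'b) = 1"
  proof (rule antisym)
    show "norm (1 :: 'a \<Rightarrow>\<^sub>C 'b) \<le> 1"
      by (rule norm_bound) simp
    show "1 \<le> norm (1 :: 'a \<Rightarrow>\<^sub>C 'b)"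
      using norm_bounded[of "1 :: 'a \<Rightarrow>\<^sub>C 'b" undefined] by simp
  qed
  show "(0 :: 'a \<Rightarrow>\<^sub>C 'b) \<noteq> 1"
  proof
    assume "(0 :: 'a \<Rightarrow>\<^sub>C 'b) = 1"
    then have "apply_bcontfun (0 :: 'a \<Rightarrow>\<^sub>C 'b) undefined = apply_bcontfun 1 undefined"
      by (rule arg_cong)
    then show False by simp
  qed
  show "1 * t = t" for t :: "'a \<Rightarrow>\<^sub>C 'b" by (rule bcontfun_eqI) simp
  show "t * 1 = t" for t :: "'a \<Rightarrow>\<^sub>C 'b" by (rule bcontfun_eqI) simp
qed

end

lemma apply_bcontfun_sum:
  "apply_bcontfun (\<Sum>i\<in>A. f i) x = (\<Sum>i\<in>A. apply_bcontfun (f i) x)"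
  by (induction A rule: infinite_finite_induct) auto


section \<open>Actions\<close>

text \<open>Groups are written additively; \<^class>\<open>group_add\<close> does not assume commutativity.\<close>

definition group_act :: "('g::group_add \<Rightarrow> 'a \<Rightarrow> 'a) \<Rightarrow> bool"
  where "group_act act \<longleftrightarrow>
    (\<forall>x. act 0 x = x) \<and> (\<forall>g h x. act (g + h) x = act g (act h x))"

definition homeo_action :: "('g::group_add \<Rightarrow> 'x::topological_space \<Rightarrow> 'x) \<Rightarrow> bool"
  where "homeo_action act \<longleftrightarrow>
    group_act act \<and> (\<forall>g. homeomorphism UNIV UNIV (act g) (act (- g)))"

definition isometric_action :: "('g::group_add \<Rightarrow> 'e::real_normed_vector \<Rightarrow> 'e) \<Rightarrow> bool"
  where "isometric_action \<alpha> \<longleftrightarrow>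
    group_act \<alpha> \<and> (\<forall>g. linear (\<alpha> g)) \<and> (\<forall>g v. norm (\<alpha> g v) = norm v)"

lemma group_act_cancel:
  assumes "group_act act"
  shows "act (- g) (act g x) = x" "act g (act (- g) x) = x"
  using assms unfolding group_act_def by (metis left_minus, metis right_minus)

lemma group_act_minus_add:
  assumes "group_act act"
  shows "act (- (g + h)) x = act (- h) (act (- g) x)"
  using assms unfolding group_act_def by (metis minus_add)

definition dual_act ::
    "('g::group_add \<Rightarrow> 'e::real_normed_vector \<Rightarrow> 'e) \<Rightarrow> 'g \<Rightarrow> ('e \<Rightarrow>\<^sub>L real) \<Rightarrow> ('e \<Rightarrow>\<^sub>L real)"
  where "dual_act \<alpha> g \<phi> = Blinfun (\<lambda>v. blinfun_apply \<phi> (\<alpha> (- g) v))"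

lemma dual_act_apply:
  assumes "isometric_action \<alpha>"
  shows "blinfun_apply (dual_act \<alpha> g \<phi>) v = blinfun_apply \<phi> (\<alpha> (- g) v)"
proof -
  have "bounded_linear (\<alpha> (- g))"
    using assms unfolding isometric_action_def
    by (auto intro!: bounded_linear_intro[where K = 1] simp: linear_add linear_scale)
  then have "bounded_linear (\<lambda>v. blinfun_apply \<phi> (\<alpha> (- g) v))"
    by (rule bounded_linear_compose[OF blinfun.bounded_linear_right])
  then show ?thesis by (simp add: dual_act_def bounded_linear_Blinfun_apply)
qed

lemma isometric_action_dual:
  assumes \<alpha>: "isometric_action \<alpha>"
  shows "isometric_action (dual_act \<alpha>)"
proof -
  note [simp] = dual_act_apply[OF \<alpha>]
  have ga: "group_act \<alpha>" and iso: "\<And>g v. norm (\<alpha> g v) = norm v"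
    using \<alpha> by (auto simp: isometric_action_def)
  have le: "norm (dual_act \<alpha> g \<phi>) \<le> norm \<phi>" for g \<phi>
  proof (rule norm_blinfun_bound)
    show "norm (blinfun_apply (dual_act \<alpha> g \<phi>) v) \<le> norm \<phi> * norm v" for v
      using norm_blinfun[of \<phi> "\<alpha> (- g) v"] by (simp add: iso)
  qed simp
  have ga': "group_act (dual_act \<alpha>)"
    unfolding group_act_def
    by (intro conjI allI blinfun_eqI)
      (use ga in \<open>simp_all add: group_act_minus_add[OF ga] group_act_def del: minus_add_distrib\<close>)
  have "norm \<phi> \<le> norm (dual_act \<alpha> g \<phi>)" for g \<phi>
    using le[of "- g" "dual_act \<alpha> g \<phi>"] group_act_cancel(1)[OF ga'] by simp
  then have "norm (dual_act \<alpha> g \<phi>) = norm \<phi>" for g \<phi>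
    using le by (intro antisym)
  moreover have "linear (dual_act \<alpha> g)" for g
    by (intro linearI blinfun_eqI) (simp_all add: blinfun.bilinear_simps)
  ultimately show ?thesis
    using ga' by (simp add: isometric_action_def)
qed

definition C_act :: "('g::group_add \<Rightarrow> 'x::topological_space \<Rightarrow> 'x) \<Rightarrow> 'g \<Rightarrow>
    ('x \<Rightarrow>\<^sub>C real) \<Rightarrow> ('x \<Rightarrow>\<^sub>C real)"
  where "C_act act g t = Bcontfun (\<lambda>x. apply_bcontfun t (act (- g) x))"

lemma apply_C_act:
  assumes "homeo_action act"
  shows "apply_bcontfun (C_act act g t) x = apply_bcontfun t (act (- g) x)"
proof -
  have "continuous_on UNIV (act (- g))"
    using assms by (auto simp: homeo_action_def homeomorphism_def)
  then have "continuous_on UNIV (\<lambda>x. apply_bcontfun t (act (- g) x))"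
    by (intro continuous_on_compose2[OF continuous_on_apply_bcontfun[of UNIV t]]) auto
  then have "(\<lambda>x. apply_bcontfun t (act (- g) x)) \<in> bcontfun"
    by (rule bcontfun_normI) (rule norm_bounded)
  then show ?thesis by (simp add: C_act_def Bcontfun_inverse)
qed


section \<open>The space \<open>V\<close>\<close>

text \<open>The explicit summability condition is needed because \<^const>\<open>infsum\<close> of a divergent family
  is \<open>0\<close>.\<close>

typedef (overloaded) ('g, 'x) ell1_sup =
  "{f :: 'g \<Rightarrow> 'x::topological_space \<Rightarrow>\<^sub>C real.
      (\<forall>x. (\<lambda>g. \<bar>apply_bcontfun (f g) x\<bar>) summable_on UNIV) \<and>
      bdd_above (range (\<lambda>x. \<Sum>\<^sub>\<infinity>g. \<bar>apply_bcontfun (f g) x\<bar>))}"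
  morphisms coord Abs_ell1_sup
  by (intro exI[of _ "\<lambda>_. 0"]) auto

setup_lifting type_definition_ell1_sup

lemma coord_eqI: "(\<And>g. coord f g = coord f' g) \<Longrightarrow> f = f'"
  by (simp add: coord_inject[symmetric] fun_eq_iff)

definition sup_bounded_by :: "real \<Rightarrow> ('g \<Rightarrow> 'x::topological_space \<Rightarrow>\<^sub>C real) \<Rightarrow> bool"
  where "sup_bounded_by B f \<longleftrightarrow> (\<forall>F x. finite F \<longrightarrow> (\<Sum>g\<in>F. \<bar>apply_bcontfun (f g) x\<bar>) \<le> B)"

lemma sup_bounded_byD:
  assumes "sup_bounded_by B f"
  shows "(\<lambda>g. \<bar>apply_bcontfun (f g) x\<bar>) summable_on UNIV"
    "(\<Sum>\<^sub>\<infinity>g. \<bar>apply_bcontfun (f g) x\<bar>) \<le> B"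
proof -
  show s: "(\<lambda>g. \<bar>apply_bcontfun (f g) x\<bar>) summable_on UNIV"
    using assms by (intro nonneg_bdd_above_summable_on) (auto simp: sup_bounded_by_def bdd_above_def)
  show "(\<Sum>\<^sub>\<infinity>g. \<bar>apply_bcontfun (f g) x\<bar>) \<le> B"
    using assms by (intro infsum_le_finite_sums[OF s]) (auto simp: sup_bounded_by_def)
qed

lemma ell1_sup_iff:
  "((\<forall>x. (\<lambda>g. \<bar>apply_bcontfun (f g) x\<bar>) summable_on UNIV) \<and>
      bdd_above (range (\<lambda>x. \<Sum>\<^sub>\<infinity>g. \<bar>apply_bcontfun (f g) x\<bar>))) \<longleftrightarrow> (\<exists>B. sup_bounded_by B f)"
  (is "?l \<longleftrightarrow> ?r")
proof
  assume l: ?l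
  then obtain B where B: "\<And>x. (\<Sum>\<^sub>\<infinity>g. \<bar>apply_bcontfun (f g) x\<bar>) \<le> B"
    by (auto simp: bdd_above_def)
  have "(\<Sum>g\<in>F. \<bar>apply_bcontfun (f g) x\<bar>) \<le> B" if "finite F" for F x
    using finite_sum_le_infsum[of "\<lambda>g. \<bar>apply_bcontfun (f g) x\<bar>" UNIV F] that l B[of x]
    by force
  then show ?r by (auto simp: sup_bounded_by_def)
next
  assume ?r
  then show ?l using sup_bounded_byD by (auto simp: bdd_above_def) blast+
qed

lemma coord_Abs:
  assumes "sup_bounded_by B f"
  shows "coord (Abs_ell1_sup f) = f"
  using ell1_sup_iff[of f] assms by (subst Abs_ell1_sup_inverse) auto

lemma sup_bounded_by_coord: "\<exists>B. sup_bounded_by B (coord f)"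
  using coord[of f] ell1_sup_iff[of "coord f"] by simp

lemma summable_coord: "(\<lambda>g. \<bar>apply_bcontfun (coord f g) x\<bar>) summable_on UNIV"
  using coord[of f] by simp

lemma sup_bounded_by_add:
  "sup_bounded_by B f \<Longrightarrow> sup_bounded_by B' f' \<Longrightarrow> sup_bounded_by (B + B') (\<lambda>g. f g + f' g)"
  unfolding sup_bounded_by_def
  by (auto intro!: order_trans[OF sum_mono[OF abs_triangle_ineq]] add_mono simp: sum.distrib)

lemma sup_bounded_by_scale:
  "sup_bounded_by B f \<Longrightarrow> sup_bounded_by (\<bar>c\<bar> * B) (\<lambda>g. c *\<^sub>R f g)"
  unfolding sup_bounded_by_def
  by (auto simp: abs_mult sum_distrib_left[symmetric] intro!: mult_left_mono)

lemma sup_bounded_by_uminus: "sup_bounded_by B f \<Longrightarrow> sup_bounded_by B (\<lambda>g. - f g)"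
  by (simp add: sup_bounded_by_def)

lemma sup_bounded_by_diff:
  "sup_bounded_by B f \<Longrightarrow> sup_bounded_by B' f' \<Longrightarrow> sup_bounded_by (B + B') (\<lambda>g. f g - f' g)"
  using sup_bounded_by_add[OF _ sup_bounded_by_uminus, of B f B' f'] by simp

instantiation ell1_sup :: (type, topological_space) real_vector
begin

lift_definition zero_ell1_sup :: "('a, 'b) ell1_sup" is "\<lambda>_. 0"
  by auto

lift_definition plus_ell1_sup ::
  "('a, 'b) ell1_sup \<Rightarrow> ('a, 'b) ell1_sup \<Rightarrow> ('a, 'b) ell1_sup" is "\<lambda>f f' g. f g + f' g"
  using sup_bounded_by_add unfolding ell1_sup_iff by blast

lift_definition minus_ell1_sup ::
  "('a, 'b) ell1_sup \<Rightarrow> ('a, 'b) ell1_sup \<Rightarrow> ('a, 'b) ell1_sup" is "\<lambda>f f' g. f g - f' g"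
  using sup_bounded_by_diff unfolding ell1_sup_iff by blast

lift_definition uminus_ell1_sup ::
  "('a, 'b) ell1_sup \<Rightarrow> ('a, 'b) ell1_sup" is "\<lambda>f g. - f g"
  using sup_bounded_by_uminus unfolding ell1_sup_iff by blast

lift_definition scaleR_ell1_sup ::
  "real \<Rightarrow> ('a, 'b) ell1_sup \<Rightarrow> ('a, 'b) ell1_sup" is "\<lambda>c f g. c *\<^sub>R f g"
  using sup_bounded_by_scale unfolding ell1_sup_iff by blast

instance
proof
  fix f f' f'' :: "('a, 'b) ell1_sup" and a b :: real
  show "f + f' + f'' = f + (f' + f'')" "f + f' = f' + f" "0 + f = f" "- f + f = 0"
    "f - f' = f + - f'" "a *\<^sub>R (f + f') = a *\<^sub>R f + a *\<^sub>R f'" "(a + b) *\<^sub>R f = a *\<^sub>R f + b *\<^sub>R f"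
    "a *\<^sub>R b *\<^sub>R f = (a * b) *\<^sub>R f" "1 *\<^sub>R f = f"
    by (transfer, simp add: fun_eq_iff algebra_simps)+
qed

end

instantiation ell1_sup :: (type, topological_space) real_normed_vector
begin

definition norm_ell1_sup :: "('a, 'b) ell1_sup \<Rightarrow> real"
  where "norm_ell1_sup f = (SUP x. \<Sum>\<^sub>\<infinity>g. \<bar>apply_bcontfun (coord f g) x\<bar>)"

definition dist_ell1_sup :: "('a, 'b) ell1_sup \<Rightarrow> ('a, 'b) ell1_sup \<Rightarrow> real"
  where "dist_ell1_sup f f' = norm (f - f')"

definition sgn_ell1_sup :: "('a, 'b) ell1_sup \<Rightarrow> ('a, 'b) ell1_sup"
  where "sgn_ell1_sup f = f /\<^sub>R norm f"

definition uniformity_ell1_sup :: "(('a, 'b) ell1_sup \<times> ('a, 'b) ell1_sup) filter"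
  where "uniformity_ell1_sup = (INF e\<in>{0 <..}. principal {(x, y). dist x y < e})"

definition open_ell1_sup :: "('a, 'b) ell1_sup set \<Rightarrow> bool"
  where "open_ell1_sup S = (\<forall>x\<in>S. \<forall>\<^sub>F (x', y) in uniformity. x' = x \<longrightarrow> y \<in> S)"

lemma norm_ell1_sup_iff: "norm (f :: ('a, 'b) ell1_sup) \<le> B \<longleftrightarrow> sup_bounded_by B (coord f)"
proof
  assume B: "norm f \<le> B"
  show "sup_bounded_by B (coord f)"
    unfolding sup_bounded_by_def
  proof (intro allI impI)
    fix F :: "'a set" and x :: 'b
    assume "finite F"
    then have "(\<Sum>g\<in>F. \<bar>apply_bcontfun (coord f g) x\<bar>) \<le> (\<Sum>\<^sub>\<infinity>g. \<bar>apply_bcontfun (coord f g) x\<bar>)"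
      by (intro finite_sum_le_infsum summable_coord) auto
    also have "\<dots> \<le> norm f"
      unfolding norm_ell1_sup_def using coord[of f] by (intro cSUP_upper) auto
    finally show "(\<Sum>g\<in>F. \<bar>apply_bcontfun (coord f g) x\<bar>) \<le> B" using B by simp
  qed
next
  assume "sup_bounded_by B (coord f)"
  then show "norm f \<le> B"
    unfolding norm_ell1_sup_def by (intro cSUP_least sup_bounded_byD) auto
qed

lemma sup_bounded_by_norm: "sup_bounded_by (norm f) (coord (f :: ('a, 'b) ell1_sup))"
  using norm_ell1_sup_iff by blast

lemma norm_coord_le: "\<bar>apply_bcontfun (coord (f :: ('a, 'b) ell1_sup) g) x\<bar> \<le> norm f"
  using sup_bounded_by_norm[of f, unfolded sup_bounded_by_def, rule_format, of "{g}" x] by simp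

instance
proof
  fix f :: "('a, 'b) ell1_sup" and a :: real
  show tri: "norm (f + f') \<le> norm f + norm f'" for f f' :: "('a, 'b) ell1_sup"
    using sup_bounded_by_add[OF sup_bounded_by_norm sup_bounded_by_norm]
    by (simp add: norm_ell1_sup_iff plus_ell1_sup.rep_eq)
  have sc: "norm (a *\<^sub>R f) \<le> \<bar>a\<bar> * norm f" for a and f :: "('a, 'b) ell1_sup"
    using sup_bounded_by_scale[OF sup_bounded_by_norm]
    by (simp add: norm_ell1_sup_iff scaleR_ell1_sup.rep_eq)
  have "0 \<le> norm f"
    using norm_coord_le[of f undefined undefined] by linarith
  have n0: "norm (0 :: ('a, 'b) ell1_sup) = 0"
    by (simp add: norm_ell1_sup_def zero_ell1_sup.rep_eq)
  show "norm f = 0 \<longleftrightarrow> f = 0"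
  proof
    assume "norm f = 0"
    then have "apply_bcontfun (coord f g) x = 0" for g x
      using norm_coord_le[of f g x] by simp
    then show "f = 0" by (auto intro!: coord_eqI bcontfun_eqI simp: zero_ell1_sup.rep_eq)
  qed (simp add: n0)
  show "norm (a *\<^sub>R f) = \<bar>a\<bar> * norm f"
  proof (cases "a = 0")
    case True
    then have "a *\<^sub>R f = 0" by (transfer, simp)
    with True n0 show ?thesis by simp
  next
    case False
    have "inverse a *\<^sub>R a *\<^sub>R f = f"
      using False by (transfer, simp)
    then have "norm f \<le> \<bar>inverse a\<bar> * norm (a *\<^sub>R f)" using sc by metis
    then have "\<bar>a\<bar> * norm f \<le> norm (a *\<^sub>R f)"
      using False by (simp add: field_simps)
    with sc show ?thesis by (simp add: antisym)
  qed
qed (rule dist_ell1_sup_def sgn_ell1_sup_def uniformity_ell1_sup_def open_ell1_sup_def)+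

end

instance ell1_sup :: (type, topological_space) banach
proof
  fix X :: "nat \<Rightarrow> ('a, 'b) ell1_sup"
  assume X: "Cauchy X"
  have Xx: "Cauchy (\<lambda>n. apply_bcontfun (coord (X n) g) x)" for g x
    unfolding Cauchy_def
  proof (intro allI impI)
    fix e :: real
    assume "0 < e"
    then obtain M where M: "\<forall>m\<ge>M. \<forall>n\<ge>M. norm (X m - X n) < e"
      using X unfolding Cauchy_iff by blast
    have "dist (apply_bcontfun (coord (X m) g) x) (apply_bcontfun (coord (X n) g) x) \<le> norm (X m - X n)"
      for m n
      using norm_coord_le[of "X m - X n" g x] by (simp add: dist_real_def minus_ell1_sup.rep_eq)
    with M show "\<exists>M. \<forall>m\<ge>M. \<forall>n\<ge>M.
        dist (apply_bcontfun (coord (X m) g) x) (apply_bcontfun (coord (X n) g) x) < e"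
      by (meson le_less_trans)
  qed
  define L where "L g x = lim (\<lambda>n. apply_bcontfun (coord (X n) g) x)" for g x
  have L: "(\<lambda>n. apply_bcontfun (coord (X n) g) x) \<longlonglongrightarrow> L g x" for g x
    using Xx unfolding L_def by (simp add: Cauchy_convergent_iff convergent_LIMSEQ_iff)
  have sumL: "\<exists>M. \<forall>m\<ge>M. \<forall>F x. finite F \<longrightarrow>
      (\<Sum>g\<in>F. \<bar>apply_bcontfun (coord (X m) g) x - L g x\<bar>) \<le> e" if "0 < e" for e :: real
  proof -
    obtain M where M: "\<And>m n. m \<ge> M \<Longrightarrow> n \<ge> M \<Longrightarrow> norm (X m - X n) < e"
      using X \<open>0 < e\<close> unfolding Cauchy_iff by blast
    have "(\<Sum>g\<in>F. \<bar>apply_bcontfun (coord (X m) g) x - L g x\<bar>) \<le> e"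
      if "m \<ge> M" "finite F" for m F x
    proof (rule LIMSEQ_le_const2)
      show "(\<lambda>n. \<Sum>g\<in>F. \<bar>apply_bcontfun (coord (X m) g) x - apply_bcontfun (coord (X n) g) x\<bar>)
          \<longlonglongrightarrow> (\<Sum>g\<in>F. \<bar>apply_bcontfun (coord (X m) g) x - L g x\<bar>)"
        by (intro tendsto_intros L)
      have "(\<Sum>g\<in>F. \<bar>apply_bcontfun (coord (X m) g) x - apply_bcontfun (coord (X n) g) x\<bar>) \<le> e"
        if "n \<ge> M" for n
        using sup_bounded_by_norm[of "X m - X n", unfolded sup_bounded_by_def, rule_format, of F x]
          M[OF \<open>m \<ge> M\<close> that] \<open>finite F\<close>
        by (simp add: minus_ell1_sup.rep_eq)
      then show "\<exists>N. \<forall>n\<ge>N.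
          (\<Sum>g\<in>F. \<bar>apply_bcontfun (coord (X m) g) x - apply_bcontfun (coord (X n) g) x\<bar>) \<le> e"
        by blast
    qed
    then show ?thesis by blast
  qed
  have "\<exists>t :: 'b \<Rightarrow>\<^sub>C real. L g = apply_bcontfun t" for g
  proof -
    have "uniform_limit UNIV (\<lambda>n. apply_bcontfun (coord (X n) g)) (L g) sequentially"
    proof (rule uniform_limitI)
      fix e :: real
      assume "0 < e"
      then obtain M where M: "\<And>m F x. m \<ge> M \<Longrightarrow> finite F \<Longrightarrow>
          (\<Sum>g\<in>F. \<bar>apply_bcontfun (coord (X m) g) x - L g x\<bar>) \<le> e / 2"
        using sumL[of "e / 2"] by auto
      have "dist (apply_bcontfun (coord (X m) g) x) (L g x) < e" if "m \<ge> M" for m x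
        using M[OF that, of "{g}" x] \<open>0 < e\<close> by (simp add: dist_real_def)
      then show "\<forall>\<^sub>F n in sequentially. \<forall>x\<in>UNIV. dist (apply_bcontfun (coord (X n) g) x) (L g x) < e"
        by (auto simp: eventually_sequentially)
    qed
    from uniform_limit_bcontfunE[OF this sequentially_bot] show ?thesis by metis
  qed
  then obtain l :: "'a \<Rightarrow> 'b \<Rightarrow>\<^sub>C real" where l: "\<And>g. L g = apply_bcontfun (l g)"
    by metis
  have bd: "\<exists>M. \<forall>m\<ge>M. sup_bounded_by e (\<lambda>g. coord (X m) g - l g)" if "0 < e" for e :: real
    using sumL[OF that] by (simp add: sup_bounded_by_def l)
  obtain M where "sup_bounded_by 1 (\<lambda>g. coord (X M) g - l g)"
    using bd[of 1] by auto
  from sup_bounded_by_diff[OF sup_bounded_by_norm[of "X M"] this]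
  have "sup_bounded_by (norm (X M) + 1) l" by simp
  then have cl: "coord (Abs_ell1_sup l) = l" by (rule coord_Abs)
  have "X \<longlonglongrightarrow> Abs_ell1_sup l"
  proof (rule LIMSEQ_I)
    fix e :: real
    assume "0 < e"
    then obtain M where "\<forall>m\<ge>M. sup_bounded_by (e / 2) (\<lambda>g. coord (X m) g - l g)"
      using bd[of "e / 2"] by auto
    then have "\<forall>m\<ge>M. norm (X m - Abs_ell1_sup l) \<le> e / 2"
      unfolding norm_ell1_sup_iff minus_ell1_sup.rep_eq cl .
    then show "\<exists>no. \<forall>n\<ge>no. norm (X n - Abs_ell1_sup l) < e"
      using \<open>0 < e\<close> by (intro exI[of _ M]) force
  qed
  then show "convergent X" by (rule convergentI)
qed

definition V_act :: "('g::group_add \<Rightarrow> 'x::topological_space \<Rightarrow> 'x) \<Rightarrow> 'g \<Rightarrow>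
    ('g, 'x) ell1_sup \<Rightarrow> ('g, 'x) ell1_sup"
  where "V_act act g f = Abs_ell1_sup (\<lambda>h. C_act act g (coord f (- g + h)))"

lemma coord_V_act:
  assumes "homeo_action act"
  shows "coord (V_act act g f) h = C_act act g (coord f (- g + h))"
    and "norm (V_act act g f) \<le> norm f"
proof -
  have b: "sup_bounded_by (norm f) (\<lambda>h. C_act act g (coord f (- g + h)))"
    unfolding sup_bounded_by_def
  proof (intro allI impI)
    fix F and x
    assume F: "finite (F :: 'a set)"
    have "(\<Sum>h\<in>F. \<bar>apply_bcontfun (C_act act g (coord f (- g + h))) x\<bar>) =
        (\<Sum>k\<in>(\<lambda>h. - g + h) ` F. \<bar>apply_bcontfun (coord f k) (act (- g) x)\<bar>)"
      by (subst sum.reindex) (auto simp: inj_on_def apply_C_act[OF assms])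
    also have "\<dots> \<le> norm f"
      using sup_bounded_by_norm[of f, unfolded sup_bounded_by_def] F by blast
    finally show "(\<Sum>h\<in>F. \<bar>apply_bcontfun (C_act act g (coord f (- g + h))) x\<bar>) \<le> norm f" .
  qed
  show c: "coord (V_act act g f) h = C_act act g (coord f (- g + h))" for h
    unfolding V_act_def by (subst coord_Abs[OF b]) simp
  show "norm (V_act act g f) \<le> norm f"
    unfolding norm_ell1_sup_iff c[abs_def] using b by (simp add: c sup_bounded_by_def)
qed

lemma isometric_action_V:
  assumes act: "homeo_action act"
  shows "isometric_action (V_act act)"
proof -
  have ga: "group_act act" using act by (simp add: homeo_action_def)
  have ga': "group_act (V_act act)"
    unfolding group_act_def
    by (intro conjI allI coord_eqI bcontfun_eqI)
      (use ga in \<open>simp_all add: coord_V_act[OF act] apply_C_act[OF act] group_act_minus_add[OF ga]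
        minus_add add.assoc group_act_def del: minus_add_distrib add_uminus_conv_diff\<close>)
  have "norm f \<le> norm (V_act act g f)" for g f
    using coord_V_act(2)[OF act, of "- g" "V_act act g f"] group_act_cancel(1)[OF ga'] by simp
  then have "norm (V_act act g f) = norm f" for g f
    using coord_V_act(2)[OF act] by (intro antisym)
  moreover have "linear (V_act act g)" for g
    by (intro linearI coord_eqI bcontfun_eqI)
      (simp_all add: coord_V_act(1)[OF act] apply_C_act[OF act] plus_ell1_sup.rep_eq
        scaleR_ell1_sup.rep_eq)
  ultimately show ?thesis
    using ga' by (simp add: isometric_action_def)
qed


section \<open>The subspaces \<open>W\<^sub>0\<^sub>0\<close>, \<open>W\<^sub>0\<close> and \<open>N\<^sub>0\<close>\<close>

definition W00 :: "('g, 'x::topological_space) ell1_sup set"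
  where "W00 = {f. finite {g. coord f g \<noteq> 0} \<and>
    (\<exists>c::real. (\<Sum>g | coord f g \<noteq> 0. coord f g) = c *\<^sub>R 1)}"

definition W0 :: "('g, 'x::topological_space) ell1_sup set"
  where "W0 = closure W00"

text \<open>The unique continuous extension to \<^term>\<open>W0\<close> of the map on \<^term>\<open>W00\<close>; the value \<open>0\<close>
  outside \<^term>\<open>W0\<close> is an arbitrary convention.\<close>

definition pi_W0 :: "('g, 'x::topological_space) ell1_sup \<Rightarrow> real"
  where "pi_W0 = (THE p. continuous_on W0 p \<and>
    (\<forall>f\<in>W00. (\<Sum>g | coord f g \<noteq> 0. coord f g) = p f *\<^sub>R 1) \<and> (\<forall>f. f \<notin> W0 \<longrightarrow> p f = 0))"

lemma infsum_coord_finite: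
  assumes "finite {g. coord f g \<noteq> 0}"
  shows "(\<Sum>\<^sub>\<infinity>g. apply_bcontfun (coord f g) x) =
    apply_bcontfun (\<Sum>g | coord f g \<noteq> 0. coord f g) x"
proof -
  have "(\<Sum>\<^sub>\<infinity>g. apply_bcontfun (coord f g) x) =
      (\<Sum>\<^sub>\<infinity>g\<in>{g. coord f g \<noteq> 0}. apply_bcontfun (coord f g) x)"
    by (rule infsum_cong_neutral) auto
  then show ?thesis using assms by (simp add: apply_bcontfun_sum)
qed

lemma summable_coord': "(\<lambda>g. apply_bcontfun (coord f g) x) summable_on UNIV"
  by (subst summable_on_iff_abs_summable_on_real) (simp add: summable_coord)

lemma linear_infsum_coord: "linear (\<lambda>f. \<Sum>\<^sub>\<infinity>g. apply_bcontfun (coord f g) x)"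
proof (rule linearI)
  show "(\<Sum>\<^sub>\<infinity>g. apply_bcontfun (coord (f + f') g) x) =
      (\<Sum>\<^sub>\<infinity>g. apply_bcontfun (coord f g) x) + (\<Sum>\<^sub>\<infinity>g. apply_bcontfun (coord f' g) x)"
    for f f' :: "('a, 'b) ell1_sup"
    unfolding plus_ell1_sup.rep_eq plus_bcontfun.rep_eq
    by (rule infsum_add[OF summable_coord' summable_coord'])
  show "(\<Sum>\<^sub>\<infinity>g. apply_bcontfun (coord (c *\<^sub>R f) g) x) =
      c *\<^sub>R (\<Sum>\<^sub>\<infinity>g. apply_bcontfun (coord f g) x)" for c and f :: "('a, 'b) ell1_sup"
    unfolding scaleR_ell1_sup.rep_eq scaleR_bcontfun.rep_eq
    by (rule infsum_scaleR_right)
qed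

lemma infsum_coord_le: "\<bar>\<Sum>\<^sub>\<infinity>g. apply_bcontfun (coord f g) x\<bar> \<le> norm f"
proof -
  have "\<bar>\<Sum>\<^sub>\<infinity>g. apply_bcontfun (coord f g) x\<bar> \<le> (\<Sum>\<^sub>\<infinity>g. \<bar>apply_bcontfun (coord f g) x\<bar>)"
    using norm_infsum_bound[of "\<lambda>g. apply_bcontfun (coord f g) x" UNIV] summable_coord[of f x]
    by simp
  also have "\<dots> \<le> norm f"
    by (rule sup_bounded_byD[OF sup_bounded_by_norm])
  finally show ?thesis .
qed

lemma bounded_linear_infsum_coord:
  "bounded_linear (\<lambda>f. \<Sum>\<^sub>\<infinity>g. apply_bcontfun (coord f g) x)"
proof (rule bounded_linear_intro[where K = 1])
  show "norm (\<Sum>\<^sub>\<infinity>g. apply_bcontfun (coord f g) x) \<le> norm f * 1" for f :: "('a, 'b) ell1_sup"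
    using infsum_coord_le[of f x] by simp
qed (rule linear_add[OF linear_infsum_coord] linear_scale[OF linear_infsum_coord])+

lemma agree_on_closure:
  fixes p q :: "'a::metric_space \<Rightarrow> real"
  assumes "continuous_on (closure S) p" "continuous_on (closure S) q"
    and "\<And>f. f \<in> S \<Longrightarrow> p f = q f" "f \<in> closure S"
  shows "p f = q f"
  using continuous_constant_on_closure[OF continuous_on_diff[OF assms(1,2)], of 0 f] assms(3,4)
  by simp

lemma infsum_W00:
  assumes "f \<in> W00"
  shows "(\<Sum>g | coord f g \<noteq> 0. coord f g) = (\<Sum>\<^sub>\<infinity>g. apply_bcontfun (coord f g) x) *\<^sub>R 1"
proof -
  obtain c where c: "(\<Sum>g | coord f g \<noteq> 0. coord f g) = c *\<^sub>R 1" and fin: "finite {g. coord f g \<noteq> 0}"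
    using assms by (auto simp: W00_def)
  have "(\<Sum>\<^sub>\<infinity>g. apply_bcontfun (coord f g) x) = c"
    unfolding infsum_coord_finite[OF fin] c by simp
  with c show ?thesis by simp
qed

lemma pi_W0_characterization:
  "continuous_on W0 (pi_W0 :: ('g, 'x::topological_space) ell1_sup \<Rightarrow> real) \<and>
    (\<forall>f\<in>(W00 :: ('g, 'x) ell1_sup set). (\<Sum>g | coord f g \<noteq> 0. coord f g) = pi_W0 f *\<^sub>R 1) \<and>
    (\<forall>f. f \<notin> (W0 :: ('g, 'x) ell1_sup set) \<longrightarrow> pi_W0 f = 0)"
proof -
  define P :: "(('g, 'x) ell1_sup \<Rightarrow> real) \<Rightarrow> bool" where
    "P p \<longleftrightarrow> continuous_on W0 p \<and>
      (\<forall>f\<in>W00. (\<Sum>g | coord f g \<noteq> 0. coord f g) = p f *\<^sub>R 1) \<and> (\<forall>f. f \<notin> W0 \<longrightarrow> p f = 0)" for p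
  define q :: "('g, 'x) ell1_sup \<Rightarrow> real"
    where "q f = (if f \<in> W0 then \<Sum>\<^sub>\<infinity>g. apply_bcontfun (coord f g) undefined else 0)" for f
  have "continuous_on W0 (\<lambda>f :: ('g, 'x) ell1_sup. \<Sum>\<^sub>\<infinity>g. apply_bcontfun (coord f g) undefined)"
    by (rule linear_continuous_on[OF bounded_linear_infsum_coord])
  then have qc: "continuous_on W0 q"
    by (rule continuous_on_eq) (simp add: q_def)
  have sub: "(W00 :: ('g, 'x) ell1_sup set) \<subseteq> W0" by (simp add: W0_def closure_subset)
  have qW: "(\<Sum>g | coord f g \<noteq> 0. coord f g) = q f *\<^sub>R 1" if "f \<in> W00" for f
    using infsum_W00[OF that, of undefined] that sub by (auto simp: q_def)
  have "P q"
    using qc qW by (auto simp: q_def P_def)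
  moreover have "p = q" if "P p" for p
  proof -
  note p = that[unfolded P_def]
  have "p f = q f" if "f \<in> W0" for f
  proof (rule agree_on_closure[where p = p and q = q and S = W00])
    show "continuous_on (closure W00) p" "continuous_on (closure W00) q"
      using p qc by (auto simp: W0_def)
    show "f \<in> closure W00" using that by (simp add: W0_def)
    show "p f = q f" if "f \<in> W00" for f
      using p qW[OF that] that by (metis scaleR_cancel_right zero_neq_one)
  qed
  then show "p = q" using p by (auto simp: q_def fun_eq_iff)
  qed
  ultimately have "\<exists>!p. P p" by blast
  from theI'[OF this] show ?thesis
    unfolding pi_W0_def P_def .
qed

lemma pi_W0_eq:
  assumes "f \<in> W0"
  shows "pi_W0 f = (\<Sum>\<^sub>\<infinity>g. apply_bcontfun (coord f g) x)"
proof (rule agree_on_closure[where p = pi_W0 and S = W00])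
  show "continuous_on (closure W00) pi_W0"
    using pi_W0_characterization by (auto simp: W0_def)
  show "continuous_on (closure W00) (\<lambda>f. \<Sum>\<^sub>\<infinity>g. apply_bcontfun (coord f g) x)"
    by (rule linear_continuous_on[OF bounded_linear_infsum_coord])
  show "f \<in> closure W00" using assms by (simp add: W0_def)
  show "pi_W0 f = (\<Sum>\<^sub>\<infinity>g. apply_bcontfun (coord f g) x)" if "f \<in> W00" for f
    using pi_W0_characterization infsum_W00[OF that, of x] that
    by (metis scaleR_cancel_right zero_neq_one)
qed

lemma W00I:
  assumes "finite F" "\<And>g. g \<notin> F \<Longrightarrow> coord f g = 0"
    and "(\<Sum>g\<in>F. coord f g) = c *\<^sub>R 1"
  shows "f \<in> W00"
proof -
  have sub: "{g. coord f g \<noteq> 0} \<subseteq> F" using assms by auto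
  moreover have "(\<Sum>g | coord f g \<noteq> 0. coord f g) = (\<Sum>g\<in>F. coord f g)"
    by (rule sum.mono_neutral_left) (use assms sub in auto)
  ultimately show ?thesis
    using assms(3) finite_subset[OF sub assms(1)] unfolding W00_def by auto
qed

lemma subspace_W00: "subspace (W00 :: ('g, 'x::topological_space) ell1_sup set)"
  unfolding subspace_def
proof (intro conjI ballI allI)
  show "0 \<in> (W00 :: ('g, 'x) ell1_sup set)"
    by (rule W00I[of "{}" _ 0]) (auto simp: zero_ell1_sup.rep_eq)
next
  fix f f' :: "('g, 'x) ell1_sup"
  assume f: "f \<in> W00" "f' \<in> W00"
  let ?S = "{g. coord f g \<noteq> 0}" and ?S' = "{g. coord f' g \<noteq> 0}"
  obtain c c' where c: "(\<Sum>g\<in>?S. coord f g) = c *\<^sub>R 1" "(\<Sum>g\<in>?S'. coord f' g) = c' *\<^sub>R 1"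
    and fin: "finite ?S" "finite ?S'"
    using f by (auto simp: W00_def)
  have "(\<Sum>g\<in>?S \<union> ?S'. coord f g) = c *\<^sub>R 1"
    unfolding c(1)[symmetric] by (rule sum.mono_neutral_right) (use fin in auto)
  moreover have "(\<Sum>g\<in>?S \<union> ?S'. coord f' g) = c' *\<^sub>R 1"
    unfolding c(2)[symmetric] by (rule sum.mono_neutral_right) (use fin in auto)
  ultimately show "f + f' \<in> W00"
    using fin by (intro W00I[of "?S \<union> ?S'" _ "c + c'"])
      (auto simp: plus_ell1_sup.rep_eq sum.distrib scaleR_left_distrib)
next
  fix a :: real and f :: "('g, 'x) ell1_sup"
  assume f: "f \<in> W00"
  let ?S = "{g. coord f g \<noteq> 0}"
  obtain c where c: "(\<Sum>g\<in>?S. coord f g) = c *\<^sub>R 1" and fin: "finite ?S"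
    using f by (auto simp: W00_def)
  have "(\<Sum>g\<in>?S. coord (a *\<^sub>R f) g) = (a * c) *\<^sub>R 1"
    using c by (simp add: scaleR_ell1_sup.rep_eq scaleR_right.sum[symmetric])
  then show "a *\<^sub>R f \<in> W00"
    by (rule W00I[OF fin, rotated]) (simp add: scaleR_ell1_sup.rep_eq)
qed

lemma subspace_W0: "subspace (W0 :: ('g, 'x::topological_space) ell1_sup set)"
  unfolding subspace_def
proof (intro conjI ballI allI)
  show "0 \<in> (W0 :: ('g, 'x) ell1_sup set)"
    using subspace_0[OF subspace_W00] closure_subset unfolding W0_def by blast
next
  fix f f' :: "('g, 'x) ell1_sup"
  assume "f \<in> W0" "f' \<in> W0"
  then obtain s s' where s: "\<And>n. s n \<in> W00" "s \<longlonglongrightarrow> f" "\<And>n. s' n \<in> W00" "s' \<longlonglongrightarrow> f'"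
    unfolding W0_def closure_sequential by blast
  show "f + f' \<in> W0"
    unfolding W0_def closure_sequential
    by (rule exI[of _ "\<lambda>n. s n + s' n"]) (simp add: s tendsto_add subspace_add[OF subspace_W00])
next
  fix a :: real and f :: "('g, 'x) ell1_sup"
  assume "f \<in> W0"
  then obtain s where s: "\<And>n. s n \<in> W00" "s \<longlonglongrightarrow> f"
    unfolding W0_def closure_sequential by blast
  show "a *\<^sub>R f \<in> W0"
    unfolding W0_def closure_sequential
    by (rule exI[of _ "\<lambda>n. a *\<^sub>R s n"])
      (simp add: s tendsto_scaleR subspace_scale[OF subspace_W00])
qed

definition N0_set :: "('g, 'x::topological_space) ell1_sup set"
  where "N0_set = {f \<in> W0. pi_W0 f = 0}"

lemma N0_set_eq:
  "N0_set = W0 \<inter> {f. (\<Sum>\<^sub>\<infinity>g. apply_bcontfun (coord f g) x) = 0}"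
proof -
  have "pi_W0 f = 0 \<longleftrightarrow> (\<Sum>\<^sub>\<infinity>g. apply_bcontfun (coord f g) x) = 0" if "f \<in> W0"
    for f :: "('a, 'b) ell1_sup"
    unfolding pi_W0_eq[OF that, of x] ..
  then show ?thesis unfolding N0_set_def by blast
qed

lemma subspace_N0_set: "subspace (N0_set :: ('g, 'x::topological_space) ell1_sup set)"
  unfolding N0_set_eq[of undefined]
  by (intro subspace_inter subspace_W0 linear_subspace_kernel linear_infsum_coord)

lemma closed_N0_set: "closed (N0_set :: ('g, 'x::topological_space) ell1_sup set)"
proof -
  have "closed ((\<lambda>f :: ('g, 'x) ell1_sup. \<Sum>\<^sub>\<infinity>g. apply_bcontfun (coord f g) undefined) -` {0})"
    by (intro continuous_closed_vimage closed_singleton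
        linear_continuous_at[OF bounded_linear_infsum_coord])
  moreover have "{f :: ('g, 'x) ell1_sup. (\<Sum>\<^sub>\<infinity>g. apply_bcontfun (coord f g) undefined) = 0} =
      (\<lambda>f. \<Sum>\<^sub>\<infinity>g. apply_bcontfun (coord f g) undefined) -` {0}"
    by auto
  ultimately show ?thesis
    unfolding N0_set_eq[of undefined] W0_def by (auto intro!: closed_Int)
qed

typedef (overloaded) ('g, 'x) N0 = "N0_set :: ('g, 'x::topological_space) ell1_sup set"
  morphisms vec_N0 Abs_N0
  using subspace_0[OF subspace_N0_set] by blast

setup_lifting type_definition_N0

instantiation N0 :: (type, topological_space) real_vector
begin

lift_definition zero_N0 :: "('a, 'b) N0" is 0
  by (rule subspace_0[OF subspace_N0_set])

lift_definition plus_N0 :: "('a, 'b) N0 \<Rightarrow> ('a, 'b) N0 \<Rightarrow> ('a, 'b) N0" is "(+)"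
  by (rule subspace_add[OF subspace_N0_set])

lift_definition minus_N0 :: "('a, 'b) N0 \<Rightarrow> ('a, 'b) N0 \<Rightarrow> ('a, 'b) N0" is "(-)"
  by (rule subspace_diff[OF subspace_N0_set])

lift_definition uminus_N0 :: "('a, 'b) N0 \<Rightarrow> ('a, 'b) N0" is uminus
  by (rule subspace_neg[OF subspace_N0_set])

lift_definition scaleR_N0 :: "real \<Rightarrow> ('a, 'b) N0 \<Rightarrow> ('a, 'b) N0" is "(*\<^sub>R)"
  by (rule subspace_scale[OF subspace_N0_set])

instance
proof
  fix u v w :: "('a, 'b) N0" and a b :: real
  show "u + v + w = u + (v + w)" "u + v = v + u" "0 + u = u" "- u + u = 0"
    "u - v = u + - v" "a *\<^sub>R (u + v) = a *\<^sub>R u + a *\<^sub>R v" "(a + b) *\<^sub>R u = a *\<^sub>R u + b *\<^sub>R u"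
    "a *\<^sub>R b *\<^sub>R u = (a * b) *\<^sub>R u" "1 *\<^sub>R u = u"
    by (transfer, simp add: algebra_simps)+
qed

end

instantiation N0 :: (type, topological_space) real_normed_vector
begin

lift_definition norm_N0 :: "('a, 'b) N0 \<Rightarrow> real" is norm .

lift_definition dist_N0 :: "('a, 'b) N0 \<Rightarrow> ('a, 'b) N0 \<Rightarrow> real" is dist .

definition sgn_N0 :: "('a, 'b) N0 \<Rightarrow> ('a, 'b) N0"
  where "sgn_N0 v = v /\<^sub>R norm v"

definition uniformity_N0 :: "(('a, 'b) N0 \<times> ('a, 'b) N0) filter"
  where "uniformity_N0 = (INF e\<in>{0 <..}. principal {(x, y). dist x y < e})"

definition open_N0 :: "('a, 'b) N0 set \<Rightarrow> bool"
  where "open_N0 S = (\<forall>x\<in>S. \<forall>\<^sub>F (x', y) in uniformity. x' = x \<longrightarrow> y \<in> S)"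

instance
proof
  fix u v :: "('a, 'b) N0" and a :: real
  show "norm (u + v) \<le> norm u + norm v"
    by transfer (rule norm_triangle_ineq)
  show "norm (a *\<^sub>R u) = \<bar>a\<bar> * norm u" by transfer simp
  show "norm u = 0 \<longleftrightarrow> u = 0" by transfer simp
  show "dist u v = norm (u - v)" by transfer (rule dist_norm)
qed (rule sgn_N0_def uniformity_N0_def open_N0_def)+

end

instance N0 :: (type, topological_space) banach
proof
  fix X :: "nat \<Rightarrow> ('a, 'b) N0"
  assume "Cauchy X"
  then have "Cauchy (\<lambda>n. vec_N0 (X n))"
    by (simp add: Cauchy_def dist_N0.rep_eq)
  then obtain l where l: "(\<lambda>n. vec_N0 (X n)) \<longlonglongrightarrow> l"
    by (auto simp: Cauchy_convergent_iff convergent_def)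
  have "l \<in> N0_set"
    by (rule Lim_in_closed_set[OF closed_N0_set _ _ l]) (simp_all add: vec_N0)
  then have "X \<longlonglongrightarrow> Abs_N0 l"
    using l by (simp add: tendsto_iff dist_N0.rep_eq Abs_N0_inverse)
  then show "convergent X" by (rule convergentI)
qed

definition N0_act :: "('g::group_add \<Rightarrow> 'x::topological_space \<Rightarrow> 'x) \<Rightarrow> 'g \<Rightarrow>
    ('g, 'x) N0 \<Rightarrow> ('g, 'x) N0"
  where "N0_act act g v = Abs_N0 (V_act act g (vec_N0 v))"

lemma V_act_W00:
  assumes act: "homeo_action act" and f: "f \<in> W00"
  shows "V_act act g f \<in> W00"
proof -
  let ?S = "{h. coord f h \<noteq> 0}"
  obtain c where c: "(\<Sum>h\<in>?S. coord f h) = c *\<^sub>R 1" and fin: "finite ?S"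
    using f by (auto simp: W00_def)
  show ?thesis
  proof (rule W00I[of "(\<lambda>h. g + h) ` ?S" _ c])
    show "finite ((\<lambda>h. g + h) ` ?S)" using fin by simp
    show "coord (V_act act g f) h = 0" if "h \<notin> (\<lambda>h. g + h) ` ?S" for h
    proof -
      have "coord f (- g + h) = 0"
        using that by (force simp: image_iff add.assoc[symmetric])
      then show ?thesis
        by (auto intro!: bcontfun_eqI simp: coord_V_act[OF act] apply_C_act[OF act])
    qed
    show "(\<Sum>h\<in>(\<lambda>h. g + h) ` ?S. coord (V_act act g f) h) = c *\<^sub>R 1"
    proof (rule bcontfun_eqI)
      fix x
      have "apply_bcontfun (\<Sum>h\<in>(\<lambda>h. g + h) ` ?S. coord (V_act act g f) h) x =
          (\<Sum>h\<in>?S. apply_bcontfun (coord f h) (act (- g) x))"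
        unfolding apply_bcontfun_sum
        by (subst sum.reindex)
          (auto simp: inj_on_def coord_V_act[OF act] apply_C_act[OF act] add.assoc[symmetric])
      also have "\<dots> = apply_bcontfun (c *\<^sub>R 1) x"
        unfolding apply_bcontfun_sum[symmetric] c by simp
      finally show "apply_bcontfun (\<Sum>h\<in>(\<lambda>h. g + h) ` ?S. coord (V_act act g f) h) x =
          apply_bcontfun (c *\<^sub>R 1) x" .
    qed
  qed
qed

lemma V_act_N0_set:
  assumes act: "homeo_action act" and f: "f \<in> N0_set"
  shows "V_act act g f \<in> N0_set"
proof -
  have "bounded_linear (V_act act g)"
    using isometric_action_V[OF act] unfolding isometric_action_def
    by (auto intro!: bounded_linear_intro[where K = 1] simp: linear_add linear_scale)
  then have cont: "continuous_on (closure W00) (V_act act g)"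
    by (rule linear_continuous_on)
  have "V_act act g ` closure W00 \<subseteq> closure W00"
    by (rule image_closure_subset[OF cont closed_closure])
      (use V_act_W00[OF act] closure_subset in blast)
  then have "V_act act g f \<in> W0"
    using f unfolding W0_def N0_set_def by blast
  moreover have "(\<Sum>\<^sub>\<infinity>h. apply_bcontfun (coord (V_act act g f) h) undefined) = 0"
  proof -
    have "bij_betw (\<lambda>h. - g + h) UNIV UNIV"
      by (rule bij_betw_byWitness[where f' = "\<lambda>h. g + h"]) (auto simp: add.assoc[symmetric])
    then have "(\<Sum>\<^sub>\<infinity>h. apply_bcontfun (coord f (- g + h)) (act (- g) undefined)) =
        (\<Sum>\<^sub>\<infinity>h. apply_bcontfun (coord f h) (act (- g) undefined))"
      by (rule infsum_reindex_bij_betw)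
    also have "\<dots> = 0"
      using f unfolding N0_set_eq[of "act (- g) undefined"] by blast
    finally show ?thesis
      by (simp add: coord_V_act(1)[OF act] apply_C_act[OF act])
  qed
  ultimately show ?thesis
    unfolding N0_set_eq[of undefined] by blast
qed

lemma vec_N0_act:
  assumes "homeo_action act"
  shows "vec_N0 (N0_act act g v) = V_act act g (vec_N0 v)"
  unfolding N0_act_def by (rule Abs_N0_inverse) (rule V_act_N0_set[OF assms vec_N0])

lemma isometric_action_N0:
  assumes act: "homeo_action act"
  shows "isometric_action (N0_act act)"
  using isometric_action_V[OF act] unfolding isometric_action_def group_act_def
  by (auto intro!: linearI simp: vec_N0_inject[symmetric] vec_N0_act[OF act] norm_N0.rep_eq
      plus_N0.rep_eq scaleR_N0.rep_eq linear_add linear_scale)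


section \<open>Topological amenability\<close>

definition topologically_amenable ::
    "('g::group_add \<Rightarrow> 'x::topological_space \<Rightarrow> 'x) \<Rightarrow> bool"
  where "topologically_amenable act \<longleftrightarrow>
    (\<exists>f :: nat \<Rightarrow> ('g, 'x) ell1_sup.
      (\<forall>n. f n \<in> W00) \<and>
      (\<forall>n g x. 0 \<le> apply_bcontfun (coord (f n) g) x) \<and>
      (\<forall>n. pi_W0 (f n) = 1) \<and>
      (\<forall>g. (\<lambda>n. norm (f n - V_act act g (f n))) \<longlonglongrightarrow> 0))"


section \<open>Modules over \<open>C(X)\<close>\<close>

definition C_module :: "(('x::topological_space \<Rightarrow>\<^sub>C real) \<Rightarrow> 'e::real_normed_vector \<Rightarrow> 'e) \<Rightarrow> bool"
  where "C_module \<rho> \<longleftrightarrow>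
    bilinear \<rho> \<and> (\<forall>s t v. \<rho> (s * t) v = \<rho> s (\<rho> t v)) \<and> (\<forall>v. \<rho> 1 v = v) \<and>
    (\<forall>t v. norm (\<rho> t v) \<le> norm t * norm v)"

definition G_C_module :: "('g::group_add \<Rightarrow> 'x::topological_space \<Rightarrow> 'x) \<Rightarrow>
    (('x \<Rightarrow>\<^sub>C real) \<Rightarrow> 'e::real_normed_vector \<Rightarrow> 'e) \<Rightarrow> ('g \<Rightarrow> 'e \<Rightarrow> 'e) \<Rightarrow> bool"
  where "G_C_module act \<rho> \<alpha> \<longleftrightarrow>
    C_module \<rho> \<and> isometric_action \<alpha> \<and>
    (\<forall>g t v. \<alpha> g (\<rho> t v) = \<rho> (C_act act g t) (\<alpha> g v))"

definition disjointly_supported ::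
    "(('x::topological_space \<Rightarrow>\<^sub>C real) \<Rightarrow> 'e \<Rightarrow> 'e) \<Rightarrow> 'e \<Rightarrow> 'e \<Rightarrow> bool"
  where "disjointly_supported \<rho> v1 v2 \<longleftrightarrow>
    (\<exists>f1 f2.
      closure {x. apply_bcontfun f1 x \<noteq> 0} \<inter> closure {x. apply_bcontfun f2 x \<noteq> 0} = {} \<and>
      \<rho> f1 v1 = v1 \<and> \<rho> f2 v2 = v2)"

definition ell1_geometric ::
    "(('x::topological_space \<Rightarrow>\<^sub>C real) \<Rightarrow> 'e::real_normed_vector \<Rightarrow> 'e) \<Rightarrow> bool"
  where "ell1_geometric \<rho> \<longleftrightarrow>
    (\<forall>v1 v2. disjointly_supported \<rho> v1 v2 \<longrightarrow> norm (v1 + v2) = norm v1 + norm v2)"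


section \<open>Bounded cohomology\<close>

text \<open>A tuple in \<open>G\<^sup>m\<^sup>+\<^sup>1\<close> is a list of length \<open>m + 1\<close>; cochains of degree \<open>m\<close> are
  extended by \<open>0\<close> to lists of other lengths. The coefficients are the dual of the Banach space
  carrying the action \<open>\<alpha>\<close>.\<close>

definition bounded_cochains :: "('g::group_add \<Rightarrow> 'e::real_normed_vector \<Rightarrow> 'e) \<Rightarrow> nat \<Rightarrow>
    ('g list \<Rightarrow> 'e \<Rightarrow>\<^sub>L real) set"
  where "bounded_cochains \<alpha> m = {\<phi>.
    (\<forall>gs. length gs \<noteq> m + 1 \<longrightarrow> \<phi> gs = 0) \<and>
    bounded (\<phi> ` {gs. length gs = m + 1}) \<and>
    (\<forall>k gs. length gs = m + 1 \<longrightarrow> \<phi> (map (\<lambda>g. k + g) gs) = dual_act \<alpha> k (\<phi> gs))}"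

text \<open>The \<open>i\<close>-th summand omits the \<open>i\<close>-th entry of \<open>gs\<close>. Applied to a cochain of degree \<open>m\<close>, only
  lists of length \<open>m + 2\<close> can give a nonzero value.\<close>

definition differential :: "('g list \<Rightarrow> 'e::real_normed_vector \<Rightarrow>\<^sub>L real) \<Rightarrow> 'g list \<Rightarrow> 'e \<Rightarrow>\<^sub>L real"
  where "differential \<phi> gs = (\<Sum>i<length gs. (-1) ^ i *\<^sub>R \<phi> (take i gs @ drop (Suc i) gs))"

definition bounded_cocycles :: "('g::group_add \<Rightarrow> 'e::real_normed_vector \<Rightarrow> 'e) \<Rightarrow> nat \<Rightarrow>
    ('g list \<Rightarrow> 'e \<Rightarrow>\<^sub>L real) set"
  where "bounded_cocycles \<alpha> m = {\<phi> \<in> bounded_cochains \<alpha> m. differential \<phi> = (\<lambda>_. 0)}"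

definition bounded_coboundaries :: "('g::group_add \<Rightarrow> 'e::real_normed_vector \<Rightarrow> 'e) \<Rightarrow> nat \<Rightarrow>
    ('g list \<Rightarrow> 'e \<Rightarrow>\<^sub>L real) set"
  where "bounded_coboundaries \<alpha> m =
    (case m of 0 \<Rightarrow> {\<lambda>_. 0} | Suc n \<Rightarrow> differential ` bounded_cochains \<alpha> n)"

definition cohomologous :: "('g::group_add \<Rightarrow> 'e::real_normed_vector \<Rightarrow> 'e) \<Rightarrow> nat \<Rightarrow>
    (('g list \<Rightarrow> 'e \<Rightarrow>\<^sub>L real) \<times> ('g list \<Rightarrow> 'e \<Rightarrow>\<^sub>L real)) set"
  where "cohomologous \<alpha> m = {(\<phi>, \<psi>). \<phi> \<in> bounded_cocycles \<alpha> m \<and> \<psi> \<in> bounded_cocycles \<alpha> m \<and>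
    (\<lambda>gs. \<phi> gs - \<psi> gs) \<in> bounded_coboundaries \<alpha> m}"

definition cohomology_class :: "('g::group_add \<Rightarrow> 'e::real_normed_vector \<Rightarrow> 'e) \<Rightarrow> nat \<Rightarrow>
    ('g list \<Rightarrow> 'e \<Rightarrow>\<^sub>L real) \<Rightarrow> ('g list \<Rightarrow> 'e \<Rightarrow>\<^sub>L real) set"
  where "cohomology_class \<alpha> m \<phi> = cohomologous \<alpha> m `` {\<phi>}"

definition bounded_cohomology :: "('g::group_add \<Rightarrow> 'e::real_normed_vector \<Rightarrow> 'e) \<Rightarrow> nat \<Rightarrow>
    ('g list \<Rightarrow> 'e \<Rightarrow>\<^sub>L real) set set"
  where "bounded_cohomology \<alpha> m = bounded_cocycles \<alpha> m // cohomologous \<alpha> m"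

definition trivial_cohomology :: "('g::group_add \<Rightarrow> 'e::real_normed_vector \<Rightarrow> 'e) \<Rightarrow> nat \<Rightarrow> bool"
  where "trivial_cohomology \<alpha> m \<longleftrightarrow>
    bounded_cohomology \<alpha> m = {cohomology_class \<alpha> m (\<lambda>_. 0)}"


text \<open>Quantification over all Banach spaces cannot be expressed inside a HOL formula, so the
  Banach space is a type parameter; the module structure and the action range over all choices.\<close>

definition ell1_geometric_vanishing ::
    "'e::banach itself \<Rightarrow> ('g::group_add \<Rightarrow> 'x::topological_space \<Rightarrow> 'x) \<Rightarrow> bool"
  where "ell1_geometric_vanishing _ act \<longleftrightarrow>
    (\<forall>(\<rho> :: ('x \<Rightarrow>\<^sub>C real) \<Rightarrow> 'e \<Rightarrow> 'e) \<alpha> p.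
      G_C_module act \<rho> \<alpha> \<and> ell1_geometric \<rho> \<and> 1 \<le> p \<longrightarrow> trivial_cohomology \<alpha> p)"


section \<open>The Johnson class\<close>

lift_definition delta :: "'g \<Rightarrow> ('g, 'x::topological_space) ell1_sup"
  is "\<lambda>g h. if h = g then 1 else 0"
proof -
  fix g :: 'g
  have "(\<Sum>h\<in>F. \<bar>apply_bcontfun (if h = g then 1 else 0 :: 'x \<Rightarrow>\<^sub>C real) x\<bar>) \<le> 1"
    if "finite F" for F and x :: 'x
  proof -
    have "(\<Sum>h\<in>F. \<bar>apply_bcontfun (if h = g then 1 else 0 :: 'x \<Rightarrow>\<^sub>C real) x\<bar>) =
        (\<Sum>h\<in>F. if h = g then 1 else 0)"
      by (rule sum.cong) auto
    then show ?thesis using that by (simp add: sum.delta)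
  qed
  then show "(\<forall>x. (\<lambda>h. \<bar>apply_bcontfun (if h = g then 1 else 0 :: 'x \<Rightarrow>\<^sub>C real) x\<bar>) summable_on UNIV) \<and>
      bdd_above (range (\<lambda>x. \<Sum>\<^sub>\<infinity>h. \<bar>apply_bcontfun (if h = g then 1 else 0 :: 'x \<Rightarrow>\<^sub>C real) x\<bar>))"
    unfolding ell1_sup_iff sup_bounded_by_def by blast
qed

definition canonical_embedding :: "'e::real_normed_vector \<Rightarrow> ('e \<Rightarrow>\<^sub>L real) \<Rightarrow>\<^sub>L real"
  where "canonical_embedding v = Blinfun (\<lambda>\<phi>. blinfun_apply \<phi> v)"

definition johnson_cocycle :: "'g list \<Rightarrow> (('g, 'x::topological_space) N0 \<Rightarrow>\<^sub>L real) \<Rightarrow>\<^sub>L real"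
  where "johnson_cocycle gs = (case gs of
    [g0, g1] \<Rightarrow> canonical_embedding (Abs_N0 (delta g1 - delta g0)) | _ \<Rightarrow> 0)"

text \<open>The coefficients are the dual of the dual of
  \<^typ>\<open>('g, 'x::topological_space) N0\<close>.\<close>

definition johnson_class_trivial :: "('g::group_add \<Rightarrow> 'x::topological_space \<Rightarrow> 'x) \<Rightarrow> bool"
  where "johnson_class_trivial act \<longleftrightarrow>
    cohomology_class (dual_act (N0_act act)) 1 johnson_cocycle =
    cohomology_class (dual_act (N0_act act)) 1 (\<lambda>_. 0)"

lemma canonical_embedding_apply [simp]:
  "blinfun_apply (canonical_embedding v) \<phi> = blinfun_apply \<phi> v"
  unfolding canonical_embedding_def
  by (rule bounded_linear_Blinfun_apply[THEN fun_cong]) (rule blinfun.bounded_linear_left)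

lemma delta_W00: "delta g \<in> W00"
  by (rule W00I[of "{g}" _ 1]) (auto simp: delta.rep_eq)

lemma delta_diff_N0_set:
  "delta g1 - delta g0 \<in> (N0_set :: ('g, 'x::topological_space) ell1_sup set)"
proof -
  have d: "(\<Sum>\<^sub>\<infinity>h. apply_bcontfun (coord (delta g :: ('g, 'x) ell1_sup) h) x) = 1" for g x
  proof -
    have "(\<Sum>\<^sub>\<infinity>h. apply_bcontfun (coord (delta g :: ('g, 'x) ell1_sup) h) x) =
        (\<Sum>\<^sub>\<infinity>h\<in>{g}. 1)"
      by (rule infsum_cong_neutral) (auto simp: delta.rep_eq)
    then show ?thesis by simp
  qed
  have "delta g1 - delta g0 \<in> (W0 :: ('g, 'x) ell1_sup set)"
    unfolding W0_def
    by (rule subsetD[OF closure_subset subspace_diff[OF subspace_W00 delta_W00 delta_W00]])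
  moreover have "(\<Sum>\<^sub>\<infinity>h. apply_bcontfun (coord (delta g1 - delta g0 :: ('g, 'x) ell1_sup) h) undefined) = 0"
    unfolding linear_diff[OF linear_infsum_coord[of undefined]] d by simp
  ultimately show ?thesis unfolding N0_set_eq[of undefined] by blast
qed

lemma johnson_cocycle:
  assumes act: "homeo_action act"
  shows "johnson_cocycle \<in> bounded_cocycles (dual_act (N0_act act)) 1"
proof -
  have \<alpha>: "isometric_action (N0_act act)" by (rule isometric_action_N0[OF act])
  have \<alpha>': "isometric_action (dual_act (N0_act act))" by (rule isometric_action_dual[OF \<alpha>])
  have two: "\<exists>a b. gs = [a, b]" if "length gs = 2" for gs :: "'a list"
    using that by (auto simp: numeral_2_eq_2 length_Suc_conv)
  have D: "vec_N0 (Abs_N0 (delta b - delta a)) = (delta b - delta a :: ('a, 'b) ell1_sup)" for a b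
    by (rule Abs_N0_inverse[OF delta_diff_N0_set])
  have nd: "norm (delta g :: ('a, 'b) ell1_sup) \<le> 1" for g
  proof -
    have "(\<Sum>h\<in>F. \<bar>apply_bcontfun (coord (delta g :: ('a, 'b) ell1_sup) h) x\<bar>) \<le> 1"
      if "finite F" for F x
    proof -
      have "(\<Sum>h\<in>F. \<bar>apply_bcontfun (coord (delta g :: ('a, 'b) ell1_sup) h) x\<bar>) =
          (\<Sum>h\<in>F. if h = g then 1 else 0)"
        by (rule sum.cong) (auto simp: delta.rep_eq)
      then show ?thesis using that by (simp add: sum.delta)
    qed
    then show ?thesis unfolding norm_ell1_sup_iff sup_bounded_by_def by blast
  qed
  have 0: "johnson_cocycle gs = 0" if "length gs \<noteq> 2" for gs :: "'a list"
    using that by (auto simp: johnson_cocycle_def split: list.splits)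
  have b: "norm (johnson_cocycle gs :: (('a, 'b) N0 \<Rightarrow>\<^sub>L real) \<Rightarrow>\<^sub>L real) \<le> 2"
    if "length gs = 2" for gs :: "'a list"
  proof -
    obtain a b where gs: "gs = [a, b]" using two[OF \<open>length gs = 2\<close>] by auto
    have n: "norm (Abs_N0 (delta b - delta a) :: ('a, 'b) N0) \<le> 2"
      using norm_triangle_ineq4[of "delta b :: ('a, 'b) ell1_sup" "delta a"] nd[of a] nd[of b]
      by (simp add: norm_N0.rep_eq D)
    show ?thesis
      unfolding gs johnson_cocycle_def
    proof (simp, rule norm_blinfun_bound)
      fix \<phi> :: "('a, 'b) N0 \<Rightarrow>\<^sub>L real"
      have "norm (blinfun_apply \<phi> (Abs_N0 (delta b - delta a))) \<le>
          norm \<phi> * norm (Abs_N0 (delta b - delta a) :: ('a, 'b) N0)"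
        by (rule norm_blinfun)
      also have "\<dots> \<le> norm \<phi> * 2" using n by (intro mult_left_mono) auto
      finally show "norm (blinfun_apply (canonical_embedding (Abs_N0 (delta b - delta a))) \<phi>) \<le>
          2 * norm \<phi>" by simp
    qed simp
  qed
  have Vd: "V_act act k (delta g) = delta (k + g)" for k g
    by (auto intro!: coord_eqI bcontfun_eqI
        simp: coord_V_act[OF act] apply_C_act[OF act] delta.rep_eq add.assoc[symmetric])
  have Nd: "N0_act act k (Abs_N0 (delta b - delta a)) = Abs_N0 (delta (k + b) - delta (k + a))"
    for k a b
    using isometric_action_V[OF act]
    by (simp add: N0_act_def D isometric_action_def linear_diff Vd)
  have eq: "johnson_cocycle (map (\<lambda>g. k + g) gs) =
      dual_act (dual_act (N0_act act)) k (johnson_cocycle gs)"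
    if "length gs = 2" for k gs
  proof -
    obtain a b where gs: "gs = [a, b]" using two[OF \<open>length gs = 2\<close>] by auto
    show ?thesis
      unfolding gs johnson_cocycle_def
      by (rule blinfun_eqI) (simp add: dual_act_apply[OF \<alpha>'] dual_act_apply[OF \<alpha>] Nd)
  qed
  have d: "differential johnson_cocycle gs = (0 :: (('a, 'b) N0 \<Rightarrow>\<^sub>L real) \<Rightarrow>\<^sub>L real)"
    for gs :: "'a list"
  proof (cases "length gs = 3")
    case True
    then obtain a b c where gs: "gs = [a, b, c]"
      by (auto simp: numeral_3_eq_3 length_Suc_conv)
    have e: "Abs_N0 (delta c - delta b) - Abs_N0 (delta c - delta a) + Abs_N0 (delta b - delta a) =
        (0 :: ('a, 'b) N0)"
      by (simp add: vec_N0_inject[symmetric] plus_N0.rep_eq minus_N0.rep_eq zero_N0.rep_eq D)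
    show ?thesis
    proof (rule blinfun_eqI)
      fix \<phi> :: "('a, 'b) N0 \<Rightarrow>\<^sub>L real"
      show "blinfun_apply (differential johnson_cocycle gs) \<phi> = blinfun_apply 0 \<phi>"
        using arg_cong[OF e, of "blinfun_apply \<phi>"]
        by (simp add: gs differential_def johnson_cocycle_def numeral_3_eq_3 lessThan_Suc
            blinfun.bilinear_simps)
    qed
  next
    case False
    then have "johnson_cocycle (take i gs @ drop (Suc i) gs) = (0 :: (('a, 'b) N0 \<Rightarrow>\<^sub>L real) \<Rightarrow>\<^sub>L real)"
      if "i < length gs" for i
      using that by (intro 0) auto
    then show ?thesis by (simp add: differential_def)
  qed
  have "bounded ((johnson_cocycle :: 'a list \<Rightarrow> (('a, 'b) N0 \<Rightarrow>\<^sub>L real) \<Rightarrow>\<^sub>L real) `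
      {gs. length gs = 1 + 1})"
    using b by (auto intro!: boundedI[of _ 2])
  then show ?thesis
    using 0 eq d unfolding bounded_cocycles_def bounded_cochains_def mem_Collect_eq one_add_one
    by blast
qed

end

theory Submission
  imports Defs
begin

text \<open>Amenability implies vanishing: in a geometric module \<open>\<Sum>\<^sub>h \<parallel>f\<^sub>h v\<parallel> \<le> \<parallel>f\<parallel> \<parallel>v\<parallel>\<close> for finitely
  supported \<open>f\<close>, so a cocycle \<open>\<phi>\<close> can be averaged in its first argument against the functions \<open>f\<^sup>n\<close>
  of the definition of amenability; a generalized limit of \<open>\<Sum>\<^sub>h \<phi>(h, \<dots>)(f\<^sup>n\<^sub>h v)\<close> is equivariant
  because the \<open>f\<^sup>n\<close> are asymptotically invariant, and it is a primitive of \<open>\<phi>\<close>. The dual of \<open>N\<^sub>0\<close> is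
  a geometric module, so vanishing trivializes the Johnson class. Conversely, an element of
  \<open>N\<^sub>0\<^sup>*\<^sup>*\<close> trivializing the Johnson cocycle gives, by the Hahn--Banach theorem, vectors \<open>v \<in> N\<^sub>0\<close> for
  which \<open>\<delta>\<^sub>0 - v\<close> is almost invariant; dividing absolute values by their sum makes it positive.\<close>

section \<open>The Hahn--Banach theorem and generalized limits\<close>

text \<open>The norm of a geometric module is additive only on vectors with disjoint supports,
  whereas the weights \<open>f_h\<close> overlap. The estimate is therefore first proved for
  \<open>a\<close> and \<open>1 - a\<close>: cutting \<open>a\<close> into \<open>K\<close> layers
  makes pieces that lie a few layers apart disjointly supported, at a cost bounded independently of
  \<open>K\<close>. Normalizing and splitting into signs reaches general weights. The averages at
  finite stages are already primitives; what fails is equivariance, which the generalized limit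
  restores. Applied separately for each vector, it takes the place of weak-star compactness.
  \<open>N\<^sub>0\<close> is a module because multiplying by \<open>t\<close> turns the sum
  \<open>c 1\<close> into \<open>c t\<close>, which need not be constant unless
  \<open>c = 0\<close>. Its norm is a supremum over \<open>X\<close> and behaves like a maximum over
  disjoint parts of \<open>X\<close>; hence the sum in the dual. An element of the bidual carries
  only weak information. Separation in finite products of \<open>N\<^sub>0\<close> turns it into
  norm approximation by one vector for finitely many group elements, and countability of
  \<open>G\<close> yields a sequence.\<close>

definition sublinear :: "('a::real_vector \<Rightarrow> real) \<Rightarrow> bool"
  where "sublinear p \<longleftrightarrow>
    (\<forall>x y. p (x + y) \<le> p x + p y) \<and> (\<forall>c x. 0 \<le> c \<longrightarrow> p (c *\<^sub>R x) \<le> c * p x)"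

lemma sublinear_add: "sublinear p \<Longrightarrow> p (x + y) \<le> p x + p y"
  by (simp add: sublinear_def)

lemma sublinear_scale_le: "sublinear p \<Longrightarrow> 0 \<le> c \<Longrightarrow> p (c *\<^sub>R x) \<le> c * p x"
  by (simp add: sublinear_def)

lemma sublinear_zero: "sublinear p \<Longrightarrow> p 0 = 0"
  using sublinear_add[of p 0 0] sublinear_scale_le[of p 0 0] by simp

lemma sublinear_scale:
  assumes "sublinear p" "0 \<le> c"
  shows "p (c *\<^sub>R x) = c * p x"
proof (cases "c = 0")
  case True
  then show ?thesis by (simp add: sublinear_zero[OF assms(1)])
next
  case False
  with assms have c: "0 < c" by simp
  have "p x \<le> inverse c * p (c *\<^sub>R x)"
    using sublinear_scale_le[OF assms(1), of "inverse c" "c *\<^sub>R x"] c by simp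
  then have "c * p x \<le> p (c *\<^sub>R x)"
    using c by (simp add: field_simps)
  with sublinear_scale_le[OF assms] show ?thesis by (simp add: antisym)
qed

lemma sublinear_minus: "sublinear p \<Longrightarrow> - p (- x) \<le> p x"
  using sublinear_add[of p x "- x"] sublinear_zero[of p] by simp

text \<open>A minimal sublinear functional coincides with all its tilts, which makes it additive; and any
  linear functional below \<open>tilt p y\<close> agrees with \<open>p\<close> at \<open>y\<close>.\<close>

definition tilt :: "('a::real_vector \<Rightarrow> real) \<Rightarrow> 'a \<Rightarrow> 'a \<Rightarrow> real"
  where "tilt p y x = (INF t\<in>{0..}. p (x + t *\<^sub>R y) - t * p y)"

lemma tilt_le:
  assumes p: "sublinear p" and t: "0 \<le> t"
  shows "tilt p y x \<le> p (x + t *\<^sub>R y) - t * p y"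
  unfolding tilt_def
proof (rule cINF_lower)
  have "- p (- x) \<le> p (x + s *\<^sub>R y) - s * p y" if "0 \<le> s" for s
    using sublinear_add[OF p, of "x + s *\<^sub>R y" "- x"] sublinear_scale[OF p that, of y] by simp
  then show "bdd_below ((\<lambda>t. p (x + t *\<^sub>R y) - t * p y) ` {0..})"
    by (auto simp: bdd_below_def)
qed (use t in simp)

lemma tilt_greatest:
  assumes "\<And>t. 0 \<le> t \<Longrightarrow> c \<le> p (x + t *\<^sub>R y) - t * p y"
  shows "c \<le> tilt p y x"
  unfolding tilt_def by (rule cINF_greatest) (use assms in auto)

lemma sublinear_tilt:
  assumes p: "sublinear p"
  shows "sublinear (tilt p y)"
  unfolding sublinear_def
proof (intro conjI allI impI)
  fix x x'
  \<comment> \<open>Admissible parameters add up: \<open>s\<close> for \<open>x\<close> and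
    \<open>t\<close> for \<open>x'\<close> give \<open>s + t\<close> for \<open>x + x'\<close>; the
    two infima are then taken one after the other.\<close>
  have "tilt p y (x + x') \<le> (p (x' + t *\<^sub>R y) - t * p y) + (p (x + s *\<^sub>R y) - s * p y)"
    if "0 \<le> s" "0 \<le> t" for s t
  proof -
    have "tilt p y (x + x') \<le> p ((x + x') + (s + t) *\<^sub>R y) - (s + t) * p y"
      by (rule tilt_le[OF p]) (use that in simp)
    also have "(x + x') + (s + t) *\<^sub>R y = (x + s *\<^sub>R y) + (x' + t *\<^sub>R y)"
      by (simp add: algebra_simps)
    finally show ?thesis
      using sublinear_add[OF p, of "x + s *\<^sub>R y" "x' + t *\<^sub>R y"] by (simp add: algebra_simps)
  qed
  then have "tilt p y (x + x') - (p (x + s *\<^sub>R y) - s * p y) \<le> tilt p y x'" if "0 \<le> s" for s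
    using that by (intro tilt_greatest) (subst diff_le_eq, blast)
  then have "tilt p y (x + x') - tilt p y x' \<le> tilt p y x"
    by (intro tilt_greatest) (simp add: algebra_simps)
  then show "tilt p y (x + x') \<le> tilt p y x + tilt p y x'" by simp
next
  fix c :: real and x
  assume "0 \<le> c"
  show "tilt p y (c *\<^sub>R x) \<le> c * tilt p y x"
  proof (cases "c = 0")
    case True
    then show ?thesis
      using tilt_le[OF p, of 0 y 0] sublinear_zero[OF p] by simp
  next
    case False
    with \<open>0 \<le> c\<close> have c: "0 < c" by simp
    have "tilt p y (c *\<^sub>R x) / c \<le> p (x + t *\<^sub>R y) - t * p y" if "0 \<le> t" for t
    proof -
      have "tilt p y (c *\<^sub>R x) \<le> p (c *\<^sub>R x + (c * t) *\<^sub>R y) - (c * t) * p y"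
        by (rule tilt_le[OF p]) (use that c in simp)
      also have "c *\<^sub>R x + (c * t) *\<^sub>R y = c *\<^sub>R (x + t *\<^sub>R y)"
        by (simp add: algebra_simps)
      finally show ?thesis
        using c sublinear_scale[OF p, of c "x + t *\<^sub>R y"] by (simp add: field_simps)
    qed
    then have "tilt p y (c *\<^sub>R x) / c \<le> tilt p y x" by (rule tilt_greatest)
    then show ?thesis using c by (simp add: field_simps)
  qed
qed

text \<open>Zorn's lemma applies: every sublinear functional below \<open>p\<close> is at least
  \<open>- p (- x)\<close> at \<open>x\<close>, so the pointwise infimum of a chain is finite, and
  it is subadditive because of any two members of a chain one lies below both.\<close>

lemma minimal_sublinear:
  fixes p :: "'a::real_vector \<Rightarrow> real"
  assumes p: "sublinear p"
  obtains q where "sublinear q" "q \<le> p" "\<And>r. sublinear r \<Longrightarrow> r \<le> q \<Longrightarrow> r = q"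
proof -
  define A where "A = {q. sublinear q \<and> q \<le> p}"
  \<comment> \<open>\<open>predicate_Zorn\<close> yields maximal elements, so the order is
    reversed.\<close>
  define P :: "('a \<Rightarrow> real) \<Rightarrow> ('a \<Rightarrow> real) \<Rightarrow> bool" where "P = (\<lambda>q r. r \<le> q)"
  have "\<exists>m\<in>A. \<forall>a\<in>A. P m a \<longrightarrow> a = m"
  proof (rule predicate_Zorn)
    show "partial_order_on A (relation_of P A)"
      by (rule partial_order_on_relation_ofI) (auto simp: P_def)
    fix C assume "C \<in> Chains (relation_of P A)"
    then have sub: "C \<subseteq> A" and lin: "\<And>q r. q \<in> C \<Longrightarrow> r \<in> C \<Longrightarrow> q \<le> r \<or> r \<le> q"
      by (auto simp: Chains_def relation_of_def P_def)
    show "\<exists>u\<in>A. \<forall>a\<in>C. P a u"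
    proof (cases "C = {}")
      case True
      then show ?thesis using p by (auto simp: A_def)
    next
      case False
      define u where "u x = (INF q\<in>C. q x)" for x
      have lower: "- p (- x) \<le> q x" if "q \<in> C" for q x
      proof -
        have q: "sublinear q" "q (- x) \<le> p (- x)"
          using that sub by (auto simp: A_def le_fun_def)
        show ?thesis using sublinear_minus[OF q(1), of x] q(2) by linarith
      qed
      have ule: "u x \<le> q x" if "q \<in> C" for q x
        unfolding u_def by (rule cINF_lower) (use that lower in \<open>auto simp: bdd_below_def\<close>)
      have uge: "c \<le> u x" if "\<And>q. q \<in> C \<Longrightarrow> c \<le> q x" for c x
        unfolding u_def by (rule cINF_greatest) (use False that in auto)
      have "sublinear u"
        unfolding sublinear_def
      proof (intro conjI allI impI)
        fix x y
        have "u (x + y) \<le> r y + q x" if qr: "q \<in> C" "r \<in> C" for q r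
        proof -
          obtain m where m: "m \<in> C" "m \<le> q" "m \<le> r" using lin[OF qr] qr by auto
          then have "m (x + y) \<le> m x + m y" using sub sublinear_add by (auto simp: A_def)
          moreover have "m x \<le> q x" "m y \<le> r y" using m by (auto simp: le_fun_def)
          ultimately show ?thesis using ule[OF m(1), of "x + y"] by linarith
        qed
        then have "u (x + y) - q x \<le> u y" if "q \<in> C" for q
          using that by (intro uge) (simp add: diff_le_eq)
        then have "u (x + y) - u y \<le> u x"
          by (intro uge) (simp add: algebra_simps)
        then show "u (x + y) \<le> u x + u y" by simp
      next
        fix c :: real and x
        assume c: "0 \<le> c"
        have le: "u (c *\<^sub>R x) \<le> c * q x" if "q \<in> C" for q
          using ule[OF that, of "c *\<^sub>R x"] sublinear_scale[of q c x] that sub c by (auto simp: A_def)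
        show "u (c *\<^sub>R x) \<le> c * u x"
        proof (cases "c = 0")
          case True
          then show ?thesis using le False by fastforce
        next
          case False
          with c have "0 < c" by simp
          then have "u (c *\<^sub>R x) / c \<le> u x"
            using le by (intro uge) (simp add: field_simps)
          with \<open>0 < c\<close> show ?thesis by (simp add: field_simps)
        qed
      qed
      moreover have "u \<le> p"
      proof -
        obtain q where "q \<in> C" using False by blast
        then have "q \<le> p" using sub by (auto simp: A_def)
        with ule[OF \<open>q \<in> C\<close>] show ?thesis by (auto simp: le_fun_def intro: order_trans)
      qed
      ultimately show ?thesis using ule by (auto simp: A_def P_def le_fun_def)
    qed
  qed
  then obtain q where q: "q \<in> A" "\<And>a. a \<in> A \<Longrightarrow> a \<le> q \<Longrightarrow> a = q" unfolding P_def by blast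
  show thesis
  proof (rule that[of q])
    show "r = q" if "sublinear r" "r \<le> q" for r
      using that q(1) by (intro q(2)) (auto simp: A_def)
  qed (use q(1) in \<open>auto simp: A_def\<close>)
qed

text \<open>Instead of extending from a subspace, the proof takes a minimal sublinear
  \<open>q\<close> below \<open>tilt p x0\<close>. Minimality gives \<open>tilt q y = q\<close>,
  hence superadditivity; the tilt forces \<open>q (- x0) \<le> - p x0\<close>, hence the attained
  value at \<open>x0\<close>.\<close>

theorem hahn_banach:
  fixes p :: "'a::real_vector \<Rightarrow> real"
  assumes p: "sublinear p"
  obtains f where "linear f" "\<And>x. f x \<le> p x" "f x0 = p x0"
proof -
  obtain q where q: "sublinear q" "q \<le> tilt p x0"
    and min: "\<And>r. sublinear r \<Longrightarrow> r \<le> q \<Longrightarrow> r = q"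
    using minimal_sublinear[OF sublinear_tilt[OF p]] by metis
  have "tilt q y = q" for y
    by (rule min[OF sublinear_tilt[OF q(1)]]) (use tilt_le[OF q(1), of 0 y] in \<open>simp add: le_fun_def\<close>)
  then have "q x \<le> q (x + y) - q y" for x y
    using tilt_le[OF q(1), of 1 y x] by simp
  then have add: "q (x + y) = q x + q y" for x y
    using sublinear_add[OF q(1), of x y] by (simp add: antisym algebra_simps)
  have neg: "q (- x) = - q x" for x
    using add[of x "- x"] sublinear_zero[OF q(1)] by simp
  have "linear q"
  proof (rule linearI)
    show "q (c *\<^sub>R x) = c *\<^sub>R q x" for c x
      using sublinear_scale[OF q(1), of c x] sublinear_scale[OF q(1), of "- c" x] neg[of "c *\<^sub>R x"]
      by (cases "0 \<le> c") auto
  qed (rule add)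
  moreover have le: "q x \<le> p x" for x
  proof -
    have "q x \<le> tilt p x0 x" using q(2) by (simp add: le_fun_def)
    then show ?thesis using tilt_le[OF p, of 0 x0 x] by simp
  qed
  moreover have "q x0 = p x0"
  proof -
    have "q (- x0) \<le> tilt p x0 (- x0)" using q(2) by (simp add: le_fun_def)
    also have "\<dots> \<le> - p x0" using tilt_le[OF p, of 1 x0 "- x0"] sublinear_zero[OF p] by simp
    finally show ?thesis using neg[of x0] le[of x0] by simp
  qed
  ultimately show thesis by (rule that)
qed

section \<open>Separation of a point from a subspace by the distance seminorm\<close>

lemma infdist_subspace_le:
  assumes "subspace S" "s \<in> S"
  shows "infdist x S \<le> norm (x - s)"
  using infdist_le[OF assms(2), of x] by (simp add: dist_norm)

lemma infdist_subspace_greatest: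
  fixes S :: "'a::real_normed_vector set"
  assumes "subspace S" "\<And>s. s \<in> S \<Longrightarrow> c \<le> norm (x - s)"
  shows "c \<le> infdist x S"
  using subspace_0[OF assms(1)] assms(2)
  by (auto simp: infdist_def dist_norm intro!: cINF_greatest)

lemma sublinear_infdist:
  fixes S :: "'a::real_normed_vector set"
  assumes S: "subspace S"
  shows "sublinear (\<lambda>x. infdist x S)"
  unfolding sublinear_def
proof (intro conjI allI impI)
  fix x y
  have "infdist (x + y) S \<le> norm (x - s) + norm (y - t)" if "s \<in> S" "t \<in> S" for s t
    using infdist_subspace_le[OF S subspace_add[OF S that], of "x + y"]
      norm_triangle_ineq[of "x - s" "y - t"]
    by (simp add: algebra_simps)
  then have "infdist (x + y) S - norm (x - s) \<le> infdist y S" if "s \<in> S" for s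
    using that by (intro infdist_subspace_greatest[OF S]) (simp add: algebra_simps)
  then have "infdist (x + y) S - infdist y S \<le> infdist x S"
    by (intro infdist_subspace_greatest[OF S]) (simp add: algebra_simps)
  then show "infdist (x + y) S \<le> infdist x S + infdist y S" by simp
next
  fix c :: real and x
  assume c: "0 \<le> c"
  have le: "infdist (c *\<^sub>R x) S \<le> c * norm (x - s)" if "s \<in> S" for s
    using infdist_subspace_le[OF S subspace_scale[OF S that, of c], of "c *\<^sub>R x"] c
    by (simp add: scaleR_diff_right[symmetric])
  show "infdist (c *\<^sub>R x) S \<le> c * infdist x S"
  proof (cases "c = 0")
    case True
    then show ?thesis using le[OF subspace_0[OF S]] by simp
  next
    case False
    with c have "0 < c" by simp
    then have "infdist (c *\<^sub>R x) S / c \<le> infdist x S"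
      using le by (intro infdist_subspace_greatest[OF S]) (simp add: field_simps)
    with \<open>0 < c\<close> show ?thesis by (simp add: field_simps)
  qed
qed

text \<open>A functional below the distance is nonpositive on \<open>S\<close>, hence zero there
  because \<open>S\<close> is symmetric; attaining the distance at \<open>x0\<close> keeps it
  nonzero at that point.\<close>

corollary separate_from_subspace:
  fixes S :: "'a::real_normed_vector set"
  assumes S: "subspace S" and x0: "x0 \<notin> closure S"
  obtains f :: "'a \<Rightarrow>\<^sub>L real" where "\<And>s. s \<in> S \<Longrightarrow> f s = 0" "f x0 \<noteq> 0"
proof -
  obtain f where f: "linear f" "\<And>x. f x \<le> infdist x S" "f x0 = infdist x0 S"
    using hahn_banach[OF sublinear_infdist[OF S]] by blast
  have le: "f x \<le> norm x" for x
    using f(2)[of x] infdist_subspace_le[OF S subspace_0[OF S], of x] by simp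
  have "\<bar>f x\<bar> \<le> norm x" for x
    using le[of x] le[of "- x"] linear_neg[OF f(1), of x] by simp
  then have "bounded_linear f"
    by (intro bounded_linear_intro[where K = 1]) (simp_all add: linear_add[OF f(1)] linear_scale[OF f(1)])
  then have F: "blinfun_apply (Blinfun f) = f" by (rule bounded_linear_Blinfun_apply)
  show thesis
  proof (rule that[of "Blinfun f"])
    have le0: "f s \<le> 0" if "s \<in> S" for s
      using f(2)[of s] that by simp
    show "Blinfun f s = 0" if "s \<in> S" for s
      using le0[OF that] le0[OF subspace_neg[OF S that]] linear_neg[OF f(1), of s]
      unfolding F by simp
    have "S \<noteq> {}" using subspace_0[OF S] by blast
    then show "Blinfun f x0 \<noteq> 0"
      using x0 in_closure_iff_infdist_zero[of S x0] unfolding F f(3) by blast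
  qed
qed

section \<open>Linear functionals extending the limit to all bounded real sequences\<close>

lemma apply_Bcontfun_seq:
  fixes a :: "nat \<Rightarrow> 'a::real_normed_vector"
  assumes "Bseq a"
  shows "apply_bcontfun (Bcontfun a) = a"
proof -
  have "a \<in> bcontfun"
    using assms by (auto simp: bcontfun_def Bseq_eq_bounded)
  then show ?thesis by (rule Bcontfun_inverse)
qed

lemma eventual_bounds:
  fixes t :: "nat \<Rightarrow>\<^sub>C real"
  shows "norm t \<in> {c. \<forall>\<^sub>F n in sequentially. t n \<le> c}"
    "bdd_below {c. \<forall>\<^sub>F n in sequentially. t n \<le> c}"
proof -
  have n: "\<bar>t n\<bar> \<le> norm t" for n using norm_bounded[of t n] by simp
  then have "t n \<le> norm t" for n using abs_le_D1 by blast
  then show "norm t \<in> {c. \<forall>\<^sub>F n in sequentially. t n \<le> c}" by simp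
  have "- norm t \<le> c" if c: "\<forall>\<^sub>F n in sequentially. t n \<le> c" for c
  proof -
    obtain k where "t k \<le> c" using c by (auto simp: eventually_sequentially)
    then show ?thesis using n[of k] by linarith
  qed
  then show "bdd_below {c. \<forall>\<^sub>F n in sequentially. t n \<le> c}" by (auto simp: bdd_below_def)
qed

text \<open>The infimum is the limit superior of \<open>t\<close>. Bounded sequences are modelled as
  bounded continuous functions on the discrete space of natural numbers.\<close>

lemma sublinear_eventual_bound:
  "sublinear (\<lambda>t :: nat \<Rightarrow>\<^sub>C real. Inf {c. \<forall>\<^sub>F n in sequentially. t n \<le> c})"
proof -
  define p where "p t = Inf {c. \<forall>\<^sub>F n in sequentially. t n \<le> c}" for t :: "nat \<Rightarrow>\<^sub>C real"
  have le: "p t \<le> c" if "\<forall>\<^sub>F n in sequentially. t n \<le> c" for t :: "nat \<Rightarrow>\<^sub>C real" and c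
    unfolding p_def by (rule cInf_lower) (use that eventual_bounds in auto)
  have ge: "c \<le> p t" if "\<And>b. \<forall>\<^sub>F n in sequentially. t n \<le> b \<Longrightarrow> c \<le> b"
    for t :: "nat \<Rightarrow>\<^sub>C real" and c
    unfolding p_def by (rule cInf_greatest) (use that eventual_bounds(1)[of t] in auto)
  have "sublinear p"
    unfolding sublinear_def
  proof (intro conjI allI impI)
    fix s t :: "nat \<Rightarrow>\<^sub>C real"
    have "p (s + t) \<le> c + b" if "\<forall>\<^sub>F n in sequentially. s n \<le> b" "\<forall>\<^sub>F n in sequentially. t n \<le> c"
      for b c
      by (rule le) (use that in eventually_elim, simp)
    then have "p (s + t) - b \<le> p t" if "\<forall>\<^sub>F n in sequentially. s n \<le> b" for b
      using that by (intro ge) (simp add: diff_le_eq)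
    then have "p (s + t) - p t \<le> p s"
      by (intro ge) (simp add: algebra_simps)
    then show "p (s + t) \<le> p s + p t" by simp
  next
    fix c :: real and t :: "nat \<Rightarrow>\<^sub>C real"
    assume c: "0 \<le> c"
    have l: "p (c *\<^sub>R t) \<le> c * b" if "\<forall>\<^sub>F n in sequentially. t n \<le> b" for b
      by (rule le) (use that in eventually_elim, use c in \<open>simp add: mult_left_mono\<close>)
    show "p (c *\<^sub>R t) \<le> c * p t"
    proof (cases "c = 0")
      case True
      then show ?thesis using l eventual_bounds(1)[of t] by fastforce
    next
      case False
      with c have "0 < c" by simp
      then have "p (c *\<^sub>R t) / c \<le> p t"
        using l by (intro ge) (simp add: field_simps)
      with \<open>0 < c\<close> show ?thesis by (simp add: field_simps)
    qed
  qed
  then show ?thesis by (simp add: p_def[abs_def])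
qed

text \<open>Domination by the limit superior, applied to \<open>a\<close> and to \<open>- a\<close>,
  squeezes \<open>L a\<close> between limit inferior and limit superior. \<open>Bcontfun a\<close>
  is meaningful only for bounded \<open>a\<close>, hence the \<open>Bseq\<close> conditions.\<close>

corollary generalized_limit:
  obtains L :: "(nat \<Rightarrow> real) \<Rightarrow> real" where
    "\<And>a b. Bseq a \<Longrightarrow> Bseq b \<Longrightarrow> L (\<lambda>n. a n + b n) = L a + L b"
    "\<And>a c. Bseq a \<Longrightarrow> L (\<lambda>n. c * a n) = c * L a"
    "\<And>a B. (\<And>n. \<bar>a n\<bar> \<le> B) \<Longrightarrow> \<bar>L a\<bar> \<le> B"
    "\<And>a l. a \<longlonglongrightarrow> l \<Longrightarrow> L a = l"
proof -
  obtain f :: "(nat \<Rightarrow>\<^sub>C real) \<Rightarrow> real" where f: "linear f"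
    and le: "\<And>t. f t \<le> Inf {c. \<forall>\<^sub>F n in sequentially. t n \<le> c}"
    using hahn_banach[OF sublinear_eventual_bound] by metis
  define L where "L a = f (Bcontfun a)" for a
  have up: "L a \<le> c" if "Bseq a" "\<forall>\<^sub>F n in sequentially. a n \<le> c" for a c
    using le[of "Bcontfun a"]
      cInf_lower[OF _ eventual_bounds(2), of c "Bcontfun a"] that
    by (auto simp: L_def apply_Bcontfun_seq)
  have add: "L (\<lambda>n. a n + b n) = L a + L b" if "Bseq a" "Bseq b" for a b
  proof -
    have "Bseq (\<lambda>n. a n + b n)"
      using that by (simp add: Bseq_eq_bounded bounded_plus_comp)
    then have "Bcontfun (\<lambda>n. a n + b n) = Bcontfun a + Bcontfun b"
      using that by (intro bcontfun_eqI) (simp add: apply_Bcontfun_seq)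
    then show ?thesis by (simp add: L_def linear_add[OF f])
  qed
  have scale: "L (\<lambda>n. c * a n) = c * L a" if "Bseq a" for a c
  proof -
    have "Bseq (\<lambda>n. c * a n)" using Bseq_mult[OF Bfun_const that] by simp
    then have "Bcontfun (\<lambda>n. c * a n) = c *\<^sub>R Bcontfun a"
      using that by (intro bcontfun_eqI) (simp add: apply_Bcontfun_seq)
    then show ?thesis by (simp add: L_def linear_scale[OF f])
  qed
  have low: "c \<le> L a" if "Bseq a" "\<forall>\<^sub>F n in sequentially. c \<le> a n" for a c
    using up[of "\<lambda>n. - 1 * a n" "- c"] scale[OF that(1), of "- 1"] that by (simp add: Bseq_minus_iff)
  show thesis
  proof (rule that[of L, OF add scale])
    fix a :: "nat \<Rightarrow> real" and B
    assume B: "\<And>n. \<bar>a n\<bar> \<le> B"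
    then have "Bseq a" by (intro BseqI'[of _ B]) simp
    moreover have "a n \<le> B" "- B \<le> a n" for n using B[of n] by auto
    ultimately show "\<bar>L a\<bar> \<le> B" using up[of a B] low[of a "- B"] by auto
  next
    fix a :: "nat \<Rightarrow> real" and l
    assume a: "a \<longlonglongrightarrow> l"
    then have B: "Bseq a" using convergent_imp_Bseq convergent_def by blast
    have "\<bar>L a - l\<bar> \<le> e" if "0 < e" for e
    proof -
      have "\<forall>\<^sub>F n in sequentially. dist (a n) l < e" using a that by (rule tendstoD)
      then have "\<forall>\<^sub>F n in sequentially. a n \<le> l + e" "\<forall>\<^sub>F n in sequentially. l - e \<le> a n"
        by (eventually_elim, simp add: dist_real_def abs_le_iff)+
      from up[OF B this(1)] low[OF B this(2)] show ?thesis by simp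
    qed
    then have "\<bar>L a - l\<bar> \<le> 0" by (rule field_le_epsilon) simp
    then show "L a = l" by simp
  qed
qed


section \<open>Norm estimates in geometric modules\<close>

lemma apply_Bcontfun_bounded:
  fixes f :: "'x::topological_space \<Rightarrow> real"
  assumes "continuous_on UNIV f" "\<And>x. \<bar>f x\<bar> \<le> B"
  shows "apply_bcontfun (Bcontfun f) = f"
  using assms by (intro Bcontfun_inverse bcontfun_normI[of f B]) simp_all

lemma continuous_on_bcontfun [continuous_intros]:
  "continuous_on S f \<Longrightarrow> continuous_on S (\<lambda>x. apply_bcontfun t (f x))"
  by (rule continuous_on_compose2[OF continuous_on_apply_bcontfun[of UNIV t]]) auto

context
  fixes \<rho> :: "('x::topological_space \<Rightarrow>\<^sub>C real) \<Rightarrow> 'e::real_normed_vector \<Rightarrow> 'e"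
  assumes \<rho>: "C_module \<rho>"
begin

lemma module_linear_left: "linear (\<lambda>t. \<rho> t v)"
  using \<rho> by (simp add: C_module_def bilinear_def)

lemma module_linear_right: "linear (\<rho> t)"
  using \<rho> unfolding C_module_def bilinear_def by (metis eta_contract_eq)

lemma module_mult: "\<rho> (s * t) v = \<rho> s (\<rho> t v)"
  using \<rho> by (simp add: C_module_def)

lemma module_one: "\<rho> 1 v = v"
  using \<rho> by (simp add: C_module_def)

lemma norm_module_le:
  fixes t :: "'x \<Rightarrow>\<^sub>C real"
  assumes "\<And>x. \<bar>t x\<bar> \<le> B"
  shows "norm (\<rho> t v) \<le> B * norm v"
proof -
  have "norm (\<rho> t v) \<le> norm t * norm v"
    using \<rho> by (simp add: C_module_def)
  also have "\<dots> \<le> B * norm v"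
    using assms by (intro mult_right_mono norm_bound) auto
  finally show ?thesis .
qed

lemma norm_module_disjoint:
  fixes f1 f2 t1 t2 :: "'x \<Rightarrow>\<^sub>C real"
  assumes "ell1_geometric \<rho>" "f1 * t1 = t1" "f2 * t2 = t2"
    and "{x. f1 x \<noteq> 0} \<subseteq> C1" "{x. f2 x \<noteq> 0} \<subseteq> C2" "closed C1" "closed C2" "C1 \<inter> C2 = {}"
  shows "norm (\<rho> t1 v) + norm (\<rho> t2 w) = norm (\<rho> t1 v + \<rho> t2 w)"
proof -
  have "closure {x. f1 x \<noteq> 0} \<inter> closure {x. f2 x \<noteq> 0} = {}"
    using closure_minimal[OF assms(4,6)] closure_minimal[OF assms(5,7)] assms(8) by blast
  moreover have "\<rho> f1 (\<rho> t1 v) = \<rho> t1 v" "\<rho> f2 (\<rho> t2 w) = \<rho> t2 w"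
    using assms(2,3) by (simp_all add: module_mult[symmetric])
  ultimately have "disjointly_supported \<rho> (\<rho> t1 v) (\<rho> t2 w)"
    unfolding disjointly_supported_def by blast
  with assms(1) show ?thesis by (simp add: ell1_geometric_def)
qed

text \<open>Layer-cake formula: the \<open>k\<close>-th term is the length of the part of the
  interval from \<open>0\<close> to \<open>y\<close> between \<open>k\<close> and
  \<open>k + 1\<close>.\<close>

lemma sum_clamp: "0 \<le> y \<Longrightarrow> (\<Sum>k<n. max 0 (min 1 (y - real k))) = min y (real n)"
  by (induction n) auto

text \<open>The layers \<open>r k\<close> of \<open>K * a\<close> satisfy that \<open>r (k + 4)\<close> and \<open>1 - r k\<close> are disjointly supported;
  shifting the sum over \<open>k\<close> by \<open>4\<close> costs only \<open>4 * norm w\<close>, which disappears after division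
  by \<open>K\<close>.\<close>

lemma norm_module_complement:
  fixes a :: "'x \<Rightarrow>\<^sub>C real"
  assumes geo: "ell1_geometric \<rho>" and a: "\<And>x. 0 \<le> a x" "\<And>x. a x \<le> 1"
  shows "norm (\<rho> a w) + norm (\<rho> (1 - a) w) \<le> norm w"
proof -
  have layers: "real K * (norm (\<rho> a w) + norm (\<rho> (1 - a) w)) \<le> (real K + 4) * norm w" for K :: nat
  proof -
    define r :: "nat \<Rightarrow> 'x \<Rightarrow>\<^sub>C real" where
      "r k = Bcontfun (\<lambda>x. max 0 (min 1 (real K * a x - real k)))" for k
    have r: "r k x = max 0 (min 1 (real K * a x - real k))" for k x
      unfolding r_def by (subst apply_Bcontfun_bounded[where B = 1]) (auto intro!: continuous_intros)
    have nr: "norm (\<rho> (r k) w) \<le> norm w" for k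
      using norm_module_le[of "r k" 1] by (simp add: r)
    have "(\<Sum>k<K. r k) = real K *\<^sub>R a"
    proof (rule bcontfun_eqI)
      fix x
      show "(\<Sum>k<K. r k) x = (real K *\<^sub>R a) x"
        using a[of x] by (simp add: apply_bcontfun_sum r sum_clamp mult_left_le)
    qed
    then have sum: "real K *\<^sub>R \<rho> a w = (\<Sum>k<K. \<rho> (r k) w)"
      by (simp add: linear_scale[OF module_linear_left, symmetric] linear_sum[OF module_linear_left, symmetric])
    have "real K *\<^sub>R \<rho> (1 - a) w = real K *\<^sub>R w - (\<Sum>k<K. \<rho> (r k) w)"
      by (simp add: linear_diff[OF module_linear_left] module_one scaleR_diff_right sum)
    also have "\<dots> = (\<Sum>k<K. \<rho> (1 - r k) w)"
      by (simp add: linear_diff[OF module_linear_left] module_one sum_subtractf sum_constant_scaleR)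
    finally have "real K * norm (\<rho> (1 - a) w) \<le> (\<Sum>k<K. norm (\<rho> (1 - r k) w))"
      using norm_sum[of "\<lambda>k. \<rho> (1 - r k) w" "{..<K}"]
      by (metis abs_of_nat norm_scaleR)
    moreover have "real K * norm (\<rho> a w) \<le> (\<Sum>k<K. norm (\<rho> (r k) w))"
      using norm_sum[of "\<lambda>k. \<rho> (r k) w" "{..<K}"] by (metis abs_of_nat norm_scaleR sum)
    moreover have "(\<Sum>k<K. norm (\<rho> (r k) w)) \<le> 4 * norm w + (\<Sum>k<K. norm (\<rho> (r (k + 4)) w))"
    proof -
      have "(\<Sum>k<K. norm (\<rho> (r k) w)) \<le> (\<Sum>k<4 + K. norm (\<rho> (r k) w))"
        by (rule sum_mono2) auto
      also have "\<dots> = (\<Sum>k<4. norm (\<rho> (r k) w)) + (\<Sum>k<K. norm (\<rho> (r (k + 4)) w))"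
        using sum.atLeastLessThan_concat[of 0 4 "4 + K" "\<lambda>k. norm (\<rho> (r k) w)"]
          sum.shift_bounds_nat_ivl[of "\<lambda>k. norm (\<rho> (r k) w)" 0 4 K]
        by (simp add: lessThan_atLeast0 add.commute)
      also have "(\<Sum>k<4::nat. norm (\<rho> (r k) w)) \<le> 4 * norm w"
        using sum_bounded_above[of "{..<4::nat}" "\<lambda>k. norm (\<rho> (r k) w)" "norm w"] nr by simp
      finally show ?thesis by simp
    qed
    moreover have "norm (\<rho> (r (k + 4)) w) + norm (\<rho> (1 - r k) w) \<le> norm w" for k
    proof -
      have "norm (\<rho> (r (k + 4)) w) + norm (\<rho> (1 - r k) w) =
          norm (\<rho> (r (k + 4)) w + \<rho> (1 - r k) w)"
      proof (rule norm_module_disjoint[OF geo])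
        \<comment> \<open>The cutoffs vary between \<open>k + 1\<close> and \<open>k + 2\<close> and
          between \<open>k + 3\<close> and \<open>k + 4\<close>; the gap from \<open>k + 2\<close>
          to \<open>k + 3\<close> keeps their closed supports apart. This is the origin of the shift
          by \<open>4\<close>.\<close>
        show "r (k + 3) * r (k + 4) = r (k + 4)" "(1 - r (k + 1)) * (1 - r k) = 1 - r k"
          by (rule bcontfun_eqI, auto simp: r min_def max_def)+
        show "{x. r (k + 3) x \<noteq> 0} \<subseteq> {x. real k + 3 \<le> real K * a x}"
          "{x. (1 - r (k + 1)) x \<noteq> 0} \<subseteq> {x. real K * a x \<le> real k + 2}"
          by (auto simp: r min_def max_def split: if_splits)
        show "closed {x. real k + 3 \<le> real K * a x}" "closed {x. real K * a x \<le> real k + 2}"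
          by (intro closed_Collect_le continuous_intros)+
      qed auto
      \<comment> \<open>The layers decrease in \<open>k\<close>, so the combined function takes
        values in the unit interval.\<close>
      also have "\<dots> = norm (\<rho> (r (k + 4) + (1 - r k)) w)"
        by (simp add: linear_add[OF module_linear_left])
      also have "\<dots> \<le> 1 * norm w"
        by (rule norm_module_le) (auto simp: r min_def max_def)
      finally show ?thesis by simp
    qed
    then have "(\<Sum>k<K. norm (\<rho> (r (k + 4)) w)) + (\<Sum>k<K. norm (\<rho> (1 - r k) w)) \<le> real K * norm w"
      using sum_bounded_above[of "{..<K}" "\<lambda>k. norm (\<rho> (r (k + 4)) w) + norm (\<rho> (1 - r k) w)" "norm w"]
      by (simp add: sum.distrib)
    ultimately show ?thesis by (simp add: algebra_simps)
  qed
  show ?thesis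
  proof (rule ccontr)
    assume "\<not> ?thesis"
    then have "0 < norm (\<rho> a w) + norm (\<rho> (1 - a) w) - norm w" by simp
    from reals_Archimedean3[OF this] obtain K
      where "4 * norm w < real K * (norm (\<rho> a w) + norm (\<rho> (1 - a) w) - norm w)" by blast
    with layers[of K] show False by (simp add: algebra_simps)
  qed
qed

text \<open>With \<open>u = s + t + e\<close> and \<open>a = s / u\<close>, the estimate for
  \<open>a\<close> and \<open>1 - a\<close> is applied to the vector \<open>\<rho> u v\<close>. The
  constant \<open>e\<close> keeps \<open>u\<close> positive where \<open>s + t\<close> vanishes, and
  costs \<open>2 * (e * norm v)\<close>.\<close>

lemma norm_module_add:
  fixes s t :: "'x \<Rightarrow>\<^sub>C real"
  assumes geo: "ell1_geometric \<rho>" and pos: "\<And>x. 0 \<le> s x" "\<And>x. 0 \<le> t x"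
  shows "norm (\<rho> s v) + norm (\<rho> t v) \<le> norm (\<rho> (s + t) v)"
proof (rule field_le_epsilon)
  fix d :: real
  assume "0 < d"
  define e where "e = d / (2 * (norm v + 1))"
  have e: "0 < e" using \<open>0 < d\<close> by (simp add: e_def add_nonneg_pos)
  have "2 * (e * norm v) \<le> d"
    using \<open>0 < d\<close> by (simp add: e_def divide_simps add_nonneg_pos)
  define u where "u = s + t + e *\<^sub>R 1"
  define a where "a = Bcontfun (\<lambda>x. s x / u x)"
  have u: "0 < u x" "s x \<le> u x" for x
    using pos[of x] e by (auto simp: u_def)
  have a: "a x = s x / u x" for x
    unfolding a_def
    by (subst apply_Bcontfun_bounded[where B = 1])
      (use u pos in \<open>auto intro!: continuous_intros simp: less_imp_neq[OF u(1), symmetric]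
        abs_of_pos[OF u(1)]\<close>)
  have "norm (\<rho> a (\<rho> u v)) + norm (\<rho> (1 - a) (\<rho> u v)) \<le> norm (\<rho> u v)"
    by (rule norm_module_complement[OF geo]) (use u pos in \<open>auto simp: a divide_le_eq_1 less_imp_le\<close>)
  moreover have "a * u = s"
    by (rule bcontfun_eqI) (simp add: a less_imp_neq[OF u(1), symmetric])
  moreover from this have "(1 - a) * u = t + e *\<^sub>R 1"
    by (simp add: left_diff_distrib) (simp add: u_def)
  ultimately have "norm (\<rho> s v) + norm (\<rho> t v + e *\<^sub>R v) \<le> norm (\<rho> (s + t) v + e *\<^sub>R v)"
    by (simp add: module_mult[symmetric])
      (simp add: u_def linear_add[OF module_linear_left] linear_scale[OF module_linear_left] module_one)
  moreover have "norm (\<rho> t v) - e * norm v \<le> norm (\<rho> t v + e *\<^sub>R v)"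
    using norm_diff_ineq[of "\<rho> t v" "e *\<^sub>R v"] e by simp
  moreover have "norm (\<rho> (s + t) v + e *\<^sub>R v) \<le> norm (\<rho> (s + t) v) + e * norm v"
    using norm_triangle_ineq[of "\<rho> (s + t) v" "e *\<^sub>R v"] e by simp
  ultimately show "norm (\<rho> s v) + norm (\<rho> t v) \<le> norm (\<rho> (s + t) v) + d"
    using \<open>2 * (e * norm v) \<le> d\<close> by linarith
qed

lemma sum_norm_module_nonneg:
  fixes t :: "'i \<Rightarrow> 'x \<Rightarrow>\<^sub>C real"
  assumes geo: "ell1_geometric \<rho>" and pos: "\<And>i x. i \<in> I \<Longrightarrow> 0 \<le> t i x"
  shows "(\<Sum>i\<in>I. norm (\<rho> (t i) v)) \<le> norm (\<rho> (\<Sum>i\<in>I. t i) v)"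
  using pos
proof (induction I rule: infinite_finite_induct)
  case (insert i I)
  then have "(\<Sum>i\<in>insert i I. norm (\<rho> (t i) v)) \<le> norm (\<rho> (t i) v) + norm (\<rho> (\<Sum>i\<in>I. t i) v)"
    by simp
  also have "\<dots> \<le> norm (\<rho> (t i + (\<Sum>i\<in>I. t i)) v)"
    by (rule norm_module_add[OF geo]) (use insert.prems in \<open>auto simp: apply_bcontfun_sum intro: sum_nonneg\<close>)
  finally show ?case using insert.hyps by simp
qed auto

text \<open>Replacing \<open>t i\<close> by its absolute value, the sum of the positive part
  \<open>p i\<close> and the negative part \<open>p i - t i\<close>, can only increase the norm of
  \<open>\<rho> (t i) v\<close>; for nonnegative functions the norms are superadditive, and the
  total is bounded by \<open>B\<close> pointwise.\<close>

lemma sum_norm_module: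
  fixes t :: "'i \<Rightarrow> 'x \<Rightarrow>\<^sub>C real"
  assumes geo: "ell1_geometric \<rho>" and B: "\<And>x. (\<Sum>i\<in>I. \<bar>t i x\<bar>) \<le> B"
  shows "(\<Sum>i\<in>I. norm (\<rho> (t i) v)) \<le> B * norm v"
proof -
  define p where "p i = Bcontfun (\<lambda>x. max 0 (t i x))" for i
  have p: "p i x = max 0 (t i x)" for i x
    unfolding p_def
  proof (subst apply_Bcontfun_bounded[where B = "norm (t i)"])
    show "\<bar>max 0 (t i x)\<bar> \<le> norm (t i)" for x
      using norm_bounded[of "t i" x] by simp
  qed (auto intro!: continuous_intros)
  have "(\<Sum>i\<in>I. norm (\<rho> (t i) v)) \<le> (\<Sum>i\<in>I. norm (\<rho> (p i + (p i - t i)) v))"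
  proof (rule sum_mono)
    fix i
    have "norm (\<rho> (t i) v) \<le> norm (\<rho> (p i) v) + norm (\<rho> (p i - t i) v)"
      using norm_triangle_ineq4[of "\<rho> (p i) v" "\<rho> (p i - t i) v"]
      by (simp add: linear_diff[OF module_linear_left])
    also have "\<dots> \<le> norm (\<rho> (p i + (p i - t i)) v)"
      by (rule norm_module_add[OF geo]) (auto simp: p)
    finally show "norm (\<rho> (t i) v) \<le> norm (\<rho> (p i + (p i - t i)) v)" .
  qed
  also have "\<dots> \<le> norm (\<rho> (\<Sum>i\<in>I. p i + (p i - t i)) v)"
    by (rule sum_norm_module_nonneg[OF geo]) (auto simp: p)
  also have "\<dots> \<le> B * norm v"
  proof (rule norm_module_le)
    fix x
    have "\<bar>(\<Sum>i\<in>I. p i + (p i - t i)) x\<bar> = \<bar>\<Sum>i\<in>I. \<bar>t i x\<bar>\<bar>"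
      unfolding apply_bcontfun_sum by (intro arg_cong[where f = abs] sum.cong) (auto simp: p)
    then show "\<bar>(\<Sum>i\<in>I. p i + (p i - t i)) x\<bar> \<le> B" using B[of x] by simp
  qed
  finally show ?thesis .
qed

end


section \<open>Amenability implies vanishing\<close>

lemma differential_diff:
  "differential (\<lambda>gs. \<phi> gs - \<psi> gs) = (\<lambda>gs. differential \<phi> gs - differential \<psi> gs)"
  by (simp add: differential_def fun_eq_iff sum_subtractf scaleR_diff_right)

lemma bounded_cocycles_diff:
  assumes \<alpha>: "isometric_action \<alpha>" and "\<phi> \<in> bounded_cocycles \<alpha> m" "\<psi> \<in> bounded_cocycles \<alpha> m"
  shows "(\<lambda>gs. \<phi> gs - \<psi> gs) \<in> bounded_cocycles \<alpha> m"
proof -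
  have "linear (dual_act \<alpha> k)" for k
    using isometric_action_dual[OF \<alpha>] by (simp add: isometric_action_def)
  from linear_diff[OF this] show ?thesis
    using assms(2,3)
    by (auto simp: bounded_cocycles_def bounded_cochains_def differential_diff
        intro!: bounded_minus_comp)
qed

lemma zero_bounded_cocycle:
  assumes \<alpha>: "isometric_action \<alpha>"
  shows "(\<lambda>_. 0) \<in> bounded_cocycles \<alpha> m"
proof -
  have "linear (dual_act \<alpha> k)" for k
    using isometric_action_dual[OF \<alpha>] by (simp add: isometric_action_def)
  from linear_0[OF this] show ?thesis
    by (auto simp: bounded_cocycles_def bounded_cochains_def differential_def
        intro!: boundedI[where B = 0])
qed

lemma trivial_cohomologyI:
  assumes \<alpha>: "isometric_action \<alpha>"
    and cob: "\<And>\<phi>. \<phi> \<in> bounded_cocycles \<alpha> m \<Longrightarrow> \<phi> \<in> bounded_coboundaries \<alpha> m"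
  shows "trivial_cohomology \<alpha> m"
proof -
  have "cohomology_class \<alpha> m \<phi> = bounded_cocycles \<alpha> m" if "\<phi> \<in> bounded_cocycles \<alpha> m" for \<phi>
    using that cob[OF bounded_cocycles_diff[OF \<alpha> that]]
    by (auto simp: cohomology_class_def cohomologous_def)
  then show ?thesis
    using zero_bounded_cocycle[OF \<alpha>, of m]
    unfolding trivial_cohomology_def bounded_cohomology_def quotient_def
    by (force simp: cohomology_class_def)
qed

text \<open>For a cocycle the left side is zero, so \<open>\<phi> gs\<close> is recovered from
  values whose first entry \<open>h\<close> is arbitrary; averaging over \<open>h\<close> then gives
  a primitive. The sign changes because an entry of \<open>gs\<close> sits one position later in
  \<open>h # gs\<close>.\<close>

lemma differential_Cons:
  "differential \<phi> (h # gs) =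
    \<phi> gs - (\<Sum>i<length gs. (-1) ^ i *\<^sub>R \<phi> (h # (take i gs @ drop (Suc i) gs)))"
  unfolding differential_def length_Cons sum.lessThan_Suc_shift by (simp add: sum_negf)

text \<open>Average of the functionals \<open>c h\<close> with weights from \<open>C(X)\<close>,
  each weight acting on the argument \<open>v\<close>. A sum over an infinite set is
  \<open>0\<close>, so finitely supported \<open>f\<close> are the ones of interest.\<close>

definition module_pairing :: "(('x::topological_space \<Rightarrow>\<^sub>C real) \<Rightarrow> 'e \<Rightarrow> 'e) \<Rightarrow>
    ('g \<Rightarrow> 'e::real_normed_vector \<Rightarrow>\<^sub>L real) \<Rightarrow> ('g, 'x) ell1_sup \<Rightarrow> 'e \<Rightarrow> real"
  where "module_pairing \<rho> c f v = (\<Sum>h | coord f h \<noteq> 0. c h (\<rho> (coord f h) v))"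

lemma finite_support_W00: "f \<in> W00 \<Longrightarrow> finite {h. coord f h \<noteq> 0}"
  by (simp add: W00_def)

lemma W00_subset_W0: "W00 \<subseteq> W0"
  by (simp add: W0_def closure_subset)

lemma norm_W00_nonneg:
  fixes f :: "('g, 'x::topological_space) ell1_sup"
  assumes f: "f \<in> W00" "pi_W0 f = 1" and pos: "\<And>g x. 0 \<le> coord f g x"
  shows "norm f \<le> 1"
  unfolding norm_ell1_sup_iff sup_bounded_by_def
proof (intro allI impI)
  fix F :: "'g set" and x
  assume "finite F"
  then have "(\<Sum>g\<in>F. \<bar>coord f g x\<bar>) \<le> (\<Sum>\<^sub>\<infinity>g. \<bar>coord f g x\<bar>)"
    by (intro finite_sum_le_infsum summable_coord) auto
  also have "\<dots> = pi_W0 f"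
    using f(1) W00_subset_W0 pos by (subst pi_W0_eq[of f x]) auto
  finally show "(\<Sum>g\<in>F. \<bar>coord f g x\<bar>) \<le> 1" by (simp add: f)
qed

context
  fixes \<rho> :: "('x::topological_space \<Rightarrow>\<^sub>C real) \<Rightarrow> 'e::real_normed_vector \<Rightarrow> 'e"
  assumes \<rho>: "C_module \<rho>"
begin

lemma module_pairing_superset:
  assumes "finite F" "{h. coord f h \<noteq> 0} \<subseteq> F"
  shows "module_pairing \<rho> c f v = (\<Sum>h\<in>F. c h (\<rho> (coord f h) v))"
  unfolding module_pairing_def using assms
  by (intro sum.mono_neutral_left) (auto simp: linear_0[OF module_linear_left[OF \<rho>]] blinfun.bilinear_simps)

lemma module_pairing_diff:
  assumes "finite {h. coord f h \<noteq> 0}" "finite {h. coord f' h \<noteq> 0}"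
  shows "module_pairing \<rho> c (f - f') v = module_pairing \<rho> c f v - module_pairing \<rho> c f' v"
proof -
  let ?F = "{h. coord f h \<noteq> 0} \<union> {h. coord f' h \<noteq> 0}"
  have "finite ?F" using assms by simp
  then show ?thesis
    by (subst (1 2 3) module_pairing_superset[of ?F])
      (auto simp: minus_ell1_sup.rep_eq linear_diff[OF module_linear_left[OF \<rho>]]
        blinfun.bilinear_simps sum_subtractf)
qed

text \<open>Here the geometry of the module enters: \<open>sum_norm_module\<close> gives a bound by
  the norm of \<open>f\<close>, independent of the size of the support.\<close>

lemma module_pairing_bound:
  assumes geo: "ell1_geometric \<rho>" and fin: "finite {h. coord f h \<noteq> 0}"
    and c: "\<And>h. norm (c h) \<le> C"
  shows "\<bar>module_pairing \<rho> c f v\<bar> \<le> C * (norm f * norm v)"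
proof -
  have C: "0 \<le> C" using norm_ge_zero c order_trans by blast
  have "\<bar>c h (\<rho> (coord f h) v)\<bar> \<le> C * norm (\<rho> (coord f h) v)" for h
    using norm_blinfun[of "c h" "\<rho> (coord f h) v"] mult_right_mono[OF c, of "norm (\<rho> (coord f h) v)" h]
    by simp
  then have "\<bar>module_pairing \<rho> c f v\<bar> \<le> (\<Sum>h | coord f h \<noteq> 0. C * norm (\<rho> (coord f h) v))"
    unfolding module_pairing_def by (intro order_trans[OF sum_abs] sum_mono)
  also have "\<dots> = C * (\<Sum>h | coord f h \<noteq> 0. norm (\<rho> (coord f h) v))"
    by (simp add: sum_distrib_left)
  also have "\<dots> \<le> C * (norm f * norm v)"
    using sup_bounded_by_norm[of f] fin C unfolding sup_bounded_by_def
    by (intro mult_left_mono sum_norm_module[OF \<rho> geo]) auto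
  finally show ?thesis .
qed

lemma module_pairing_add:
  "module_pairing \<rho> c f (v + w) = module_pairing \<rho> c f v + module_pairing \<rho> c f w"
  by (simp add: module_pairing_def linear_add[OF module_linear_right[OF \<rho>]]
      blinfun.bilinear_simps sum.distrib)

lemma module_pairing_scale: "module_pairing \<rho> c f (a *\<^sub>R v) = a * module_pairing \<rho> c f v"
  by (simp add: module_pairing_def linear_scale[OF module_linear_right[OF \<rho>]]
      blinfun.bilinear_simps sum_distrib_left)

lemma module_pairing_const:
  assumes "f \<in> W00" "pi_W0 f = 1"
  shows "module_pairing \<rho> (\<lambda>_. a) f v = a v"
proof -
  have "module_pairing \<rho> (\<lambda>_. a) f v = a (\<rho> (\<Sum>h | coord f h \<noteq> 0. coord f h) v)"
    by (simp add: module_pairing_def linear_sum[OF module_linear_left[OF \<rho>]] blinfun.sum_right)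
  also have "(\<Sum>h | coord f h \<noteq> 0. coord f h) = 1"
    using pi_W0_characterization assms by auto
  finally show ?thesis by (simp add: module_one[OF \<rho>])
qed

end

text \<open>Substituting \<open>k + h\<close> for \<open>h\<close> and using equivariance of
  \<open>\<rho>\<close> moves \<open>k\<close> from the functionals to the weights and the
  vector.\<close>

lemma module_pairing_act:
  assumes act: "homeo_action act" and mod: "G_C_module act \<rho> \<alpha>"
    and fin: "finite {h. coord f h \<noteq> 0}"
    and c: "\<And>h. c (k + h) = dual_act \<alpha> k (c' h)"
  shows "module_pairing \<rho> c f v = module_pairing \<rho> c' (V_act act (- k) f) (\<alpha> (- k) v)"
proof -
  let ?S = "{h. coord f h \<noteq> 0}"
  have \<rho>: "C_module \<rho>" and \<alpha>: "isometric_action \<alpha>"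
    and eq: "\<And>g t v. \<alpha> g (\<rho> t v) = \<rho> (C_act act g t) (\<alpha> g v)"
    using mod by (auto simp: G_C_module_def)
  have S: "?S = (\<lambda>h. k + h) ` (\<lambda>h. - k + h) ` ?S"
    by (simp add: image_image add.assoc[symmetric])
  have "coord (V_act act (- k) f) h = 0" if "h \<notin> (\<lambda>h. - k + h) ` ?S" for h
  proof -
    have "coord f (k + h) = 0"
      using that by (force simp: image_iff add.assoc[symmetric])
    then show ?thesis
      by (intro bcontfun_eqI) (simp add: coord_V_act[OF act] apply_C_act[OF act])
  qed
  then have "module_pairing \<rho> c' (V_act act (- k) f) (\<alpha> (- k) v) =
      (\<Sum>h\<in>(\<lambda>h. - k + h) ` ?S. c' h (\<rho> (coord (V_act act (- k) f) h) (\<alpha> (- k) v)))"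
    using fin by (intro module_pairing_superset[OF \<rho>]) auto
  also have "\<dots> = (\<Sum>h\<in>(\<lambda>h. - k + h) ` ?S. c (k + h) (\<rho> (coord f (k + h)) v))"
    by (simp add: c dual_act_apply[OF \<alpha>] eq coord_V_act[OF act])
  also have "\<dots> = module_pairing \<rho> c f v"
    unfolding module_pairing_def by (subst (2) S) (subst sum.reindex, auto simp: inj_on_def)
  finally show ?thesis ..
qed

lemma finite_support_V_act:
  assumes "homeo_action act" "f \<in> W00"
  shows "finite {h. coord (V_act act k f) h \<noteq> 0}"
  by (rule finite_support_W00) (rule V_act_W00[OF assms])

lemma amenable_cocycle_coboundary:
  fixes act :: "'g::group_add \<Rightarrow> 'x::topological_space \<Rightarrow> 'x" and \<alpha> :: "'g \<Rightarrow> 'e::real_normed_vector \<Rightarrow> 'e"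
  assumes act: "homeo_action act" and am: "topologically_amenable act"
    and mod: "G_C_module act \<rho> \<alpha>" and geo: "ell1_geometric \<rho>"
    and \<phi>: "\<phi> \<in> bounded_cocycles \<alpha> (Suc m)"
  shows "\<phi> \<in> differential ` bounded_cochains \<alpha> m"
proof -
  have \<rho>: "C_module \<rho>" and \<alpha>: "isometric_action \<alpha>"
    using mod by (auto simp: G_C_module_def)
  have ga: "group_act \<alpha>" and iso: "\<And>g v. norm (\<alpha> g v) = norm v"
    using \<alpha> by (auto simp: isometric_action_def)
  obtain f :: "nat \<Rightarrow> ('g, 'x) ell1_sup" where f: "\<And>n. f n \<in> W00" "\<And>n. pi_W0 (f n) = 1"
    and pos: "\<And>n g x. 0 \<le> coord (f n) g x"
    and inv: "\<And>g. (\<lambda>n. norm (f n - V_act act g (f n))) \<longlonglongrightarrow> 0"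
    using am unfolding topologically_amenable_def by blast
  have nf: "norm (f n) \<le> 1" for n
    by (rule norm_W00_nonneg[OF f pos])
  obtain L :: "(nat \<Rightarrow> real) \<Rightarrow> real" where
    L_add: "\<And>a b. Bseq a \<Longrightarrow> Bseq b \<Longrightarrow> L (\<lambda>n. a n + b n) = L a + L b" and
    L_scale: "\<And>a c. Bseq a \<Longrightarrow> L (\<lambda>n. c * a n) = c * L a" and
    L_bound: "\<And>a B. (\<And>n. \<bar>a n\<bar> \<le> B) \<Longrightarrow> \<bar>L a\<bar> \<le> B" and
    L_lim: "\<And>a l. a \<longlonglongrightarrow> l \<Longrightarrow> L a = l"
    using generalized_limit by blast
  have \<phi>0: "\<phi> gs = 0" if "length gs \<noteq> Suc m + 1" for gs
    using \<phi> that by (simp add: bounded_cocycles_def bounded_cochains_def)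
  have equi: "\<phi> (map (\<lambda>g. k + g) gs) = dual_act \<alpha> k (\<phi> gs)" if "length gs = Suc m + 1" for k gs
    using \<phi> that by (simp add: bounded_cocycles_def bounded_cochains_def)
  have d\<phi>: "differential \<phi> gs = 0" for gs
    using \<phi> by (simp add: bounded_cocycles_def)
  have "bounded (\<phi> ` {gs. length gs = Suc m + 1})"
    using \<phi> by (simp add: bounded_cocycles_def bounded_cochains_def)
  then obtain C where C: "0 < C" "\<And>gs. length gs = Suc m + 1 \<Longrightarrow> norm (\<phi> gs) \<le> C"
    unfolding bounded_pos by auto
  have \<phi>C: "norm (\<phi> gs) \<le> C" for gs
    using C \<phi>0[of gs] by (cases "length gs = Suc m + 1") auto
  define a where "a gs v n = module_pairing \<rho> (\<lambda>h. \<phi> (h # gs)) (f n) v" for gs v n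
  have a_bound: "\<bar>a gs v n\<bar> \<le> C * norm v" for gs v n
  proof -
    have "\<bar>a gs v n\<bar> \<le> C * (norm (f n) * norm v)"
      unfolding a_def by (rule module_pairing_bound[OF \<rho> geo finite_support_W00[OF f(1)] \<phi>C])
    also have "\<dots> \<le> C * (1 * norm v)"
      using C nf by (intro mult_left_mono mult_right_mono) auto
    finally show ?thesis by simp
  qed
  have a_Bseq: "Bseq (a gs v)" for gs v
    using a_bound by (intro BseqI'[of _ "C * norm v"]) simp
  have L_a: "\<bar>L (a gs v)\<bar> \<le> C * norm v" for gs v
    by (rule L_bound) (rule a_bound)
  \<comment> \<open>Boundedness is carried through the induction because \<open>L\<close> is
    additive only on bounded sequences.\<close>
  have L_sum: "Bseq (\<lambda>n. \<Sum>i\<in>I. c i * a (gs i) v n) \<and>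
      L (\<lambda>n. \<Sum>i\<in>I. c i * a (gs i) v n) = (\<Sum>i\<in>I. c i * L (a (gs i) v))" if "finite I"
    for I :: "nat set" and c gs v
    using that
  proof induction
    case empty
    then show ?case using L_lim[of "\<lambda>_. 0" 0] by simp
  next
    case (insert i I)
    have "Bseq (\<lambda>n. c i * a (gs i) v n)"
      using Bseq_mult[OF Bfun_const a_Bseq] by simp
    with insert show ?case
      by (simp add: L_add L_scale a_Bseq) (simp add: Bseq_eq_bounded bounded_plus_comp)
  qed
  have bl: "bounded_linear (\<lambda>v. L (a gs v))" for gs
  proof (rule bounded_linear_intro[where K = C])
    show "L (a gs (v + w)) = L (a gs v) + L (a gs w)" for v w
    proof -
      have "a gs (v + w) = (\<lambda>n. a gs v n + a gs w n)"
        by (rule ext) (simp add: a_def module_pairing_add[OF \<rho>])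
      then show ?thesis by (simp add: L_add a_Bseq)
    qed
    show "L (a gs (r *\<^sub>R v)) = r *\<^sub>R L (a gs v)" for r v
    proof -
      have "a gs (r *\<^sub>R v) = (\<lambda>n. r * a gs v n)"
        by (rule ext) (simp add: a_def module_pairing_scale[OF \<rho>])
      then show ?thesis by (simp add: L_scale a_Bseq)
    qed
    show "norm (L (a gs v)) \<le> norm v * C" for v
      using L_a by (simp add: mult.commute)
  qed
  define \<psi> where "\<psi> gs = (if length gs = m + 1 then Blinfun (\<lambda>v. L (a gs v)) else 0)" for gs
  have \<psi>: "\<psi> gs v = L (a gs v)" if "length gs = m + 1" for gs v
    using that by (simp add: \<psi>_def bounded_linear_Blinfun_apply[OF bl])
  have "\<psi> \<in> bounded_cochains \<alpha> m"
    unfolding bounded_cochains_def mem_Collect_eq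
  proof (intro conjI allI impI)
    show "\<psi> gs = 0" if "length gs \<noteq> m + 1" for gs
      using that by (simp add: \<psi>_def)
    have "norm (\<psi> gs) \<le> C" if "length gs = m + 1" for gs
      by (rule norm_blinfun_bound) (use C L_a in \<open>auto simp: \<psi>[OF that]\<close>)
    then show "bounded (\<psi> ` {gs. length gs = m + 1})"
      by (auto intro!: boundedI)
    show "\<psi> (map (\<lambda>g. k + g) gs) = dual_act \<alpha> k (\<psi> gs)" if "length gs = m + 1" for k gs
    proof (rule blinfun_eqI)
      fix v
      define w where "w = \<alpha> (- k) v"
      \<comment> \<open>Translating \<open>gs\<close> by \<open>k\<close> amounts to translating the
        weights by \<open>- k\<close> and replacing \<open>v\<close> by \<open>w\<close>; by
        asymptotic invariance the resulting difference tends to \<open>0\<close>, so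
        \<open>L\<close> does not see it.\<close>
      have "\<phi> ((k + h) # map (\<lambda>g. k + g) gs) = dual_act \<alpha> k (\<phi> (h # gs))" for h
        using equi[of "h # gs" k] that by simp
      then have shift: "a (map (\<lambda>g. k + g) gs) v n =
          module_pairing \<rho> (\<lambda>h. \<phi> (h # gs)) (V_act act (- k) (f n)) w" for n
        unfolding a_def w_def
        by (rule module_pairing_act[OF act mod finite_support_W00[OF f(1)]])
      have bound: "\<bar>a gs w n - a (map (\<lambda>g. k + g) gs) v n\<bar> \<le>
          C * (norm (f n - V_act act (- k) (f n)) * norm w)" for n
        unfolding shift unfolding a_def
        unfolding module_pairing_diff[OF \<rho> finite_support_W00[OF f(1)] finite_support_V_act[OF act f(1)], symmetric]
        by (rule module_pairing_bound[OF \<rho> geo finite_support_W00 \<phi>C])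
          (rule subspace_diff[OF subspace_W00 f(1) V_act_W00[OF act f(1)]])
      have "(\<lambda>n. C * (norm (f n - V_act act (- k) (f n)) * norm w)) \<longlonglongrightarrow> 0"
        using tendsto_mult_right_zero[OF tendsto_mult_left_zero[OF inv[of "- k"]]] .
      then have lim: "(\<lambda>n. a gs w n - a (map (\<lambda>g. k + g) gs) v n) \<longlonglongrightarrow> 0"
        by (rule Lim_null_comparison[rotated]) (simp add: bound)
      from convergent_imp_Bseq[OF convergentI[OF this]]
      have "Bseq (\<lambda>n. a gs w n - a (map (\<lambda>g. k + g) gs) v n)" .
      from L_add[OF a_Bseq[of "map (\<lambda>g. k + g) gs" v] this] L_lim[OF lim]
      have "L (a gs w) = L (a (map (\<lambda>g. k + g) gs) v)" by simp
      then show "\<psi> (map (\<lambda>g. k + g) gs) v = dual_act \<alpha> k (\<psi> gs) v"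
        using that by (simp add: \<psi> dual_act_apply[OF \<alpha>] w_def)
    qed
  qed
  moreover have "differential \<psi> gs = \<phi> gs" for gs
  proof (cases "length gs = Suc m + 1")
    case False
    then have "differential \<psi> gs = 0"
      by (auto simp: differential_def \<psi>_def intro!: sum.neutral)
    then show ?thesis using \<phi>0[OF False] by simp
  next
    case True
    let ?gs = "\<lambda>i. take i gs @ drop (Suc i) gs"
    have len: "length (?gs i) = m + 1" if "i < length gs" for i
      using that True by simp
    show ?thesis
    proof (rule blinfun_eqI)
      fix v
      have \<phi>_gs: "\<phi> gs = (\<Sum>i<length gs. (-1) ^ i *\<^sub>R \<phi> (h # ?gs i))" for h
        using d\<phi>[of "h # gs"] unfolding differential_Cons by simp
      \<comment> \<open>Exact for every \<open>n\<close>: the cocycle identity makes the averaged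
        functional independent of \<open>h\<close>, and the weights sum to \<open>1\<close>.\<close>
      have "(\<Sum>i<length gs. (-1) ^ i * a (?gs i) v n) = \<phi> gs v" for n
      proof -
        have "(\<Sum>i<length gs. (-1) ^ i * a (?gs i) v n) =
            module_pairing \<rho> (\<lambda>h. \<Sum>i<length gs. (-1) ^ i *\<^sub>R \<phi> (h # ?gs i)) (f n) v"
          unfolding a_def module_pairing_def sum_distrib_left
          by (subst sum.swap) (simp add: blinfun.sum_left blinfun.scaleR_left)
        also have "\<dots> = module_pairing \<rho> (\<lambda>_. \<phi> gs) (f n) v"
          unfolding \<phi>_gs[symmetric] ..
        also have "\<dots> = \<phi> gs v"
          by (rule module_pairing_const[OF \<rho> f])
        finally show ?thesis .
      qed
      then have "L (\<lambda>n. \<Sum>i<length gs. (-1) ^ i * a (?gs i) v n) = \<phi> gs v"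
        using L_lim[of "\<lambda>_. \<phi> gs v"] by simp
      moreover have "differential \<psi> gs v = (\<Sum>i<length gs. (-1) ^ i * L (a (?gs i) v))"
        unfolding differential_def by (simp add: blinfun.sum_left blinfun.scaleR_left \<psi>[OF len])
      ultimately show "differential \<psi> gs v = \<phi> gs v"
        using L_sum[of "{..<length gs}" "\<lambda>i. (-1) ^ i" ?gs v] by simp
    qed
  qed
  ultimately show ?thesis by (intro image_eqI[of _ _ \<psi>]) auto
qed

proposition amenable_imp_vanishing:
  assumes "homeo_action act" "topologically_amenable act"
  shows "ell1_geometric_vanishing TYPE('e::banach) act"
  unfolding ell1_geometric_vanishing_def
proof (intro allI impI, elim conjE)
  fix \<rho> \<alpha> and p :: nat
  assume mod: "G_C_module act (\<rho> :: _ \<Rightarrow> 'e \<Rightarrow> 'e) \<alpha>" and geo: "ell1_geometric \<rho>" and "1 \<le> p"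
  then obtain m where m: "p = Suc m" by (cases p) auto
  show "trivial_cohomology \<alpha> p"
  proof (rule trivial_cohomologyI)
    show "isometric_action \<alpha>" using mod by (simp add: G_C_module_def)
    show "\<phi> \<in> bounded_coboundaries \<alpha> p" if "\<phi> \<in> bounded_cocycles \<alpha> p" for \<phi>
      using amenable_cocycle_coboundary[OF assms mod geo] that
      by (simp add: bounded_coboundaries_def m)
  qed
qed


section \<open>The dual of \<open>N\<^sub>0\<close> as a geometric module\<close>

lemma closure_norm_approx:
  fixes S :: "'a::real_normed_vector set"
  assumes "f \<in> closure S" "0 < e"
  obtains u where "u \<in> S" "norm (f - u) < e"
  using assms unfolding closure_approachable dist_norm by (metis norm_minus_commute)

lemma infsum_coord_delta:
  "(\<Sum>\<^sub>\<infinity>h. coord (delta g :: ('g, 'x::topological_space) ell1_sup) h x) = 1"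
proof -
  have "(\<Sum>\<^sub>\<infinity>h. coord (delta g :: ('g, 'x) ell1_sup) h x) = (\<Sum>\<^sub>\<infinity>h\<in>{g}. 1)"
    by (rule infsum_cong_neutral) (auto simp: delta.rep_eq)
  then show ?thesis by simp
qed

lemma norm_delta_le: "norm (delta g :: ('g, 'x::topological_space) ell1_sup) \<le> 1"
  unfolding norm_ell1_sup_iff sup_bounded_by_def
proof (intro allI impI)
  fix F :: "'g set" and x
  assume "finite F"
  have "(\<Sum>h\<in>F. \<bar>coord (delta g :: ('g, 'x) ell1_sup) h x\<bar>) = (\<Sum>h\<in>F. if h = g then 1 else 0)"
    by (rule sum.cong) (auto simp: delta.rep_eq)
  then show "(\<Sum>h\<in>F. \<bar>coord (delta g :: ('g, 'x) ell1_sup) h x\<bar>) \<le> 1"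
    using \<open>finite F\<close> by (simp add: sum.delta)
qed

text \<open>Approximants from \<open>W00\<close> may have a nonzero constant sum. Subtracting that
  constant times a \<open>delta\<close> removes it, and since \<open>f\<close> itself has sum
  \<open>0\<close>, the constant is at most the approximation error.\<close>

lemma N0_set_subset_closure:
  "(N0_set :: ('g, 'x::topological_space) ell1_sup set) \<subseteq>
    closure {f \<in> W00. (\<Sum>g | coord f g \<noteq> 0. coord f g) = 0}"
proof
  fix f :: "('g, 'x) ell1_sup"
  define \<sigma> :: "('g, 'x) ell1_sup \<Rightarrow> real" where "\<sigma> = (\<lambda>f. \<Sum>\<^sub>\<infinity>g. coord f g undefined)"
  have lin: "linear \<sigma>" unfolding \<sigma>_def by (rule linear_infsum_coord)
  assume f: "f \<in> N0_set"
  then have "\<sigma> f = 0" "f \<in> closure W00"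
    unfolding N0_set_eq[of undefined] W0_def \<sigma>_def by auto
  show "f \<in> closure {f \<in> W00. (\<Sum>g | coord f g \<noteq> 0. coord f g) = 0}"
    unfolding closure_approachable
  proof (intro allI impI)
    fix e :: real
    assume "0 < e"
    then obtain u where u: "u \<in> W00" "norm (f - u) < e / 2"
      using closure_norm_approx[OF \<open>f \<in> closure W00\<close>, of "e / 2"] by auto
    define w where "w = u - \<sigma> u *\<^sub>R delta undefined"
    have "w \<in> W00"
      unfolding w_def by (intro subspace_diff subspace_scale subspace_W00 u delta_W00)
    moreover have "\<sigma> w = 0"
      unfolding w_def linear_diff[OF lin] linear_scale[OF lin] by (simp add: \<sigma>_def infsum_coord_delta)
    ultimately have "(\<Sum>g | coord w g \<noteq> 0. coord w g) = 0"
      using infsum_W00[of w undefined] by (simp add: \<sigma>_def)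
    moreover have "norm (f - w) < e"
    proof -
      have "\<bar>\<sigma> u\<bar> \<le> norm (f - u)"
        using infsum_coord_le[of "f - u" undefined] \<open>\<sigma> f = 0\<close> linear_diff[OF lin, of f u]
        by (simp add: \<sigma>_def)
      moreover have "norm (\<sigma> u *\<^sub>R delta undefined :: ('g, 'x) ell1_sup) \<le> \<bar>\<sigma> u\<bar> * 1"
        unfolding norm_scaleR by (intro mult_left_mono norm_delta_le) auto
      moreover have "norm (f - w) \<le> norm (f - u) + norm (\<sigma> u *\<^sub>R delta undefined :: ('g, 'x) ell1_sup)"
        using norm_triangle_ineq[of "f - u" "\<sigma> u *\<^sub>R delta undefined"] by (simp add: w_def algebra_simps)
      ultimately show ?thesis using u by linarith
    qed
    ultimately show "\<exists>y\<in>{f \<in> W00. (\<Sum>g | coord f g \<noteq> 0. coord f g) = 0}. dist y f < e"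
      using \<open>w \<in> W00\<close> by (auto simp: dist_norm norm_minus_commute)
  qed
qed

definition V_mult :: "('x::topological_space \<Rightarrow>\<^sub>C real) \<Rightarrow> ('g, 'x) ell1_sup \<Rightarrow> ('g, 'x) ell1_sup"
  where "V_mult t f = Abs_ell1_sup (\<lambda>h. t * coord f h)"

lemma coord_V_mult [simp]: "coord (V_mult t f) h = t * coord f h"
  and norm_V_mult: "norm (V_mult t f) \<le> norm t * norm f"
proof -
  have b: "sup_bounded_by (norm t * norm f) (\<lambda>h. t * coord f h)"
    unfolding sup_bounded_by_def
  proof (intro allI impI)
    fix F :: "'b set" and x
    assume "finite F"
    then have "(\<Sum>g\<in>F. \<bar>coord f g x\<bar>) \<le> norm f"
      using sup_bounded_by_norm[of f] by (auto simp: sup_bounded_by_def)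
    then have "\<bar>t x\<bar> * (\<Sum>g\<in>F. \<bar>coord f g x\<bar>) \<le> norm t * norm f"
      using norm_bounded[of t x] by (intro mult_mono) (auto intro: sum_nonneg)
    then show "(\<Sum>g\<in>F. \<bar>(t * coord f g) x\<bar>) \<le> norm t * norm f"
      by (simp add: abs_mult sum_distrib_left)
  qed
  show c: "coord (V_mult t f) h = t * coord f h" for h
    unfolding V_mult_def by (subst coord_Abs[OF b]) simp
  show "norm (V_mult t f) \<le> norm t * norm f"
    unfolding norm_ell1_sup_iff c using b .
qed

lemma linear_V_mult: "linear (V_mult t)"
  by (intro linearI coord_eqI)
    (simp_all add: plus_ell1_sup.rep_eq scaleR_ell1_sup.rep_eq distrib_left)

text \<open>A common factor \<open>t\<close> preserves a vanishing sum, though in general not a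
  nonzero constant one; so stability is checked on functions with sum \<open>0\<close> and passed to
  the closure by continuity.\<close>

lemma V_mult_N0_set:
  assumes f: "f \<in> N0_set"
  shows "V_mult t f \<in> N0_set"
proof -
  have "bounded_linear (V_mult t)"
    using norm_V_mult[of t]
    by (intro bounded_linear_intro[where K = "norm t"])
      (simp_all add: linear_add[OF linear_V_mult] linear_scale[OF linear_V_mult] mult.commute)
  then have cont: "continuous_on S (V_mult t)" for S by (rule linear_continuous_on)
  let ?Z = "{f \<in> W00. (\<Sum>g | coord f g \<noteq> 0. coord f g) = 0}"
  have "V_mult t w \<in> W00" if "w \<in> ?Z" for w
  proof (rule W00I[of "{g. coord w g \<noteq> 0}" _ 0])
    show "finite {g. coord w g \<noteq> 0}" using that by (auto simp: W00_def)
    show "(\<Sum>g | coord w g \<noteq> 0. coord (V_mult t w) g) = 0 *\<^sub>R 1"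
      using that by (simp add: sum_distrib_left[symmetric])
  qed auto
  then have "V_mult t ` closure ?Z \<subseteq> closure W00"
    by (intro image_closure_subset[OF cont closed_closure]) (use closure_subset in blast)
  then have "V_mult t f \<in> W0"
    using f N0_set_subset_closure unfolding W0_def by blast
  moreover have "(\<Sum>\<^sub>\<infinity>h. coord (V_mult t f) h undefined) = 0"
    using f unfolding N0_set_eq[of undefined] by (simp add: infsum_cmult_right')
  ultimately show ?thesis unfolding N0_set_eq[of undefined] by blast
qed

definition N0_mult :: "('x::topological_space \<Rightarrow>\<^sub>C real) \<Rightarrow> ('g, 'x) N0 \<Rightarrow> ('g, 'x) N0"
  where "N0_mult t v = Abs_N0 (V_mult t (vec_N0 v))"

lemma vec_N0_mult: "vec_N0 (N0_mult t v) = V_mult t (vec_N0 v)"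
  unfolding N0_mult_def by (rule Abs_N0_inverse) (rule V_mult_N0_set[OF vec_N0])

lemma N0_eqI: "(\<And>g x. coord (vec_N0 u) g x = coord (vec_N0 v) g x) \<Longrightarrow> u = v"
  unfolding vec_N0_inject[symmetric] by (intro coord_eqI bcontfun_eqI)

lemma norm_N0_mult: "norm (N0_mult t v) \<le> norm t * norm v"
  using norm_V_mult[of t "vec_N0 v"] by (simp add: norm_N0.rep_eq vec_N0_mult)

lemma N0_mult_simps:
  "N0_mult t (u + v) = N0_mult t u + N0_mult t v"
  "N0_mult t (c *\<^sub>R v) = c *\<^sub>R N0_mult t v"
  "N0_mult (s + t) v = N0_mult s v + N0_mult t v"
  "N0_mult (s - t) v = N0_mult s v - N0_mult t v"
  "N0_mult (c *\<^sub>R t) v = c *\<^sub>R N0_mult t v"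
  "N0_mult s (N0_mult t v) = N0_mult (s * t) v"
  "N0_mult 1 v = v"
  "N0_mult 0 v = 0"
  by (rule N0_eqI,
      simp add: vec_N0_mult plus_N0.rep_eq minus_N0.rep_eq scaleR_N0.rep_eq zero_N0.rep_eq
        plus_ell1_sup.rep_eq minus_ell1_sup.rep_eq scaleR_ell1_sup.rep_eq zero_ell1_sup.rep_eq
        algebra_simps)+

definition N0_dual_mult :: "('x::topological_space \<Rightarrow>\<^sub>C real) \<Rightarrow> (('g, 'x) N0 \<Rightarrow>\<^sub>L real) \<Rightarrow>
    (('g, 'x) N0 \<Rightarrow>\<^sub>L real)"
  where "N0_dual_mult t a = Blinfun (\<lambda>v. a (N0_mult t v))"

lemma N0_dual_mult_apply [simp]:
  fixes a :: "('g, 'x::topological_space) N0 \<Rightarrow>\<^sub>L real"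
  shows "N0_dual_mult t a v = a (N0_mult t v)"
proof -
  have "bounded_linear (N0_mult t :: ('g, 'x) N0 \<Rightarrow> _)"
    using norm_N0_mult[of t]
    by (intro bounded_linear_intro[where K = "norm t"]) (simp_all add: N0_mult_simps mult.commute)
  then have "bounded_linear (\<lambda>v. a (N0_mult t v))"
    by (rule bounded_linear_compose[OF blinfun.bounded_linear_right])
  then show ?thesis by (simp add: N0_dual_mult_def bounded_linear_Blinfun_apply)
qed

lemma C_module_N0_dual: "C_module (N0_dual_mult :: _ \<Rightarrow> (('g, 'x::topological_space) N0 \<Rightarrow>\<^sub>L real) \<Rightarrow> _)"
  unfolding C_module_def bilinear_def
proof (intro conjI allI)
  fix s t :: "'x \<Rightarrow>\<^sub>C real" and a :: "('g, 'x) N0 \<Rightarrow>\<^sub>L real"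
  show "linear (N0_dual_mult t :: (('g, 'x) N0 \<Rightarrow>\<^sub>L real) \<Rightarrow> _)" "linear (\<lambda>t. N0_dual_mult t a)"
    by (intro linearI blinfun_eqI; simp add: blinfun.bilinear_simps N0_mult_simps)+
  \<comment> \<open>Adjoints reverse products; commutativity of \<open>C(X)\<close> restores the
    order.\<close>
  have "t * s = s * t" by (rule bcontfun_eqI) simp
  then show "N0_dual_mult (s * t) a = N0_dual_mult s (N0_dual_mult t a)"
    by (intro blinfun_eqI) (simp add: N0_mult_simps)
  show "N0_dual_mult 1 a = a"
    by (rule blinfun_eqI) (simp add: N0_mult_simps)
  show "norm (N0_dual_mult t a) \<le> norm t * norm a"
  proof (rule norm_blinfun_bound)
    fix v
    have "norm (a (N0_mult t v)) \<le> norm a * norm (N0_mult t v)" by (rule norm_blinfun)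
    also have "\<dots> \<le> norm a * (norm t * norm v)" by (intro mult_left_mono norm_N0_mult) simp
    finally show "norm (N0_dual_mult t a v) \<le> norm t * norm a * norm v" by (simp add: mult_ac)
  qed simp
qed

lemma G_C_module_N0_dual:
  assumes act: "homeo_action act"
  shows "G_C_module act N0_dual_mult (dual_act (N0_act act))"
  unfolding G_C_module_def
proof (intro conjI allI)
  show "isometric_action (dual_act (N0_act act))"
    by (intro isometric_action_dual isometric_action_N0 act)
  fix g t and a :: "('a, 'b) N0 \<Rightarrow>\<^sub>L real"
  have ga: "group_act act" using act by (simp add: homeo_action_def)
  have "N0_act act (- g) (N0_mult (C_act act g t) v) = N0_mult t (N0_act act (- g) v)" for v
    by (rule N0_eqI)
      (simp add: vec_N0_act[OF act] vec_N0_mult coord_V_act[OF act] apply_C_act[OF act]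
        group_act_cancel[OF ga])
  then show "dual_act (N0_act act) g (N0_dual_mult t a) =
      N0_dual_mult (C_act act g t) (dual_act (N0_act act) g a)"
    by (intro blinfun_eqI) (simp add: dual_act_apply[OF isometric_action_N0[OF act]])
qed (rule C_module_N0_dual)

section \<open>Additivity of the dual norm over disjoint supports\<close>

lemma norm_blinfun_le_unit_ball:
  fixes a :: "'e::real_normed_vector \<Rightarrow>\<^sub>L real"
  assumes "\<And>v. norm v \<le> 1 \<Longrightarrow> a v \<le> c"
  shows "norm a \<le> c"
proof (rule norm_blinfun_bound)
  show "0 \<le> c" using assms[of 0] by (simp add: blinfun.bilinear_simps)
  fix v
  have le: "a v \<le> c * norm v" for v
  proof (cases "v = 0")
    case False
    then show ?thesis
      using assms[of "v /\<^sub>R norm v"] by (simp add: blinfun.bilinear_simps divide_simps mult.commute)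
  qed (simp add: blinfun.bilinear_simps)
  show "norm (a v) \<le> c * norm v"
    using le[of v] le[of "- v"] by (simp add: blinfun.bilinear_simps)
qed

text \<open>At each point of \<open>X\<close> at most one summand survives, so the pointwise sum of
  absolute values is that of a single vector from the unit ball, times a factor of absolute value at
  most \<open>1\<close>.\<close>

lemma norm_N0_mult_disjoint:
  fixes h1 h2 :: "'x::topological_space \<Rightarrow>\<^sub>C real" and v1 v2 :: "('g, 'x) N0"
  assumes h: "\<And>x. \<bar>h1 x\<bar> \<le> 1" "\<And>x. \<bar>h2 x\<bar> \<le> 1" "\<And>x. h1 x = 0 \<or> h2 x = 0"
    and v: "norm v1 \<le> 1" "norm v2 \<le> 1"
  shows "norm (N0_mult h1 v1 + N0_mult h2 v2) \<le> 1"
  unfolding norm_N0.rep_eq norm_ell1_sup_iff sup_bounded_by_def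
proof (intro allI impI)
  fix F :: "'g set" and x
  assume F: "finite F"
  have 1: "(\<Sum>g\<in>F. \<bar>h x * coord (vec_N0 v) g x\<bar>) \<le> 1" if "\<bar>h x\<bar> \<le> 1" "norm v \<le> 1"
    for h :: "'x \<Rightarrow>\<^sub>C real" and v :: "('g, 'x) N0"
  proof -
    have "(\<Sum>g\<in>F. \<bar>coord (vec_N0 v) g x\<bar>) \<le> 1"
      using that(2) F unfolding norm_N0.rep_eq norm_ell1_sup_iff sup_bounded_by_def by blast
    then have "\<bar>h x\<bar> * (\<Sum>g\<in>F. \<bar>coord (vec_N0 v) g x\<bar>) \<le> 1 * 1"
      using that(1) by (intro mult_mono) (auto intro: sum_nonneg)
    then show ?thesis by (simp add: abs_mult sum_distrib_left)
  qed
  show "(\<Sum>g\<in>F. \<bar>coord (vec_N0 (N0_mult h1 v1 + N0_mult h2 v2)) g x\<bar>) \<le> 1"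
    using 1[OF h(1) v(1)] 1[OF h(2) v(2)] h(3)[of x]
    by (auto simp: plus_N0.rep_eq plus_ell1_sup.rep_eq vec_N0_mult)
qed

text \<open>The functions \<open>f1\<close> and \<open>f2\<close> supplied by disjointness may be
  large, so multiplying by them can leave the unit ball. They are replaced by truncations
  \<open>h1\<close> and \<open>h2\<close> with the same zeros and values in the unit interval, which
  change the values of \<open>a1\<close> and \<open>a2\<close> only slightly.\<close>

lemma ell1_geometric_N0_dual:
  "ell1_geometric (N0_dual_mult :: _ \<Rightarrow> (('g, 'x::topological_space) N0 \<Rightarrow>\<^sub>L real) \<Rightarrow> _)"
  unfolding ell1_geometric_def
proof (intro allI impI)
  fix a1 a2 :: "('g, 'x) N0 \<Rightarrow>\<^sub>L real"
  assume "disjointly_supported N0_dual_mult a1 a2"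
  then obtain f1 f2 :: "'x \<Rightarrow>\<^sub>C real" where
    disj: "closure {x. f1 x \<noteq> 0} \<inter> closure {x. f2 x \<noteq> 0} = {}"
    and "N0_dual_mult f1 a1 = a1" "N0_dual_mult f2 a2 = a2"
    unfolding disjointly_supported_def by blast
  then have f: "a1 (N0_mult f1 v) = a1 v" "a2 (N0_mult f2 v) = a2 v" for v
    by (metis N0_dual_mult_apply)+
  have f12: "f1 x = 0 \<or> f2 x = 0" for x
    using disj closure_subset[of "{x. f1 x \<noteq> 0}"] closure_subset[of "{x. f2 x \<noteq> 0}"] by blast
  have main: "a1 v1 + a2 v2 \<le> norm (a1 + a2)" if v: "norm v1 \<le> 1" "norm v2 \<le> 1" for v1 v2
  proof (rule field_le_epsilon)
    fix e :: real
    assume "0 < e"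
    \<comment> \<open>Chosen so that the two truncation errors together stay within
      \<open>e\<close>; the \<open>+ 1\<close> avoids division by zero.\<close>
    define d where "d = e / (norm a1 + norm a2 + 1)"
    have s: "0 < norm a1 + norm a2 + 1" by (simp add: add_nonneg_pos)
    have d: "0 < d" using \<open>0 < e\<close> s by (simp add: d_def)
    have de: "d * norm a1 + d * norm a2 \<le> e"
    proof -
      have "d * (norm a1 + norm a2) \<le> d * (norm a1 + norm a2 + 1)"
        using d by (intro mult_left_mono) auto
      also have "\<dots> = e" using s by (simp add: d_def)
      finally show ?thesis by (simp add: algebra_simps)
    qed
    have "\<exists>h :: 'x \<Rightarrow>\<^sub>C real. \<forall>x. h x = min 1 (\<bar>t x\<bar> / d)" for t :: "'x \<Rightarrow>\<^sub>C real"
      using d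
      by (intro exI[of _ "Bcontfun (\<lambda>x. min 1 (\<bar>t x\<bar> / d))"])
        (subst apply_Bcontfun_bounded[where B = 1], auto intro!: continuous_intros)
    then obtain h1 h2 :: "'x \<Rightarrow>\<^sub>C real"
      where h: "\<And>x. h1 x = min 1 (\<bar>f1 x\<bar> / d)" "\<And>x. h2 x = min 1 (\<bar>f2 x\<bar> / d)" by metis
    \<comment> \<open>\<open>t - t * h\<close> vanishes where the absolute value of \<open>t\<close>
      exceeds \<open>d\<close> and is at most \<open>d\<close> elsewhere; the factor
      \<open>t\<close> can be inserted because \<open>a\<close> absorbs it.\<close>
    have near: "a v \<le> a (N0_mult h v) + d * norm a"
      if a: "\<And>v. a (N0_mult t v) = a v" and h: "\<And>x. h x = min 1 (\<bar>t x\<bar> / d)" and "norm v \<le> 1"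
      for a :: "('g, 'x) N0 \<Rightarrow>\<^sub>L real" and t h :: "'x \<Rightarrow>\<^sub>C real" and v
    proof -
      have "norm (t - t * h) \<le> d"
      proof (rule norm_bound)
        fix x
        show "norm ((t - t * h) x) \<le> d"
        proof (cases "\<bar>t x\<bar> \<le> d")
          case True
          then have "h x = \<bar>t x\<bar> / d" using d by (simp add: h)
          then have "0 \<le> h x" "h x \<le> 1" using True d by simp_all
          then have "\<bar>t x\<bar> * \<bar>1 - h x\<bar> \<le> d * 1"
            using True by (intro mult_mono) auto
          moreover have "(t - t * h) x = t x * (1 - h x)" by (simp add: algebra_simps)
          ultimately show ?thesis by (simp add: abs_mult)
        next
          case False
          then show ?thesis using d by (simp add: h min_def)
        qed
      qed
      then have "norm (N0_mult (t - t * h) v) \<le> d * 1"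
        using that(3) d by (intro order_trans[OF norm_N0_mult] mult_mono) auto
      then have "norm a * norm (N0_mult (t - t * h) v) \<le> norm a * d"
        by (intro mult_left_mono) auto
      moreover have "a v - a (N0_mult h v) = a (N0_mult (t - t * h) v)"
        using a[of v] a[of "N0_mult h v"] by (simp add: N0_mult_simps blinfun.bilinear_simps)
      ultimately show ?thesis
        using norm_blinfun[of a "N0_mult (t - t * h) v"] by (simp add: mult.commute)
    qed
    \<comment> \<open>\<open>a1\<close> does not notice a factor \<open>f1\<close> inserted before
      \<open>h2\<close>, but that product is zero; likewise for \<open>a2\<close>.\<close>
    have "f1 * h2 = 0" "f2 * h1 = 0"
      by (rule bcontfun_eqI, use f12 d in \<open>force simp: h\<close>)+
    then have cross: "a1 (N0_mult h2 v2) = 0" "a2 (N0_mult h1 v1) = 0"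
      using f(1)[of "N0_mult h2 v2"] f(2)[of "N0_mult h1 v1"]
      by (simp_all add: N0_mult_simps blinfun.bilinear_simps)
    let ?u = "N0_mult h1 v1 + N0_mult h2 v2"
    have h12: "h1 x = 0 \<or> h2 x = 0" for x
      using f12[of x] by (auto simp: h)
    have u: "norm ?u \<le> 1"
      by (rule norm_N0_mult_disjoint[OF _ _ h12 v]) (use d in \<open>auto simp: h\<close>)
    have "(a1 + a2) ?u \<le> norm (a1 + a2) * norm ?u"
      using norm_blinfun[of "a1 + a2" ?u] by simp
    also have "\<dots> \<le> norm (a1 + a2) * 1" using u by (intro mult_left_mono) auto
    finally have "a1 (N0_mult h1 v1) + a2 (N0_mult h2 v2) \<le> norm (a1 + a2)"
      by (simp add: blinfun.bilinear_simps cross)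
    then show "a1 v1 + a2 v2 \<le> norm (a1 + a2) + e"
      using near[OF f(1) h(1) v(1)] near[OF f(2) h(2) v(2)] de by linarith
  qed
  \<comment> \<open>The supremum is taken in \<open>v1\<close> with \<open>v2\<close> fixed, and
    only then in \<open>v2\<close>.\<close>
  have "norm a1 \<le> norm (a1 + a2) - a2 v2" if "norm v2 \<le> 1" for v2
    using main[OF _ that] by (intro norm_blinfun_le_unit_ball) (simp add: le_diff_eq)
  then have "norm a2 \<le> norm (a1 + a2) - norm a1"
    by (intro norm_blinfun_le_unit_ball) (simp add: le_diff_eq add.commute)
  then show "norm (a1 + a2) = norm a1 + norm a2"
    using norm_triangle_ineq[of a1 a2] by linarith
qed

proposition vanishing_imp_johnson_trivial:
  fixes act :: "'g::group_add \<Rightarrow> 'x::topological_space \<Rightarrow> 'x"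
  assumes act: "homeo_action act"
    and van: "ell1_geometric_vanishing TYPE(('g, 'x) N0 \<Rightarrow>\<^sub>L real) act"
  shows "johnson_class_trivial act"
proof -
  have "trivial_cohomology (dual_act (N0_act act)) 1"
    using van G_C_module_N0_dual[OF act] ell1_geometric_N0_dual
    unfolding ell1_geometric_vanishing_def by blast
  moreover have "cohomology_class (dual_act (N0_act act)) 1 johnson_cocycle \<in>
      bounded_cohomology (dual_act (N0_act act)) 1"
    unfolding cohomology_class_def bounded_cohomology_def
    by (rule quotientI) (rule johnson_cocycle[OF act])
  ultimately show ?thesis
    unfolding trivial_cohomology_def johnson_class_trivial_def by auto
qed


section \<open>Triviality of the Johnson class implies amenability\<close>

lemma apply_Bcontfun_finite_seq:
  fixes u :: "nat \<Rightarrow> 'a::real_normed_vector"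
  assumes "\<And>i. n \<le> i \<Longrightarrow> u i = 0"
  shows "apply_bcontfun (Bcontfun u) = u"
proof (rule apply_Bcontfun_seq)
  have "range u \<subseteq> insert 0 (u ` {..<n})"
    using assms not_le by blast
  then have "finite (range u)" by (rule finite_subset) simp
  then show "Bseq u" by (simp add: Bseq_eq_bounded finite_imp_bounded)
qed

text \<open>Sequences vanishing from \<open>n\<close> on model the product of \<open>n\<close>
  copies with the supremum norm, as \<open>n\<close> is a variable and not a type. The component
  \<open>a i\<close> is \<open>f\<close> restricted to sequences concentrated at
  \<open>i\<close>.\<close>

lemma functional_on_finite_seq:
  fixes f :: "(nat \<Rightarrow>\<^sub>C 'a::real_normed_vector) \<Rightarrow>\<^sub>L real"
  obtains a :: "nat \<Rightarrow> 'a \<Rightarrow>\<^sub>L real" where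
    "\<And>n u. (\<And>i. n \<le> i \<Longrightarrow> apply_bcontfun u i = 0) \<Longrightarrow> f u = (\<Sum>i<n. a i (apply_bcontfun u i))"
proof -
  define single :: "nat \<Rightarrow> 'a \<Rightarrow> nat \<Rightarrow>\<^sub>C 'a" where "single i v = Bcontfun (\<lambda>j. if j = i then v else 0)" for i v
  have single: "apply_bcontfun (single i v) j = (if j = i then v else 0)" for i v j
    unfolding single_def by (subst apply_Bcontfun_finite_seq[of "Suc i"]) auto
  have "bounded_linear (single i)" for i
    by (rule bounded_linear_intro[where K = 1]) (auto intro!: bcontfun_eqI norm_bound simp: single)
  then have "bounded_linear (\<lambda>v. f (single i v))" for i
    by (rule bounded_linear_compose[OF blinfun.bounded_linear_right])
  then have a: "blinfun_apply (Blinfun (\<lambda>v. f (single i v))) = (\<lambda>v. f (single i v))" for i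
    by (rule bounded_linear_Blinfun_apply)
  show thesis
  proof (rule that[of "\<lambda>i. Blinfun (\<lambda>v. f (single i v))"])
    fix n and u :: "nat \<Rightarrow>\<^sub>C 'a"
    assume u: "\<And>i. n \<le> i \<Longrightarrow> apply_bcontfun u i = 0"
    have "(\<Sum>i<n. single i (apply_bcontfun u i)) = u"
    proof (rule bcontfun_eqI)
      fix j
      have "apply_bcontfun (\<Sum>i<n. single i (apply_bcontfun u i)) j =
          (\<Sum>i<n. apply_bcontfun (single i (apply_bcontfun u i)) j)"
        by (induction n) auto
      then show "apply_bcontfun (\<Sum>i<n. single i (apply_bcontfun u i)) j = apply_bcontfun u j"
        using u[of j] by (simp add: single sum.delta not_less)
    qed
    then have "f u = f (\<Sum>i<n. single i (apply_bcontfun u i))" by simp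
    then show "f u = (\<Sum>i<n. Blinfun (\<lambda>v. f (single i v)) (apply_bcontfun u i))"
      by (simp add: a blinfun.sum_right)
  qed
qed

lemma vec_N0_delta_diff: "vec_N0 (Abs_N0 (delta b - delta a)) = delta b - delta a"
  by (rule Abs_N0_inverse[OF delta_diff_N0_set])

text \<open>In the bidual the identity reads \<open>g \<Lambda> - \<Lambda> = \<delta>\<^sub>g -
  \<delta>\<^sub>0\<close>. An equivariant cochain of degree \<open>0\<close> is determined by its
  value at \<open>[0]\<close>, and \<open>\<Lambda>\<close> is this value for a primitive of the
  Johnson cocycle.\<close>

lemma johnson_trivialE:
  fixes act :: "'g::group_add \<Rightarrow> 'x::topological_space \<Rightarrow> 'x"
  assumes act: "homeo_action act" and J: "johnson_class_trivial act"
  obtains \<Lambda> :: "(('g, 'x) N0 \<Rightarrow>\<^sub>L real) \<Rightarrow>\<^sub>L real" where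
    "\<And>g a. \<Lambda> (dual_act (N0_act act) (- g) a) - \<Lambda> a = a (Abs_N0 (delta g - delta 0))"
proof -
  let ?\<alpha> = "dual_act (N0_act act)"
  let ?J = "johnson_cocycle :: 'g list \<Rightarrow> (('g, 'x) N0 \<Rightarrow>\<^sub>L real) \<Rightarrow>\<^sub>L real"
  have \<alpha>: "isometric_action ?\<alpha>"
    by (intro isometric_action_dual isometric_action_N0 act)
  \<comment> \<open>Triviality is an equality of classes; to use it, the Johnson cocycle is first
    placed in its own class, which needs \<open>0\<close> as a coboundary.\<close>
  have "(\<lambda>_. 0) \<in> bounded_cocycles ?\<alpha> 0" by (rule zero_bounded_cocycle[OF \<alpha>])
  then have "(\<lambda>gs. ?J gs - ?J gs) \<in> bounded_coboundaries ?\<alpha> 1"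
    by (auto simp: bounded_cocycles_def bounded_coboundaries_def image_iff intro!: bexI[of _ "\<lambda>_. 0"])
  then have "?J \<in> cohomology_class ?\<alpha> 1 ?J"
    using johnson_cocycle[OF act] by (simp add: cohomology_class_def cohomologous_def)
  then have "?J \<in> cohomology_class ?\<alpha> 1 (\<lambda>_. 0)"
    using J by (simp add: johnson_class_trivial_def)
  then have "(\<lambda>gs. 0 - ?J gs) \<in> differential ` bounded_cochains ?\<alpha> 0"
    by (simp add: cohomology_class_def cohomologous_def bounded_coboundaries_def)
  then obtain \<psi> where \<psi>: "\<psi> \<in> bounded_cochains ?\<alpha> 0" and d: "\<And>gs. differential \<psi> gs = - ?J gs"
    by (auto simp: fun_eq_iff)
  have d: "\<psi> [g] - \<psi> [0] = - canonical_embedding (Abs_N0 (delta g - delta 0))" for g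
    using d[of "[0, g]"] by (simp add: differential_def johnson_cocycle_def lessThan_Suc)
  have "\<psi> [g] = dual_act ?\<alpha> g (\<psi> [0])" for g
  proof -
    have "\<forall>k gs. length gs = 0 + 1 \<longrightarrow> \<psi> (map (\<lambda>h. k + h) gs) = dual_act ?\<alpha> k (\<psi> gs)"
      using \<psi> unfolding bounded_cochains_def mem_Collect_eq by (elim conjE)
    from this[rule_format, of "[0]" g] show ?thesis by simp
  qed
  with d have "dual_act ?\<alpha> g (\<psi> [0]) - \<psi> [0] = - canonical_embedding (Abs_N0 (delta g - delta 0))" for g
    by metis
  then have "(dual_act ?\<alpha> g (\<psi> [0]) - \<psi> [0]) a = (- canonical_embedding (Abs_N0 (delta g - delta 0))) a"
    for g a
    by simp
  then have "\<psi> [0] (?\<alpha> (- g) a) - \<psi> [0] a = - a (Abs_N0 (delta g - delta 0))" for g a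
    by (simp add: blinfun.bilinear_simps dual_act_apply[OF \<alpha>])
  \<comment> \<open>\<open>\<psi>\<close> is a primitive of the negative of the Johnson cocycle,
    hence the change of sign.\<close>
  then have "(- \<psi> [0]) (?\<alpha> (- g) a) - (- \<psi> [0]) a = a (Abs_N0 (delta g - delta 0))" for g a
    unfolding blinfun.minus_left by (smt (verit))
  then show thesis by (rule that)
qed

text \<open>A functional on \<open>N\<^sub>0\<^sup>n\<close> that vanishes on all \<open>(g\<^sub>i v - v)\<^sub>i\<close> but not on
  \<open>(\<delta>\<^bsub>g i\<^esub> - \<delta>\<^sub>0)\<^sub>i\<close> would contradict the invariance property of the element of the bidual that
  trivializes the Johnson cocycle.\<close>

lemma johnson_trivial_approx:
  fixes n :: nat and g :: "nat \<Rightarrow> 'g::group_add" and act :: "'g::group_add \<Rightarrow> 'x::topological_space \<Rightarrow> 'x"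
  assumes act: "homeo_action act" and J: "johnson_class_trivial act" and e: "0 < e"
  shows "\<exists>v :: ('g, 'x) N0. \<forall>i<n. norm (N0_act act (g i) v - v - Abs_N0 (delta (g i) - delta 0)) < e"
proof -
  obtain \<Lambda> :: "(('g, 'x) N0 \<Rightarrow>\<^sub>L real) \<Rightarrow>\<^sub>L real" where
    \<Lambda>: "\<And>g a. \<Lambda> (dual_act (N0_act act) (- g) a) - \<Lambda> a = a (Abs_N0 (delta g - delta 0))"
    using johnson_trivialE[OF act J] by blast
  have lin: "linear (N0_act act k :: ('g, 'x) N0 \<Rightarrow> _)" for k
    using isometric_action_N0[OF act] by (simp add: isometric_action_def)
  define T :: "('g, 'x) N0 \<Rightarrow> nat \<Rightarrow>\<^sub>C ('g, 'x) N0"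
    where "T v = Bcontfun (\<lambda>i. if i < n then N0_act act (g i) v - v else 0)" for v
  have T: "apply_bcontfun (T v) i = (if i < n then N0_act act (g i) v - v else 0)" for v i
    unfolding T_def by (subst apply_Bcontfun_finite_seq[of n]) auto
  define D :: "nat \<Rightarrow>\<^sub>C ('g, 'x) N0"
    where "D = Bcontfun (\<lambda>i. if i < n then Abs_N0 (delta (g i) - delta 0) else 0)"
  have D: "apply_bcontfun D i = (if i < n then Abs_N0 (delta (g i) - delta 0) else 0)" for i
    unfolding D_def by (subst apply_Bcontfun_finite_seq[of n]) auto
  have "linear T"
    by (intro linearI bcontfun_eqI)
      (auto simp: T linear_add[OF lin] linear_scale[OF lin] algebra_simps)
  then have S: "subspace (range T)" by (metis linear_subspace_image subspace_UNIV)
  have "D \<in> closure (range T)"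
  proof (rule ccontr)
    assume "D \<notin> closure (range T)"
    then obtain f :: "(nat \<Rightarrow>\<^sub>C ('g, 'x) N0) \<Rightarrow>\<^sub>L real"
      where f: "\<And>s. s \<in> range T \<Longrightarrow> f s = 0" "f D \<noteq> 0"
      using separate_from_subspace[OF S] by blast
    obtain a where a: "\<And>u. (\<And>i. n \<le> i \<Longrightarrow> apply_bcontfun u i = 0) \<Longrightarrow>
        f u = (\<Sum>i<n. blinfun_apply (a i) (apply_bcontfun u i))"
      using functional_on_finite_seq[of f] by metis
    have "(\<Sum>i<n. dual_act (N0_act act) (- g i) (a i) - a i) = 0"
    proof (rule blinfun_eqI)
      fix v
      have "(\<Sum>i<n. a i (N0_act act (g i) v - v)) = f (T v)"
        by (subst a) (auto simp: T)
      then show "(\<Sum>i<n. dual_act (N0_act act) (- g i) (a i) - a i) v = blinfun_apply 0 v"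
        using f(1)[of "T v"]
        by (simp add: blinfun.sum_left blinfun.bilinear_simps dual_act_apply[OF isometric_action_N0[OF act]])
    qed
    then have "\<Lambda> (\<Sum>i<n. dual_act (N0_act act) (- g i) (a i) - a i) = 0"
      by (simp add: blinfun.bilinear_simps)
    then have "(\<Sum>i<n. a i (Abs_N0 (delta (g i) - delta 0))) = 0"
      by (simp add: blinfun.sum_right blinfun.diff_right \<Lambda>)
    moreover have "f D = (\<Sum>i<n. a i (Abs_N0 (delta (g i) - delta 0)))"
      by (subst a) (auto simp: D)
    ultimately show False using f(2) by simp
  qed
  then obtain s where s: "s \<in> range T" "norm (D - s) < e"
    using closure_norm_approx[OF _ e] by blast
  then obtain v where v: "norm (D - T v) < e" by blast
  show ?thesis
  proof (intro exI[of _ v] allI impI)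
    show "norm (N0_act act (g i) v - v - Abs_N0 (delta (g i) - delta 0)) < e" if "i < n" for i
      using norm_bounded[of "D - T v" i] v that by (simp add: T D norm_minus_commute)
  qed
qed

section \<open>Finitely supported almost invariant functions and their normalization\<close>

lemma pi_W0I:
  assumes "f \<in> W00" "(\<Sum>g | coord f g \<noteq> 0. coord f g) = c *\<^sub>R 1"
  shows "pi_W0 f = c"
proof -
  have "pi_W0 f *\<^sub>R (1 :: 'b \<Rightarrow>\<^sub>C real) = c *\<^sub>R 1"
    using pi_W0_characterization assms by auto
  then show ?thesis by (simp add: scaleR_cancel_right)
qed

lemma V_act_delta:
  assumes act: "homeo_action act"
  shows "V_act act k (delta g) = delta (k + g)"
  by (auto intro!: coord_eqI bcontfun_eqI
      simp: coord_V_act[OF act] apply_C_act[OF act] delta.rep_eq add.assoc[symmetric])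

text \<open>One third of \<open>e\<close> is the error of \<open>johnson_trivial_approx\<close>;
  replacing \<open>v\<close> by a nearby finitely supported \<open>w\<close> costs another third for
  \<open>w\<close> and, as the action is isometric, a third for its translate.\<close>

lemma johnson_trivial_approx_W00:
  fixes n :: nat and g :: "nat \<Rightarrow> 'g::group_add" and act :: "'g::group_add \<Rightarrow> 'x::topological_space \<Rightarrow> 'x"
  assumes act: "homeo_action act" and J: "johnson_class_trivial act" and e: "0 < e"
  obtains f :: "('g, 'x) ell1_sup" where "f \<in> W00" "pi_W0 f = 1"
    "\<And>i. i < n \<Longrightarrow> norm (f - V_act act (g i) f) < e"
proof -
  have e3: "0 < e / 3" using e by simp
  obtain v :: "('g, 'x) N0" where
    v: "\<And>i. i < n \<Longrightarrow> norm (N0_act act (g i) v - v - Abs_N0 (delta (g i) - delta 0)) < e / 3"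
    using johnson_trivial_approx[OF act J e3, of n g] by blast
  obtain w where w: "w \<in> W00" "(\<Sum>g | coord w g \<noteq> 0. coord w g) = 0" "norm (vec_N0 v - w) < e / 3"
    using closure_norm_approx[OF subsetD[OF N0_set_subset_closure vec_N0] e3, of v] by blast
  have lin: "linear (V_act act k :: ('g, 'x) ell1_sup \<Rightarrow> _)"
    and iso: "norm (V_act act k f) = norm f" for k and f :: "('g, 'x) ell1_sup"
    using isometric_action_V[OF act] by (simp_all add: isometric_action_def)
  let ?f = "delta 0 - w"
  show thesis
  proof (rule that[of ?f])
    show W: "?f \<in> W00" by (intro subspace_diff subspace_W00 delta_W00 w)
    have "(\<Sum>\<^sub>\<infinity>h. coord w h undefined) = 0"
      using infsum_W00[OF w(1), of undefined] w(2) by simp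
    then have "(\<Sum>\<^sub>\<infinity>h. coord ?f h undefined) = 1"
      unfolding linear_diff[OF linear_infsum_coord[of undefined]] by (simp add: infsum_coord_delta)
    then show "pi_W0 ?f = 1"
      using pi_W0_eq[of ?f undefined] W W00_subset_W0 by auto
    fix i assume i: "i < n"
    let ?d = "V_act act (g i) (vec_N0 v) - vec_N0 v - (delta (g i) - delta 0)"
    have "norm ?d < e / 3"
      using v[OF i] by (simp add: norm_N0.rep_eq minus_N0.rep_eq vec_N0_act[OF act] vec_N0_delta_diff)
    moreover have "?f - V_act act (g i) ?f = ?d - V_act act (g i) (vec_N0 v - w) + (vec_N0 v - w)"
      by (simp add: linear_diff[OF lin] V_act_delta[OF act])
    moreover have "norm (a - b + c) \<le> norm a + norm b + norm c" for a b c :: "('g, 'x) ell1_sup"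
      using norm_triangle_ineq[of "a - b" c] norm_triangle_ineq4[of a b] by linarith
    ultimately have "norm (?f - V_act act (g i) ?f) \<le>
        norm ?d + norm (V_act act (g i) (vec_N0 v - w)) + norm (vec_N0 v - w)"
      by metis
    moreover note \<open>norm ?d < e / 3\<close>
    ultimately show "norm (?f - V_act act (g i) ?f) < e"
      using w(3) unfolding iso by linarith
  qed
qed

text \<open>Changing the numerator and then the denominator costs one copy of the l1 distance each,
  since both sums divided by are at least \<open>1\<close>; hence the factor
  \<open>2\<close>.\<close>

lemma sum_abs_normalize_diff:
  fixes a b :: "'i \<Rightarrow> real"
  assumes "1 \<le> (\<Sum>i\<in>I. \<bar>a i\<bar>)" "1 \<le> (\<Sum>i\<in>I. \<bar>b i\<bar>)"
  shows "(\<Sum>i\<in>I. \<bar>\<bar>a i\<bar> / (\<Sum>i\<in>I. \<bar>a i\<bar>) - \<bar>b i\<bar> / (\<Sum>i\<in>I. \<bar>b i\<bar>)\<bar>) \<le> 2 * (\<Sum>i\<in>I. \<bar>a i - b i\<bar>)"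
proof -
  let ?A = "\<Sum>i\<in>I. \<bar>a i\<bar>" and ?B = "\<Sum>i\<in>I. \<bar>b i\<bar>" and ?D = "\<Sum>i\<in>I. \<bar>a i - b i\<bar>"
  have AB: "\<bar>?B - ?A\<bar> \<le> ?D"
  proof -
    have "\<bar>?B - ?A\<bar> \<le> (\<Sum>i\<in>I. \<bar>\<bar>b i\<bar> - \<bar>a i\<bar>\<bar>)"
      unfolding sum_subtractf[symmetric] by (rule sum_abs)
    also have "\<dots> \<le> ?D" by (rule sum_mono) linarith
    finally show ?thesis .
  qed
  have "\<bar>\<bar>a i\<bar> / ?A - \<bar>b i\<bar> / ?B\<bar> \<le> \<bar>a i - b i\<bar> + \<bar>b i\<bar> / ?B * ?D" for i
  proof -
    have "\<bar>a i\<bar> / ?A - \<bar>b i\<bar> / ?B = (\<bar>a i\<bar> - \<bar>b i\<bar>) / ?A + \<bar>b i\<bar> / ?B * ((?B - ?A) / ?A)"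
      using assms by (simp add: divide_simps) (simp add: algebra_simps)
    also have "\<bar>\<dots>\<bar> \<le> \<bar>(\<bar>a i\<bar> - \<bar>b i\<bar>) / ?A\<bar> + \<bar>\<bar>b i\<bar> / ?B * ((?B - ?A) / ?A)\<bar>"
      by (rule abs_triangle_ineq)
    also have "\<bar>(\<bar>a i\<bar> - \<bar>b i\<bar>) / ?A\<bar> \<le> \<bar>a i - b i\<bar>"
    proof -
      have "\<bar>\<bar>a i\<bar> - \<bar>b i\<bar>\<bar> \<le> \<bar>a i - b i\<bar> * ?A"
        using mult_left_mono[OF assms(1) abs_ge_zero, of "a i - b i"] abs_triangle_ineq3[of "a i" "b i"]
        by (simp only: mult_1_right)
      then show ?thesis using assms(1) by (simp add: abs_divide divide_le_eq)
    qed
    also have "\<bar>\<bar>b i\<bar> / ?B * ((?B - ?A) / ?A)\<bar> \<le> \<bar>b i\<bar> / ?B * ?D"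
    proof -
      have "\<bar>?B - ?A\<bar> \<le> ?D * ?A"
        using mult_left_mono[OF assms(1), of ?D] AB by (simp add: sum_nonneg)
      then have "\<bar>(?B - ?A) / ?A\<bar> \<le> ?D"
        using assms(1) by (simp add: abs_divide divide_le_eq)
      then have "\<bar>b i\<bar> / ?B * \<bar>(?B - ?A) / ?A\<bar> \<le> \<bar>b i\<bar> / ?B * ?D"
        using assms(2) by (intro mult_left_mono) auto
      then show ?thesis using assms(2) by (simp add: abs_mult)
    qed
    finally show ?thesis by simp
  qed
  then have "(\<Sum>i\<in>I. \<bar>\<bar>a i\<bar> / ?A - \<bar>b i\<bar> / ?B\<bar>) \<le> (\<Sum>i\<in>I. \<bar>a i - b i\<bar> + \<bar>b i\<bar> / ?B * ?D)"
    by (rule sum_mono)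
  also have "\<dots> = ?D + ?B / ?B * ?D"
    by (simp add: sum.distrib sum_distrib_right[symmetric] sum_divide_distrib[symmetric])
  also have "\<dots> = 2 * ?D" using assms(2) by simp
  finally show ?thesis .
qed

text \<open>As the coordinates of \<open>f\<close> sum to \<open>1\<close>, the sum \<open>A\<close>
  of their absolute values is at least \<open>1\<close> everywhere, so division by it preserves
  continuity. Normalization commutes with the action, which reduces the last bound to a pointwise
  one.\<close>

lemma normalize_W00:
  fixes act :: "'g::group_add \<Rightarrow> 'x::topological_space \<Rightarrow> 'x" and f :: "('g, 'x) ell1_sup"
  assumes act: "homeo_action act" and f: "f \<in> W00" "pi_W0 f = 1"
  obtains p where "p \<in> W00" "pi_W0 p = 1" "\<And>h x. 0 \<le> coord p h x"
    "\<And>g. norm (p - V_act act g p) \<le> 2 * norm (f - V_act act g f)"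
proof -
  define S where "S = {h. coord f h \<noteq> 0}"
  have S: "finite S" using f(1) by (simp add: S_def W00_def)
  define A where "A x = (\<Sum>h\<in>S. \<bar>coord f h x\<bar>)" for x
  have "(\<Sum>h\<in>S. coord f h) = 1"
    using pi_W0_characterization f by (auto simp: S_def)
  then have A1: "1 \<le> A x" for x
  proof -
    have "(\<Sum>h\<in>S. coord f h x) = 1"
      unfolding apply_bcontfun_sum[symmetric] by (simp add: \<open>(\<Sum>h\<in>S. coord f h) = 1\<close>)
    then show ?thesis using sum_abs[of "\<lambda>h. coord f h x" S] unfolding A_def by linarith
  qed
  have A_super: "A x = (\<Sum>h\<in>H. \<bar>coord f h x\<bar>)" if "finite H" "S \<subseteq> H" for H x
    unfolding A_def using that by (intro sum.mono_neutral_left) (auto simp: S_def)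
  have A_ge: "\<bar>coord f h x\<bar> \<le> A x" for h x
    by (subst A_super[of "insert h S"]) (use S in \<open>auto intro!: member_le_sum\<close>)
  define P where "P h = Bcontfun (\<lambda>x. \<bar>coord f h x\<bar> / A x)" for h
  have P: "P h x = \<bar>coord f h x\<bar> / A x" for h x
  proof -
    have "A y \<noteq> 0" "\<bar>A y\<bar> = A y" for y using A1[of y] by auto
    then have "continuous_on UNIV (\<lambda>x. \<bar>coord f h x\<bar> / A x)"
      unfolding A_def by (intro continuous_intros) auto
    moreover have "\<bar>\<bar>coord f h x\<bar> / A x\<bar> \<le> 1" for x
      using A_ge[of h x] A1[of x] by simp
    ultimately show ?thesis unfolding P_def by (subst apply_Bcontfun_bounded) auto
  qed
  have P_sum: "(\<Sum>h\<in>S. P h) = 1"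
    using A1 by (intro bcontfun_eqI)
      (simp add: apply_bcontfun_sum P sum_divide_distrib[symmetric] A_def[symmetric] less_imp_neq[of 0, symmetric]
        order_less_le_trans[of 0 1])
  have "sup_bounded_by 1 P"
    unfolding sup_bounded_by_def
  proof (intro allI impI)
    fix F :: "'g set" and x
    assume F: "finite F"
    have "(\<Sum>h\<in>F. \<bar>P h x\<bar>) = (\<Sum>h\<in>F. \<bar>coord f h x\<bar>) / A x"
      using A1[of x] by (simp add: P sum_divide_distrib)
    also have "(\<Sum>h\<in>F. \<bar>coord f h x\<bar>) \<le> A x"
      by (subst A_super[of "F \<union> S"]) (use F S in \<open>auto intro!: sum_mono2\<close>)
    then have "(\<Sum>h\<in>F. \<bar>coord f h x\<bar>) / A x \<le> 1" using A1[of x] by simp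
    finally show "(\<Sum>h\<in>F. \<bar>P h x\<bar>) \<le> 1" .
  qed
  then have p: "coord (Abs_ell1_sup P) = P" by (rule coord_Abs)
  let ?p = "Abs_ell1_sup P"
  have P0: "P h = 0" if "h \<notin> S" for h
    by (rule bcontfun_eqI) (use that in \<open>simp add: P S_def\<close>)
  have W: "?p \<in> W00"
    by (rule W00I[of S _ 1]) (use S P0 P_sum in \<open>simp_all add: p\<close>)
  have "(\<Sum>h | P h \<noteq> 0. P h) = (\<Sum>h\<in>S. P h)"
    by (rule sum.mono_neutral_left) (use S P0 in auto)
  then have pi: "pi_W0 ?p = 1"
    by (intro pi_W0I[OF W]) (simp add: p P_sum)
  show thesis
  proof (rule that[OF W pi])
    show "0 \<le> coord ?p h x" for h x using A1[of x] by (simp add: p P)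
    fix g
    show "norm (?p - V_act act g ?p) \<le> 2 * norm (f - V_act act g f)"
      unfolding norm_ell1_sup_iff sup_bounded_by_def
    proof (intro allI impI)
      fix F :: "'g set" and x
      assume F: "finite F"
      \<comment> \<open>Contains the support of \<open>f\<close> and its translate by
        \<open>g\<close>, so that sums over it are the full denominators at \<open>x\<close> and at
        \<open>y\<close>.\<close>
      let ?H = "F \<union> S \<union> (\<lambda>h. g + h) ` S"
      define y where "y = act (- g) x"
      define a b where "a h = coord f h x" and "b h = coord f (- g + h) y" for h
      have H: "finite ?H" using F S by simp
      have Aa: "A x = (\<Sum>h\<in>?H. \<bar>a h\<bar>)"
        unfolding a_def by (rule A_super[OF H]) auto
      have "A y = (\<Sum>k\<in>(\<lambda>h. - g + h) ` ?H. \<bar>coord f k y\<bar>)"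
      proof (rule A_super)
        have "h \<in> (\<lambda>h. - g + h) ` (\<lambda>h. g + h) ` S" if "h \<in> S" for h
          using that by (simp add: image_image add.assoc[symmetric])
        then show "S \<subseteq> (\<lambda>h. - g + h) ` ?H" by blast
      qed (use H in simp)
      then have Ab: "A y = (\<Sum>h\<in>?H. \<bar>b h\<bar>)"
        unfolding b_def by (subst (asm) sum.reindex) (auto simp: inj_on_def)
      have "(\<Sum>h\<in>F. \<bar>coord (?p - V_act act g ?p) h x\<bar>) \<le> (\<Sum>h\<in>?H. \<bar>coord (?p - V_act act g ?p) h x\<bar>)"
        by (rule sum_mono2) (use H in auto)
      also have "\<dots> = (\<Sum>h\<in>?H. \<bar>\<bar>a h\<bar> / A x - \<bar>b h\<bar> / A y\<bar>)"
        by (simp add: minus_ell1_sup.rep_eq coord_V_act[OF act] apply_C_act[OF act] p P a_def b_def y_def)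
      also have "\<dots> \<le> 2 * (\<Sum>h\<in>?H. \<bar>a h - b h\<bar>)"
        using sum_abs_normalize_diff[of a ?H b] A1[of x] A1[of y] unfolding Aa Ab by blast
      also have "(\<Sum>h\<in>?H. \<bar>a h - b h\<bar>) = (\<Sum>h\<in>?H. \<bar>coord (f - V_act act g f) h x\<bar>)"
        by (simp add: minus_ell1_sup.rep_eq coord_V_act[OF act] apply_C_act[OF act] a_def b_def y_def)
      also have "\<dots> \<le> norm (f - V_act act g f)"
        by (rule sup_bounded_by_norm[unfolded sup_bounded_by_def, rule_format, OF H])
      finally show "(\<Sum>h\<in>F. \<bar>coord (?p - V_act act g ?p) h x\<bar>) \<le> 2 * norm (f - V_act act g f)"
        by simp
    qed
  qed
qed

text \<open>Countability enumerates the group by \<open>from_nat\<close>: the \<open>n\<close>-th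
  function is almost invariant under the first \<open>n\<close> elements of the enumeration, so
  \<open>g\<close> is covered as soon as \<open>n\<close> exceeds \<open>to_nat g\<close>.\<close>

proposition johnson_trivial_imp_amenable:
  fixes act :: "'g::{group_add, countable} \<Rightarrow> 'x::topological_space \<Rightarrow> 'x"
  assumes act: "homeo_action act" and J: "johnson_class_trivial act"
  shows "topologically_amenable act"
proof -
  have "\<exists>p :: ('g, 'x) ell1_sup. p \<in> W00 \<and> pi_W0 p = 1 \<and> (\<forall>h x. 0 \<le> coord p h x) \<and>
      (\<forall>i<n. norm (p - V_act act (from_nat i) p) \<le> 2 * inverse (real (Suc n)))" for n
  proof -
    obtain f :: "('g, 'x) ell1_sup" where f: "f \<in> W00" "pi_W0 f = 1"
      "\<And>i. i < n \<Longrightarrow> norm (f - V_act act (from_nat i) f) < inverse (real (Suc n))"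
      using johnson_trivial_approx_W00[OF act J, where e = "inverse (real (Suc n))" and g = from_nat and n = n]
      by auto
    obtain p where "p \<in> W00" "pi_W0 p = 1" "\<And>h x. 0 \<le> coord p h x"
      and le: "\<And>g. norm (p - V_act act g p) \<le> 2 * norm (f - V_act act g f)"
      using normalize_W00[OF act f(1,2)] by blast
    moreover have "norm (p - V_act act (from_nat i) p) \<le> 2 * inverse (real (Suc n))" if "i < n" for i
      using le[of "from_nat i"] f(3)[OF that] by linarith
    ultimately show ?thesis by blast
  qed
  then obtain p :: "nat \<Rightarrow> ('g, 'x) ell1_sup" where
    p: "\<And>n. p n \<in> W00" "\<And>n. pi_W0 (p n) = 1" "\<And>n h x. 0 \<le> coord (p n) h x"
    and inv: "\<And>n i. i < n \<Longrightarrow> norm (p n - V_act act (from_nat i) (p n)) \<le> 2 * inverse (real (Suc n))"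
    by metis
  have "(\<lambda>n. norm (p n - V_act act g (p n))) \<longlonglongrightarrow> 0" for g
  proof (rule Lim_null_comparison)
    show "\<forall>\<^sub>F n in sequentially. norm (norm (p n - V_act act g (p n))) \<le> 2 * inverse (real (Suc n))"
      by (rule eventually_mono[OF eventually_gt_at_top[of "to_nat g"]])
        (use inv[of "to_nat g"] in simp)
    show "(\<lambda>n. 2 * inverse (real (Suc n))) \<longlonglongrightarrow> 0"
      by (rule tendsto_mult_right_zero[OF LIMSEQ_inverse_real_of_nat])
  qed
  with p show ?thesis unfolding topologically_amenable_def by blast
qed

text \<open>A Banach space is a type here, so the equivalence with vanishing is split:
  \<open>'e\<close> is arbitrary in one direction, and the other assumes vanishing just for modules
  carried by the dual of \<open>N0\<close>.\<close>

theorem theoremB: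
  fixes act :: "'g::{group_add, countable} \<Rightarrow> 'x::t2_space \<Rightarrow> 'x"
  assumes "compact (UNIV :: 'x set)" and "homeo_action act"
  shows "(topologically_amenable act \<longleftrightarrow> johnson_class_trivial act) \<and>
    (topologically_amenable act \<longrightarrow> ell1_geometric_vanishing TYPE('e::banach) act) \<and>
    (ell1_geometric_vanishing TYPE(('g, 'x) N0 \<Rightarrow>\<^sub>L real) act \<longrightarrow> topologically_amenable act)"
proof -
  note van = amenable_imp_vanishing[OF assms(2)]
  note J = vanishing_imp_johnson_trivial[OF assms(2)] johnson_trivial_imp_amenable[OF assms(2)]
  show ?thesis
    using van[where 'e = 'e] van[where 'e = "('g, 'x) N0 \<Rightarrow>\<^sub>L real"] J by blast
qed

end
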